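(* Let $h:\mathbb{R}\to\mathbb{R}^+$ be a growth rate, let $X$ be a complex Banach space, and let $U=\{U(t_0,s_0)\}_{t_0\ge s_0}$ be an $h$-evolution family on $X$ which is $h$-bounded. Let $\{T_{t_0}\}_{t_0\ge e_*}$ be the associated evolution $h$-semigroup on $C_0(\mathbb{R}_*,X)$ and $B_h$ its generator. The following assertions are equivalent: (1) $\{T_{t_0}\}_{t_0\ge e_*}$ is $h$-hyperbolic on $C_0(\mathbb{R}_*,X)$; (2) $U$ admits an $h$-dichotomy on $X$; (3) $\sigma(B_h)\cap i\mathbb{R}=\varnothing$. In this case, $B_h$ is invertible and, if $h$ is continuously differentiable, its inverse is given by $$(B_h^{-1}g)(t_0)=-\int_{\mathbb{R}}\Gamma_h(t_0,s_0)\,g(s_0)\,d\mu_*(s_0),\qquad g\in C_0(\mathbb{R}_*,X),\ t_0\in\mathbb{R}_*,$$ where $d\mu_*(s_0)=\frac{h'(s_0)}{h(s_0)}\,ds_0$ and, with $P_h(\cdot)$, $Q_h(\cdot)=I-P_h(\cdot)$ the projections of the $h$-dichotomy of $U$, $$\Gamma_h(t_0,s_0)=\begin{cases}U(t_0,s_0)P_h(s_0), & t_0>s_0,\\ -\,U_{Q_h}(s_0,t_0)^{-1}Q_h(s_0), & t_0<s_0.\end{cases}$$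
   Context: A growth rate is a strictly increasing homeomorphism $h:\mathbb{R}\to\mathbb{R}^+=(0,\infty)$. It induces on $\mathbb{R}$ the abelian group law $t*_h s:=h^{-1}(h(t)h(s))$, with neutral element $e_*:=h^{-1}(1)$ and inverse $t^{*-1}:=h^{-1}(1/h(t))$. $\mathbb{R}_*$ denotes $\mathbb{R}$ with this structure; its order and topology are the usual ones of $\mathbb{R}$. $C_0(\mathbb{R}_*,X)$ is the Banach space of continuous functions $u:\mathbb{R}_*\to X$ vanishing at $\pm\infty$, with norm $\|u\|_{*\infty}=\sup_{s}\|u(s)\|_X$. An $h$-evolution family on $X$ is a collection $\{U(t,s)\}_{t\ge s}$ ($t,s\in\mathbb{R}_*$) of bounded linear operators on $X$ with $U(t,t)=\mathrm{Id}$, $U(t,\tau)U(\tau,s)=U(t,s)$ for $t\ge\tau\ge s$, and $(t,s)\mapsto U(t,s)x$ continuous on $\{t\ge s\}$ for each $x\in X$. It is $h$-bounded if there are $\alpha>0$, $K\ge1$ with $\|U(t,s)\|\le K\,(h(t)/h(s))^{\alpha}$ for all $t\ge s$. The associated evolution $h$-semigroup is the family of bounded operators on $C_0(\mathbb{R}_*,X)$ given, for $t\ge e_*$, by $(T_tu)(s):=U(s,s*_h t^{*-1})\,u(s*_h t^{*-1})$. Its generator is $B_hw=\lim_{t\to e_*^+}\frac{T_tw-w}{\ln(h(t))}$ (limit in $C_0(\mathbb{R}_*,X)$), with domain $D(B_h)$ the set of $w$ for which this limit exists. $\rho(B_h)$ is the set of $\lambda\in\mathbb{C}$ such that $\lambda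 I-B_h:D(B_h)\to C_0(\mathbb{R}_*,X)$ is invertible with bounded inverse, and $\sigma(B_h)=\mathbb{C}\setminus\rho(B_h)$. $h$-hyperbolicity: $\{T_{t}\}_{t\ge e_*}$ on a Banach space $Y$ is $h$-hyperbolic if there is a projection $\mathcal{P}_h$ on $Y$ with $T_t\mathcal{P}_h=\mathcal{P}_hT_t$ for all $t\ge e_*$ such that, with $\mathcal{Q}_h=I-\mathcal{P}_h$, the restriction $T_t|_{\mathcal{Q}_hY}:\mathcal{Q}_hY\to\mathcal{Q}_hY$ is invertible for each $t\ge e_*$, and there exist $\nu>0$, $N\ge1$ with $\|T_t\mathcal{P}_hy\|\le N h(t)^{-\nu}\|y\|$ and $\|(T_t|_{\mathcal{Q}_hY})^{-1}\mathcal{Q}_hy\|\le N h(t)^{-\nu}\|y\|$ for all $t\ge e_*$, $y\in Y$. $h$-dichotomy: $U$ admits an $h$-dichotomy if there are projections $P_h(t_0):X\to X$, $t_0\in\mathbb{R}_*$, with $P_h(t_0)U(t_0,s_0)=U(t_0,s_0)P_h(s_0)$ for $t_0\ge s_0$, such that, with $Q_h(t_0)=I-P_h(t_0)$, the restriction $U_{Q_h}(t_0,s_0):Q_h(s_0)X\to Q_h(t_0)X$ of $U(t_0,s_0)$ is invertible for all $t_0\ge s_0$, and there exist $\nu>0$, $N\ge1$ with $\|U(t_0,s_0)P_h(s_0)\|\le N(h(t_0)/h(s_0))^{-\nu}$ and $\|U_{Q_h}(t_0,s_0)^{-1}Q_h(t_0)\|\le N(h(t_0)/h(s_0))^{-\nu}$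 for all $t_0\ge s_0$. *)

theory Defs
  imports "HOL-Analysis.Analysis"
begin

section \<open>Complex Banach spaces\<close>

text \<open>HOL-Analysis only has real normed spaces as type classes, so complex scalar multiplication
  is added on top of them, compatibly with the real one.\<close>

class scaleC =
  fixes scaleC :: "complex \<Rightarrow> 'a \<Rightarrow> 'a"  (infixr \<open>*\<^sub>C\<close> 75)

class complex_banach = banach + scaleC +
  assumes scaleC_add_right: "a *\<^sub>C (x + y) = a *\<^sub>C x + a *\<^sub>C y"
    and scaleC_add_left: "(a + b) *\<^sub>C x = a *\<^sub>C x + b *\<^sub>C x"
    and scaleC_scaleC: "a *\<^sub>C b *\<^sub>C x = (a * b) *\<^sub>C x"
    and scaleC_of_real: "complex_of_real r *\<^sub>C x = r *\<^sub>R x"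
    and norm_scaleC: "norm (a *\<^sub>C x) = cmod a * norm x"

definition bounded_clinear :: "('a::complex_banach \<Rightarrow> 'b::complex_banach) \<Rightarrow> bool" where
  "bounded_clinear f \<longleftrightarrow> bounded_linear f \<and> (\<forall>c x. f (c *\<^sub>C x) = c *\<^sub>C f x)"

definition is_projection :: "('a::complex_banach \<Rightarrow> 'a) \<Rightarrow> bool" where
  "is_projection P \<longleftrightarrow> bounded_clinear P \<and> (\<forall>x. P (P x) = P x)"

lemma bounded_linear_scaleC:
  "bounded_linear (\<lambda>x::'a::complex_banach. c *\<^sub>C x)"
proof (rule bounded_linear_intro)
  fix r :: real and x y :: 'a
  show "c *\<^sub>C (x + y) = c *\<^sub>C x + c *\<^sub>C y"
    by (rule scaleC_add_right)
  show "c *\<^sub>C (r *\<^sub>R x) = r *\<^sub>R (c *\<^sub>C x)"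
    by (metis mult.commute scaleC_of_real scaleC_scaleC)
  show "norm (c *\<^sub>C x) \<le> norm x * cmod c"
    by (simp add: norm_scaleC)
qed

section \<open>The Banach space of continuous functions vanishing at infinity\<close>

typedef (overloaded) ('a::real_normed_vector) c0 =
  "{u :: real \<Rightarrow> 'a. continuous_on UNIV u \<and> (u \<longlongrightarrow> 0) at_top \<and> (u \<longlongrightarrow> 0) at_bot}"
  morphisms c0_apply Abs_c0
  by (intro exI[of _ "\<lambda>_. 0"]) auto

setup_lifting type_definition_c0

lemma c0_eqI: "(\<And>s. c0_apply u s = c0_apply v s) \<Longrightarrow> u = v"
  by transfer auto

lemma continuous_on_c0_apply: "continuous_on UNIV (c0_apply u)"
  and c0_apply_at_top: "(c0_apply u \<longlongrightarrow> 0) at_top"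
  and c0_apply_at_bot: "(c0_apply u \<longlongrightarrow> 0) at_bot"
  using c0_apply[of u] by auto

lemma c0_bcontfun:
  fixes u :: "real \<Rightarrow> 'a::real_normed_vector"
  assumes "continuous_on UNIV u" "(u \<longlongrightarrow> 0) at_top" "(u \<longlongrightarrow> 0) at_bot"
  shows "u \<in> bcontfun"
proof -
  obtain b where b: "\<And>x. x \<ge> b \<Longrightarrow> norm (u x) < 1"
    using tendstoD[OF assms(2), of 1] by (auto simp: eventually_at_top_linorder)
  obtain a where a: "\<And>x. x \<le> a \<Longrightarrow> norm (u x) < 1"
    using tendstoD[OF assms(3), of 1] by (auto simp: eventually_at_bot_linorder)
  have "compact (u ` {a..b})"
    by (intro compact_continuous_image continuous_on_subset[OF assms(1)]) auto
  then have "bounded (u ` {a..b})"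
    by (rule compact_imp_bounded)
  then obtain B where B: "\<forall>y\<in>u ` {a..b}. norm y \<le> B"
    unfolding bounded_iff by (elim exE)
  have "norm (u x) \<le> max 1 B" for x
  proof (cases "x \<in> {a..b}")
    case True
    then have "norm (u x) \<le> B"
      using B by blast
    then show ?thesis by simp
  next
    case False
    then have "x \<le> a \<or> x \<ge> b" by auto
    then have "norm (u x) < 1"
      using a b by blast
    then show ?thesis by simp
  qed
  then show ?thesis
    using assms(1) by (rule bcontfun_normI[rotated])
qed

definition c0_to_bcontfun :: "'a::real_normed_vector c0 \<Rightarrow> (real \<Rightarrow>\<^sub>C 'a)" where
  "c0_to_bcontfun u = Bcontfun (c0_apply u)"

lemma apply_c0_to_bcontfun [simp]: "apply_bcontfun (c0_to_bcontfun u) = c0_apply u"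
  unfolding c0_to_bcontfun_def
  by (rule Bcontfun_inverse)
    (intro c0_bcontfun continuous_on_c0_apply c0_apply_at_top c0_apply_at_bot)

instantiation c0 :: (real_normed_vector) real_vector
begin

lift_definition zero_c0 :: "'a c0" is "\<lambda>_. 0"
  by auto

lift_definition uminus_c0 :: "'a c0 \<Rightarrow> 'a c0" is "\<lambda>u s. - u s"
  by (auto intro!: continuous_intros tendsto_eq_intros)

lift_definition plus_c0 :: "'a c0 \<Rightarrow> 'a c0 \<Rightarrow> 'a c0" is "\<lambda>u v s. u s + v s"
  by (auto intro!: continuous_intros tendsto_eq_intros)

lift_definition minus_c0 :: "'a c0 \<Rightarrow> 'a c0 \<Rightarrow> 'a c0" is "\<lambda>u v s. u s - v s"
  by (auto intro!: continuous_intros tendsto_eq_intros)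

lift_definition scaleR_c0 :: "real \<Rightarrow> 'a c0 \<Rightarrow> 'a c0" is "\<lambda>r u s. r *\<^sub>R u s"
  by (auto intro!: continuous_intros tendsto_eq_intros)

lemmas c0_apply_simps [simp] =
  zero_c0.rep_eq uminus_c0.rep_eq plus_c0.rep_eq minus_c0.rep_eq scaleR_c0.rep_eq

instance
  by standard (auto intro!: c0_eqI simp: algebra_simps)

end

lemma c0_to_bcontfun_minus: "c0_to_bcontfun (u - v) = c0_to_bcontfun u - c0_to_bcontfun v"
  and c0_to_bcontfun_plus: "c0_to_bcontfun (u + v) = c0_to_bcontfun u + c0_to_bcontfun v"
  and c0_to_bcontfun_scaleR: "c0_to_bcontfun (r *\<^sub>R u) = r *\<^sub>R c0_to_bcontfun u"
  and c0_to_bcontfun_zero: "c0_to_bcontfun 0 = 0"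
  by (rule bcontfun_eqI; simp add: minus_bcontfun.rep_eq plus_bcontfun.rep_eq
      scaleR_bcontfun.rep_eq zero_bcontfun.rep_eq)+

lemma c0_to_bcontfun_inject: "c0_to_bcontfun u = c0_to_bcontfun v \<longleftrightarrow> u = v"
  by (metis apply_c0_to_bcontfun c0_eqI)

instantiation c0 :: (real_normed_vector) real_normed_vector
begin

definition norm_c0 :: "'a c0 \<Rightarrow> real" where
  "norm_c0 u = (SUP s. norm (c0_apply u s))"

definition dist_c0 :: "'a c0 \<Rightarrow> 'a c0 \<Rightarrow> real" where
  "dist_c0 u v = norm (u - v)"

definition sgn_c0 :: "'a c0 \<Rightarrow> 'a c0" where
  "sgn_c0 u = u /\<^sub>R norm u"

definition uniformity_c0 :: "('a c0 \<times> 'a c0) filter" where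
  "uniformity_c0 = (INF e\<in>{0 <..}. principal {(x, y). dist x y < e})"

definition open_c0 :: "'a c0 set \<Rightarrow> bool" where
  "open_c0 S = (\<forall>x\<in>S. \<forall>\<^sub>F (x', y) in uniformity. x' = x \<longrightarrow> y \<in> S)"

lemma norm_c0_to_bcontfun: "norm (c0_to_bcontfun u) = norm u"
  by (simp add: norm_c0_def norm_bcontfun_def dist_bcontfun.rep_eq zero_bcontfun.rep_eq)

instance
proof
  fix u v :: "'a c0" and r :: real
  show "norm u = 0 \<longleftrightarrow> u = 0"
    by (metis norm_c0_to_bcontfun c0_to_bcontfun_zero c0_to_bcontfun_inject norm_eq_zero)
  show "norm (u + v) \<le> norm u + norm v"
    by (metis norm_c0_to_bcontfun c0_to_bcontfun_plus norm_triangle_ineq)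
  show "norm (r *\<^sub>R u) = \<bar>r\<bar> * norm u"
    by (metis norm_c0_to_bcontfun c0_to_bcontfun_scaleR norm_scaleR)
qed (rule dist_c0_def sgn_c0_def uniformity_c0_def open_c0_def)+

end

lemma dist_c0_to_bcontfun: "dist (c0_to_bcontfun u) (c0_to_bcontfun v) = dist u v"
  by (metis dist_norm norm_c0_to_bcontfun c0_to_bcontfun_minus)

instance c0 :: (banach) banach
proof
  fix f :: "nat \<Rightarrow> 'a c0"
  let ?g = "\<lambda>n. c0_to_bcontfun (f n)"
  assume "Cauchy f"
  then have "Cauchy ?g"
    by (simp add: Cauchy_def dist_c0_to_bcontfun)
  then obtain l where l: "?g \<longlonglongrightarrow> l"
    using Cauchy_convergent_iff convergent_def by blast
  have unif: "uniform_limit UNIV (\<lambda>n. c0_apply (f n)) (apply_bcontfun l) sequentially"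
    using tendsto_bcontfun_uniform_limit[OF l] by simp
  have lim: "(apply_bcontfun l \<longlongrightarrow> 0) F" if "\<And>u::'a c0. (c0_apply u \<longlongrightarrow> 0) F" for F
    by (rule swap_uniform_limit'[where f = "\<lambda>n. c0_apply (f n)" and g = "\<lambda>_. 0"
          and F = sequentially and S = UNIV])
      (use unif that in auto)
  obtain u where u: "c0_apply u = apply_bcontfun l"
    by (metis (mono_tags, lifting) Abs_c0_inverse c0_apply_at_bot c0_apply_at_top
        continuous_on_apply_bcontfun lim mem_Collect_eq)
  have "c0_to_bcontfun u = l"
    by (rule bcontfun_eqI) (simp add: u)
  with l have "f \<longlonglongrightarrow> u"
    unfolding tendsto_iff by (metis (mono_tags, lifting) dist_c0_to_bcontfun eventually_mono)
  then show "convergent f"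
    by (rule convergentI)
qed

instantiation c0 :: (complex_banach) complex_banach
begin

lift_definition scaleC_c0 :: "complex \<Rightarrow> 'a c0 \<Rightarrow> 'a c0" is "\<lambda>c u s. c *\<^sub>C u s"
proof (intro CollectI conjI; elim CollectE conjE)
  fix c :: complex and u :: "real \<Rightarrow> 'a"
  have lim: "((\<lambda>s. c *\<^sub>C u s) \<longlongrightarrow> 0) F" if "(u \<longlongrightarrow> 0) F" for F
    using bounded_linear.tendsto[OF bounded_linear_scaleC that, of c]
    by (simp add: linear_0[OF bounded_linear.linear[OF bounded_linear_scaleC]])
  show "continuous_on UNIV (\<lambda>s. c *\<^sub>C u s)" if "continuous_on UNIV u"
    using that by (rule bounded_linear.continuous_on[OF bounded_linear_scaleC])
  show "((\<lambda>s. c *\<^sub>C u s) \<longlongrightarrow> 0) at_top" if "(u \<longlongrightarrow> 0) at_top"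
    using that by (rule lim)
  show "((\<lambda>s. c *\<^sub>C u s) \<longlongrightarrow> 0) at_bot" if "(u \<longlongrightarrow> 0) at_bot"
    using that by (rule lim)
qed

lemmas scaleC_c0_apply [simp] = scaleC_c0.rep_eq

instance
proof
  fix a b :: complex and r :: real and u v :: "'a c0"
  show "a *\<^sub>C (u + v) = a *\<^sub>C u + a *\<^sub>C v"
    by (rule c0_eqI) (simp add: scaleC_add_right)
  show "(a + b) *\<^sub>C u = a *\<^sub>C u + b *\<^sub>C u"
    by (rule c0_eqI) (simp add: scaleC_add_left)
  show "a *\<^sub>C b *\<^sub>C u = (a * b) *\<^sub>C u"
    by (rule c0_eqI) (simp add: scaleC_scaleC)
  show "complex_of_real r *\<^sub>C u = r *\<^sub>R u"
    by (rule c0_eqI) (simp add: scaleC_of_real)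
  have le: "norm (a *\<^sub>C u) \<le> cmod a * norm u" for a and u :: "'a c0"
  proof -
    have "norm (c0_apply u s) \<le> norm u" for s
      using norm_bounded[of "c0_to_bcontfun u" s] by (simp add: norm_c0_to_bcontfun)
    then have "norm (c0_to_bcontfun (a *\<^sub>C u)) \<le> cmod a * norm u"
      by (intro norm_bound) (simp add: norm_scaleC mult_left_mono)
    then show ?thesis
      by (simp add: norm_c0_to_bcontfun)
  qed
  show "norm (a *\<^sub>C u) = cmod a * norm u"
  proof (cases "a = 0")
    case True
    then show ?thesis
      using le[of 0 u] by simp
  next
    case False
    have "inverse a *\<^sub>C a *\<^sub>C u = u"
      by (rule c0_eqI) (use False scaleC_of_real[of 1] in \<open>simp add: scaleC_scaleC\<close>)
    then have "norm u \<le> inverse (cmod a) * norm (a *\<^sub>C u)"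
      using le[of "inverse a" "a *\<^sub>C u"] by (simp add: norm_inverse)
    with False have "cmod a * norm u \<le> norm (a *\<^sub>C u)"
      by (simp add: field_simps)
    with le[of a u] show ?thesis
      by simp
  qed
qed

end

section \<open>Growth rates and the induced group structure on the real line\<close>

definition growth_rate :: "(real \<Rightarrow> real) \<Rightarrow> bool" where
  "growth_rate h \<longleftrightarrow> strict_mono h \<and> (\<exists>k. homeomorphism UNIV {0<..} h k)"

definition star_mult :: "(real \<Rightarrow> real) \<Rightarrow> real \<Rightarrow> real \<Rightarrow> real" where
  "star_mult h t s = inv h (h t * h s)"

definition star_unit :: "(real \<Rightarrow> real) \<Rightarrow> real" where
  "star_unit h = inv h 1"

definition star_inverse :: "(real \<Rightarrow> real) \<Rightarrow> real \<Rightarrow> real" where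
  "star_inverse h t = inv h (1 / h t)"

section \<open>Evolution families and dichotomies\<close>

text \<open>\<open>U t s\<close> is only meaningful for \<open>s \<le> t\<close>.\<close>

definition evolution_family :: "(real \<Rightarrow> real \<Rightarrow> 'a::complex_banach \<Rightarrow> 'a) \<Rightarrow> bool" where
  "evolution_family U \<longleftrightarrow>
     (\<forall>t s. s \<le> t \<longrightarrow> bounded_clinear (U t s)) \<and>
     (\<forall>t. U t t = id) \<and>
     (\<forall>t r s. s \<le> r \<longrightarrow> r \<le> t \<longrightarrow> U t r \<circ> U r s = U t s) \<and>
     (\<forall>x. continuous_on {(t, s). s \<le> t} (\<lambda>(t, s). U t s x))"

definition h_bounded ::
  "(real \<Rightarrow> real) \<Rightarrow> (real \<Rightarrow> real \<Rightarrow> 'a::complex_banach \<Rightarrow> 'a) \<Rightarrow> bool" where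
  "h_bounded h U \<longleftrightarrow>
     (\<exists>\<alpha>>0. \<exists>K\<ge>1. \<forall>t s. s \<le> t \<longrightarrow> onorm (U t s) \<le> K * (h t / h s) powr \<alpha>)"

definition compl_proj :: "('a::complex_banach \<Rightarrow> 'a) \<Rightarrow> 'a \<Rightarrow> 'a" where
  "compl_proj P x = x - P x"

text \<open>The inverse of the restriction of \<open>A\<close> to the range of \<open>Q\<close>, composed with the complementary
  projection \<open>Q'\<close> onto the range of the restricted map.\<close>

definition restr_inv ::
  "('a::complex_banach \<Rightarrow> 'a) \<Rightarrow> ('a \<Rightarrow> 'a) \<Rightarrow> ('a \<Rightarrow> 'a) \<Rightarrow> 'a \<Rightarrow> 'a" where
  "restr_inv A Q Q' x = inv_into (range Q) A (Q' x)"

text \<open>Operator norm bounds are stated vectorwise, so that they include boundedness of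
  the inverse on the range of \<open>Q\<close> (\<^const>\<open>onorm\<close> is meaningless on unbounded maps).\<close>

definition is_h_dichotomy ::
  "(real \<Rightarrow> real) \<Rightarrow> (real \<Rightarrow> real \<Rightarrow> 'a::complex_banach \<Rightarrow> 'a) \<Rightarrow> (real \<Rightarrow> 'a \<Rightarrow> 'a) \<Rightarrow> bool" where
  "is_h_dichotomy h U P \<longleftrightarrow>
     (\<forall>t. is_projection (P t)) \<and>
     (\<forall>t s. s \<le> t \<longrightarrow> P t \<circ> U t s = U t s \<circ> P s) \<and>
     (\<forall>t s. s \<le> t \<longrightarrow>
        bij_betw (U t s) (range (compl_proj (P s))) (range (compl_proj (P t)))) \<and>
     (\<exists>\<nu>>0. \<exists>N\<ge>1. \<forall>t s. s \<le> t \<longrightarrow> (\<forall>x.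
        norm (U t s (P s x)) \<le> N * (h t / h s) powr (- \<nu>) * norm x \<and>
        norm (restr_inv (U t s) (compl_proj (P s)) (compl_proj (P t)) x)
          \<le> N * (h t / h s) powr (- \<nu>) * norm x))"

definition admits_h_dichotomy ::
  "(real \<Rightarrow> real) \<Rightarrow> (real \<Rightarrow> real \<Rightarrow> 'a::complex_banach \<Rightarrow> 'a) \<Rightarrow> bool" where
  "admits_h_dichotomy h U \<longleftrightarrow> (\<exists>P. is_h_dichotomy h U P)"

text \<open>The value on the diagonal is immaterial.\<close>

definition green_kernel ::
  "(real \<Rightarrow> real \<Rightarrow> 'a::complex_banach \<Rightarrow> 'a) \<Rightarrow> (real \<Rightarrow> 'a \<Rightarrow> 'a) \<Rightarrow> real \<Rightarrow> real \<Rightarrow> 'a \<Rightarrow> 'a" where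
  "green_kernel U P t s x =
     (if s < t then U t s (P s x)
      else if t < s then - restr_inv (U s t) (compl_proj (P t)) (compl_proj (P s)) x
      else 0)"

section \<open>The evolution semigroup, its generator and hyperbolicity\<close>

definition h_hyperbolic ::
  "(real \<Rightarrow> real) \<Rightarrow> (real \<Rightarrow> 'y::complex_banach \<Rightarrow> 'y) \<Rightarrow> bool" where
  "h_hyperbolic h T \<longleftrightarrow>
     (\<exists>P. is_projection P \<and>
        (\<forall>t\<ge>star_unit h. T t \<circ> P = P \<circ> T t) \<and>
        (\<forall>t\<ge>star_unit h. bij_betw (T t) (range (compl_proj P)) (range (compl_proj P))) \<and>
        (\<exists>\<nu>>0. \<exists>N\<ge>1. \<forall>t\<ge>star_unit h. \<forall>y.
           norm (T t (P y)) \<le> N * h t powr (- \<nu>) * norm y \<and>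
           norm (restr_inv (T t) (compl_proj P) (compl_proj P) y)
             \<le> N * h t powr (- \<nu>) * norm y))"

text \<open>The function under \<^const>\<open>Abs_c0\<close> does lie in the space when \<open>U\<close> is an
  \<open>h\<close>-bounded evolution family and \<open>t\<close> is at least the neutral element;
  see \<open>evol_semigroup_apply\<close> below.\<close>

definition evol_semigroup ::
  "(real \<Rightarrow> real) \<Rightarrow> (real \<Rightarrow> real \<Rightarrow> 'a::complex_banach \<Rightarrow> 'a) \<Rightarrow> real \<Rightarrow> 'a c0 \<Rightarrow> 'a c0" where
  "evol_semigroup h U t u =
     Abs_c0 (\<lambda>s. U s (star_mult h s (star_inverse h t))
                   (c0_apply u (star_mult h s (star_inverse h t))))"

definition gen_limit ::
  "(real \<Rightarrow> real) \<Rightarrow> (real \<Rightarrow> 'y::complex_banach \<Rightarrow> 'y) \<Rightarrow> 'y \<Rightarrow> 'y \<Rightarrow> bool" where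
  "gen_limit h T w v \<longleftrightarrow>
     ((\<lambda>t. (T t w - w) /\<^sub>R ln (h t)) \<longlongrightarrow> v) (at_right (star_unit h))"

definition gen_domain ::
  "(real \<Rightarrow> real) \<Rightarrow> (real \<Rightarrow> 'y::complex_banach \<Rightarrow> 'y) \<Rightarrow> 'y set" where
  "gen_domain h T = {w. \<exists>v. gen_limit h T w v}"

definition generator ::
  "(real \<Rightarrow> real) \<Rightarrow> (real \<Rightarrow> 'y::complex_banach \<Rightarrow> 'y) \<Rightarrow> 'y \<Rightarrow> 'y" where
  "generator h T w = (THE v. gen_limit h T w v)"

text \<open>Operators with domain \<open>D\<close>; values outside \<open>D\<close> are irrelevant.\<close>

definition invertible_on :: "'y::complex_banach set \<Rightarrow> ('y \<Rightarrow> 'y) \<Rightarrow> bool" where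
  "invertible_on D A \<longleftrightarrow> bij_betw A D UNIV \<and> bounded_clinear (inv_into D A)"

definition resolvent_set :: "'y::complex_banach set \<Rightarrow> ('y \<Rightarrow> 'y) \<Rightarrow> complex set" where
  "resolvent_set D A = {z. invertible_on D (\<lambda>w. z *\<^sub>C w - A w)}"

definition op_spectrum :: "'y::complex_banach set \<Rightarrow> ('y \<Rightarrow> 'y) \<Rightarrow> complex set" where
  "op_spectrum D A = - resolvent_set D A"

subsection \<open>Well-definedness of the evolution semigroup\<close>

lemma growth_rate_facts:
  assumes "growth_rate h"
  shows "\<And>t. 0 < h t" "\<And>y. 0 < y \<Longrightarrow> h (inv h y) = y" "\<And>s t. h s \<le> h t \<longleftrightarrow> s \<le> t"
    "continuous_on UNIV h" "continuous_on {0<..} (inv h)"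
proof -
  obtain k where k: "homeomorphism UNIV {0<..} h k" and mono: "strict_mono h"
    using assms by (auto simp: growth_rate_def)
  have range: "range h = {0<..}"
    using k by (simp add: homeomorphism_def)
  then show "0 < h t" for t by blast
  show h_inv: "h (inv h y) = y" if "0 < y" for y
    using range that by (intro f_inv_into_f) auto
  show "h s \<le> h t \<longleftrightarrow> s \<le> t" for s t
    using mono by (rule strict_mono_less_eq)
  show "continuous_on UNIV h"
    using k by (simp add: homeomorphism_def)
  have "inv h y = k y" if "0 < y" for y
    using k h_inv[OF that] by (metis UNIV_I homeomorphism_apply1)
  then show "continuous_on {0<..} (inv h)"
    using k continuous_on_cong[of "{0<..}" "{0<..}" "inv h" k] by (auto simp: homeomorphism_def)
qed

lemma evol_semigroup_apply:
  fixes U :: "real \<Rightarrow> real \<Rightarrow> 'a::complex_banach \<Rightarrow> 'a"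
  assumes h: "growth_rate h" and U: "evolution_family U" and bd: "h_bounded h U"
    and t: "star_unit h \<le> t"
  shows "c0_apply (evol_semigroup h U t u) s =
    U s (star_mult h s (star_inverse h t)) (c0_apply u (star_mult h s (star_inverse h t)))"
proof -
  note hf = growth_rate_facts[OF h]
  define r where "r s = star_mult h s (star_inverse h t)" for s
  have hr: "h (r s) = h s / h t" and r_eq: "r s = inv h (h s / h t)" for s
    using hf(1)[of s] hf(1)[of t] by (simp_all add: r_def star_mult_def star_inverse_def hf(2))
  have ht: "1 \<le> h t"
    using t hf(2)[of 1] hf(3)[of "star_unit h" t] by (simp add: star_unit_def)
  have r_le: "r s \<le> s" for s
  proof -
    have "h (r s) \<le> h s"
      using ht hf(1)[of s] by (simp add: hr divide_le_eq mult_le_cancel_left1)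
    then show ?thesis
      by (simp only: hf(3))
  qed
  have r_cont: "continuous_on UNIV r"
  proof -
    have "h t \<noteq> 0"
      using hf(1)[of t] by simp
    then have "continuous_on UNIV (\<lambda>s. h s / h t)"
      by (intro continuous_intros hf(4)) auto
    then show ?thesis
      unfolding r_eq by (rule continuous_on_compose2[OF hf(5)]) (use hf(1) in auto)
  qed
  have r_ge: "A \<le> r s" if "h A * h t \<le> h s" for A s
  proof -
    have "h A \<le> h (r s)"
      using that hf(1)[of t] by (simp add: hr le_divide_eq)
    then show ?thesis
      by (simp only: hf(3))
  qed
  have r_top: "filterlim r at_top at_top"
    unfolding filterlim_at_top eventually_at_top_linorder
  proof
    fix A
    have "h (inv h (h A * h t)) = h A * h t"
      using hf(1) by (intro hf(2)) simp
    then show "\<exists>N. \<forall>s\<ge>N. A \<le> r s"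
      using r_ge hf(3) by metis
  qed
  have r_bot: "filterlim r at_bot at_bot"
    unfolding filterlim_at_bot eventually_at_bot_linorder
    using r_le order_trans by meson
  obtain \<alpha> K where K: "K \<ge> 1" "\<And>t s. s \<le> t \<Longrightarrow> onorm (U t s) \<le> K * (h t / h s) powr \<alpha>"
    using bd by (auto simp: h_bounded_def)
  have lin: "bounded_linear (U t s)" if "s \<le> t" for t s
    using U that by (auto simp: evolution_family_def bounded_clinear_def)
  define C where "C = K * h t powr \<alpha>"
  have Ub: "norm (U s (r s) x) \<le> norm x * C" for s x
  proof -
    have "h s / h (r s) = h t"
      using hf(1)[of s] hf(1)[of t] by (simp add: hr)
    then have "onorm (U s (r s)) \<le> C"
      using K(2)[OF r_le[of s]] by (simp add: C_def)
    then show ?thesis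
      using onorm[OF lin[OF r_le[of s]], of x]
      by (metis dual_order.trans mult.commute mult_right_mono norm_ge_zero)
  qed
  let ?f = "\<lambda>s. U s (r s) (c0_apply u (r s))"
  have lim: "(?f \<longlongrightarrow> 0) F" if "((\<lambda>s. c0_apply u (r s)) \<longlongrightarrow> 0) F" for F
    by (rule Lim_null_comparison[where g = "\<lambda>s. norm (c0_apply u (r s)) * C"])
      (use Ub that in \<open>auto intro!: tendsto_mult_left_zero tendsto_norm_zero\<close>)
  have "isCont ?f s0" for s0
  proof -
    define x where "x = c0_apply u (r s0)"
    have "continuous_on {(t, s). s \<le> t} (\<lambda>(t, s). U t s x)"
      using U by (simp add: evolution_family_def)
    moreover have "continuous_on UNIV (\<lambda>s. (s, r s))"
      by (intro continuous_on_Pair continuous_on_id r_cont)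
    ultimately have "continuous_on UNIV (\<lambda>s. (\<lambda>(t, s). U t s x) (s, r s))"
      by (rule continuous_on_compose2) (use r_le in auto)
    then have c1: "((\<lambda>s. U s (r s) x) \<longlongrightarrow> U s0 (r s0) x) (at s0)"
      by (simp add: continuous_on_eq_continuous_at isCont_def)
    have "continuous_on UNIV (\<lambda>s. c0_apply u (r s))"
      by (rule continuous_on_compose2[OF continuous_on_c0_apply r_cont]) auto
    then have "((\<lambda>s. c0_apply u (r s) - x) \<longlongrightarrow> 0) (at s0)"
      unfolding x_def
      by (intro LIM_zero) (simp add: continuous_on_eq_continuous_at isCont_def)
    then have "((\<lambda>s. norm (c0_apply u (r s) - x) * C) \<longlongrightarrow> 0) (at s0)"
      by (intro tendsto_mult_left_zero tendsto_norm_zero)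
    then have "((\<lambda>s. U s (r s) (c0_apply u (r s) - x)) \<longlongrightarrow> 0) (at s0)"
      by (rule Lim_null_comparison[rotated]) (simp add: Ub)
    from tendsto_add[OF c1 this] show ?thesis
      by (simp add: isCont_def x_def linear_diff[OF bounded_linear.linear[OF lin[OF r_le]]])
  qed
  then have "?f \<in> {u. continuous_on UNIV u \<and> (u \<longlongrightarrow> 0) at_top \<and> (u \<longlongrightarrow> 0) at_bot}"
    using lim[OF filterlim_compose[OF c0_apply_at_top r_top]]
      lim[OF filterlim_compose[OF c0_apply_at_bot r_bot]]
    by (simp add: continuous_on_eq_continuous_at)
  from Abs_c0_inverse[OF this] show ?thesis
    by (simp add: evol_semigroup_def r_def)
qed

end

theory Submission
  imports Defs
begin

text \<open>In the logarithmic time \<open>lg = ln \<circ> h\<close> everything becomes exponential, so that \<open>T\<close> is an ordinary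
  \<open>C\<^sub>0\<close>-semigroup \<open>S\<close> and its generator is the usual one.

  A dichotomy gives hyperbolicity by letting \<open>P\<close> and the inverses of \<open>U\<close> on the range of \<open>Q\<close> act pointwise.
  For a hyperbolic \<open>S\<close> and large \<open>t\<close>, \<open>S t - I\<close> is invertible by a contraction argument, and since
  the generator \<open>B\<close> satisfies \<open>B \<circ> (\<integral>\<^sub>0\<^sup>t S) = S t - I\<close>, so is \<open>B\<close>; rotating \<open>S\<close> by unimodular factors
  moves any point of the imaginary axis to \<open>0\<close>. If, conversely, \<open>B\<close> is merely invertible, solve \<open>B u = - g\<close> for
  a source \<open>g\<close> that adds \<open>x\<close> to the trajectories right after time \<open>s\<close>: the solution
  splits \<open>x\<close> into a part decaying forwards and a part decaying backwards. Multiplying trajectories by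
  slowly growing cut-offs and using the bound on the inverse of \<open>B\<close> once more yields exponential rates.\<close>

section \<open>Preliminaries\<close>

text \<open>The implications form the cycle dichotomy, hyperbolicity, spectral condition, dichotomy.
  Two obstacles shape the argument. A dichotomy does not say how its projections depend on time, so
  their strong continuity has to be extracted from that of \<open>U\<close> before they can act
  pointwise on \<open>c0\<close>. And an element \<open>u\<close> of the domain of \<open>B\<close>
  need not be differentiable as a function: the generator only compares \<open>u\<close> at time s
  with the value transported to s from s - \<tau>. What does have a derivative is \<open>u\<close>
  transported to one fixed later time, and this derivative is minus the transported
  \<open>B u\<close>. That fact gives both the explicit solutions behind the splitting and the Green
  formula, where it is integrated after applying the projection (for times before t) or the backward
  inverses (for times after t).\<close>

lemma bounded_clinear_bounded_linear: "bounded_clinear f \<Longrightarrow> bounded_linear f"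
  by (simp add: bounded_clinear_def)

lemma bounded_clinear_linear: "bounded_clinear f \<Longrightarrow> linear f"
  by (simp add: bounded_clinear_def bounded_linear.linear)

lemma bounded_clinear_scaleC: "bounded_clinear f \<Longrightarrow> f (c *\<^sub>C x) = c *\<^sub>C f x"
  by (simp add: bounded_clinear_def)

lemma bounded_clinearI:
  assumes "\<And>x y. f (x + y) = f x + f y" and "\<And>c x. f (c *\<^sub>C x) = c *\<^sub>C f x"
    and "\<And>x. norm (f x) \<le> b * norm x"
  shows "bounded_clinear f"
  unfolding bounded_clinear_def
proof
  show "bounded_linear f"
  proof (rule bounded_linear_intro[where K = b])
    show "f (r *\<^sub>R x) = r *\<^sub>R f x" for r x
      by (metis assms(2) scaleC_of_real)
    show "norm (f x) \<le> norm x * b" for x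
      using assms(3)[of x] by (simp add: mult.commute)
  qed (rule assms(1))
qed (use assms in blast)

lemma scaleC_zero_right [simp]: "c *\<^sub>C (0::'a::complex_banach) = 0"
  using norm_scaleC[of c "0::'a"] by simp

lemma scaleC_one [simp]: "1 *\<^sub>C (x::'a::complex_banach) = x"
  using scaleC_of_real[of 1 x] by simp

lemma scaleC_zero_left [simp]: "0 *\<^sub>C (x::'a::complex_banach) = 0"
  using scaleC_of_real[of 0 x] by simp

lemma scaleC_minus_right: "c *\<^sub>C (- x) = - (c *\<^sub>C (x::'a::complex_banach))"
  by (rule linear_neg[OF bounded_linear.linear[OF bounded_linear_scaleC]])

lemma scaleC_diff_right: "c *\<^sub>C (x - y) = c *\<^sub>C x - c *\<^sub>C (y::'a::complex_banach)"
  by (rule linear_diff[OF bounded_linear.linear[OF bounded_linear_scaleC]])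

lemma scaleC_minus_left: "(- c) *\<^sub>C x = - (c *\<^sub>C (x::'a::complex_banach))"
  using scaleC_add_left[of c "- c" x] by (simp add: add_eq_0_iff)

lemma scaleC_diff_left: "(a - b) *\<^sub>C x = a *\<^sub>C x - b *\<^sub>C (x::'a::complex_banach)"
  using scaleC_add_left[of a "- b" x] by (simp add: scaleC_minus_left)

lemma scaleC_scaleR: "c *\<^sub>C (r *\<^sub>R x) = r *\<^sub>R (c *\<^sub>C (x::'a::complex_banach))"
  by (rule linear_cmul[OF bounded_linear.linear[OF bounded_linear_scaleC]])

lemma norm_c0_ge: "norm (c0_apply u s) \<le> norm u"
  using norm_bounded[of "c0_to_bcontfun u" s] by (simp add: norm_c0_to_bcontfun)

lemma norm_c0_le: "(\<And>s. norm (c0_apply u s) \<le> b) \<Longrightarrow> norm u \<le> b"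
  unfolding norm_c0_def by (rule cSUP_least) auto

text \<open>The carrier of \<open>c0\<close> as a set of plain functions, so that membership can be
  argued before \<open>Abs_c0\<close> is applied.\<close>

definition vanishing :: "(real \<Rightarrow> 'a::real_normed_vector) set" where
  "vanishing = {u. continuous_on UNIV u \<and> (u \<longlongrightarrow> 0) at_top \<and> (u \<longlongrightarrow> 0) at_bot}"

lemma c0_apply_vanishing: "c0_apply u \<in> vanishing"
  by (simp add: vanishing_def continuous_on_c0_apply c0_apply_at_top c0_apply_at_bot)

lemma c0_apply_Abs_c0: "u \<in> vanishing \<Longrightarrow> c0_apply (Abs_c0 u) = u"
  by (rule Abs_c0_inverse) (simp add: vanishing_def)

lemma vanishing_compose:
  assumes "u \<in> vanishing" "continuous_on UNIV f" "filterlim f at_top at_top"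
    "filterlim f at_bot at_bot"
  shows "(\<lambda>s. u (f s)) \<in> vanishing"
  using assms continuous_on_compose2[of UNIV u UNIV f]
  by (auto simp: vanishing_def intro: filterlim_compose)

lemma tendsto_zero_comparison:
  assumes "(f \<longlongrightarrow> (0::'a::real_normed_vector)) F" "\<And>s. norm (g s) \<le> b * norm (f s)"
  shows "(g \<longlongrightarrow> 0) F"
  by (rule Lim_null_comparison[where g = "\<lambda>s. b * norm (f s)"])
    (use assms in \<open>auto intro!: tendsto_mult_right_zero tendsto_norm_zero\<close>)

lemma vanishing_comparison:
  assumes "u \<in> vanishing" "continuous_on UNIV v" "\<And>s. norm (v s) \<le> b * norm (u s)"
  shows "v \<in> vanishing"
  using assms tendsto_zero_comparison[of u _ v b] by (auto simp: vanishing_def)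

text \<open>The operators below shift time: the image at \<open>s\<close> is estimated by
  \<open>u\<close> at another time \<open>r\<close>, a difference that the supremum norm does not
  see.\<close>

lemma norm_c0_le_scaled:
  assumes "b \<ge> 0" "\<And>s. \<exists>r. norm (c0_apply v s) \<le> b * norm (c0_apply u r)"
  shows "norm v \<le> b * norm u"
proof (rule norm_c0_le)
  fix s
  obtain r where "norm (c0_apply v s) \<le> b * norm (c0_apply u r)"
    using assms(2) by blast
  also have "\<dots> \<le> b * norm u"
    using assms(1) norm_c0_ge[of u r] by (rule mult_left_mono[rotated])
  finally show "norm (c0_apply v s) \<le> b * norm u" .
qed

section \<open>Logarithmic time\<close>

locale h_evolution =
  fixes h :: "real \<Rightarrow> real" and U :: "real \<Rightarrow> real \<Rightarrow> 'a::complex_banach \<Rightarrow> 'a"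
    and \<alpha> K :: real
  assumes growth: "growth_rate h" and evol: "evolution_family U"
    and alpha_pos: "\<alpha> > 0" and K_ge_1: "K \<ge> 1"
    and onorm_U: "\<And>t s. s \<le> t \<Longrightarrow> onorm (U t s) \<le> K * (h t / h s) powr \<alpha>"
begin

text \<open>An isomorphism of the group R_* onto the additive reals that preserves order and
  topology; its inverse is \<open>ex\<close>.\<close>

definition lg :: "real \<Rightarrow> real" where "lg s = ln (h s)"

definition ex :: "real \<Rightarrow> real" where "ex \<tau> = inv h (exp \<tau>)"

lemmas h_facts = growth_rate_facts[OF growth]

lemma h_lg: "h s = exp (lg s)"
  by (simp add: lg_def h_facts(1))

lemma lg_ex [simp]: "lg (ex \<tau>) = \<tau>"
  by (simp add: lg_def ex_def h_facts(2))

lemma ex_lg [simp]: "ex (lg s) = s"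
  by (metis h_facts(3) h_lg lg_ex order_antisym order_refl)

lemma lg_le_iff [simp]: "lg s \<le> lg t \<longleftrightarrow> s \<le> t"
  using h_facts(3)[of s t] by (simp add: h_lg)

lemma lg_less_iff [simp]: "lg s < lg t \<longleftrightarrow> s < t"
  by (simp add: not_le[symmetric])

lemma ex_le_iff [simp]: "ex s \<le> ex t \<longleftrightarrow> s \<le> t"
  using lg_le_iff[of "ex s" "ex t"] by (simp del: lg_le_iff)

lemma ex_less_iff [simp]: "ex s < ex t \<longleftrightarrow> s < t"
  by (simp add: not_le[symmetric])

lemma ex_eq_iff [simp]: "ex s = ex t \<longleftrightarrow> s = t"
  by (metis lg_ex)

lemma le_ex_iff: "s \<le> ex t \<longleftrightarrow> lg s \<le> t"
  using lg_le_iff[of s "ex t"] by (simp del: lg_le_iff)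

lemma ex_le_iff': "ex s \<le> t \<longleftrightarrow> s \<le> lg t"
  using lg_le_iff[of "ex s" t] by (simp del: lg_le_iff)

lemma continuous_on_lg: "continuous_on S lg"
proof -
  have "continuous_on UNIV (\<lambda>s. ln (h s))"
    using h_facts(1,4) by (intro continuous_intros) (auto simp: less_le)
  then show ?thesis
    unfolding lg_def by (rule continuous_on_subset) simp
qed

lemma continuous_on_ex: "continuous_on S ex"
  unfolding ex_def
  by (rule continuous_on_compose2[OF h_facts(5)]) (auto intro!: continuous_intros)

lemma filterlim_lg: "filterlim lg at_top at_top" "filterlim lg at_bot at_bot"
  unfolding filterlim_at_top filterlim_at_bot eventually_at_top_linorder eventually_at_bot_linorder
  using le_ex_iff ex_le_iff' by blast+

lemma filterlim_ex: "filterlim ex at_top at_top" "filterlim ex at_bot at_bot"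
  unfolding filterlim_at_top filterlim_at_bot eventually_at_top_linorder eventually_at_bot_linorder
  using le_ex_iff ex_le_iff' by blast+

lemma star_unit_eq: "star_unit h = ex 0"
  by (simp add: star_unit_def ex_def)

lemma star_mult_eq: "star_mult h s t = ex (lg s + lg t)"
  by (simp add: star_mult_def ex_def h_lg exp_add)

lemma star_inverse_eq: "star_inverse h t = ex (- lg t)"
  by (simp add: star_inverse_def ex_def h_lg exp_minus field_simps)

lemma U_clin: "s \<le> t \<Longrightarrow> bounded_clinear (U t s)"
  using evol by (simp add: evolution_family_def)

lemmas U_blin = bounded_clinear_bounded_linear[OF U_clin]
lemmas U_lin = bounded_clinear_linear[OF U_clin]

lemma U_refl [simp]: "U t t x = x"
  using evol by (simp add: evolution_family_def)

lemma U_comp: "s \<le> r \<Longrightarrow> r \<le> t \<Longrightarrow> U t r (U r s x) = U t s x"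
  using evol by (auto simp: evolution_family_def fun_eq_iff)

lemma norm_U_le: 
  assumes "s \<le> t"
  shows "norm (U t s x) \<le> K * exp (\<alpha> * (lg t - lg s)) * norm x"
proof -
  have "norm (U t s x) \<le> onorm (U t s) * norm x"
    by (rule onorm[OF U_blin[OF assms]])
  also have "\<dots> \<le> (K * (h t / h s) powr \<alpha>) * norm x"
    by (rule mult_right_mono[OF onorm_U[OF assms]]) simp
  also have "(h t / h s) powr \<alpha> = exp (\<alpha> * (lg t - lg s))"
    by (simp add: h_lg powr_def ln_div)
  finally show ?thesis .
qed

text \<open>Strong continuity concerns a fixed vector, so \<open>w z\<close> is split into
  \<open>w z0\<close> and a remainder tending to 0; the growth bound, whose factor converges as z
  tends to z0, sends the image of the remainder to 0 as well.\<close>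

lemma continuous_on_U:
  assumes p: "continuous_on S p" and q: "continuous_on S q" and w: "continuous_on S w"
    and le: "\<And>z. z \<in> S \<Longrightarrow> q z \<le> p z"
  shows "continuous_on S (\<lambda>z. U (p z) (q z) (w z))"
  unfolding continuous_on_def
proof
  fix z0 assume z0: "z0 \<in> S"
  let ?x = "w z0"
  have lim: "(p \<longlongrightarrow> p z0) (at z0 within S)" "(q \<longlongrightarrow> q z0) (at z0 within S)"
    "(w \<longlongrightarrow> ?x) (at z0 within S)"
    using p q w z0 by (auto simp: continuous_on_def)
  have "continuous_on {(t, s). s \<le> t} (\<lambda>(t, s). U t s ?x)"
    using evol by (simp add: evolution_family_def)
  then have "continuous_on S (\<lambda>z. (\<lambda>(t, s). U t s ?x) (p z, q z))"
    by (rule continuous_on_compose2) (auto intro!: continuous_intros p q le)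
  then have 1: "((\<lambda>z. U (p z) (q z) ?x) \<longlongrightarrow> U (p z0) (q z0) ?x) (at z0 within S)"
    using z0 by (auto simp: continuous_on_def)
  have lg: "((\<lambda>z. lg (f z)) \<longlongrightarrow> lg (f z0)) (at z0 within S)"
    if "(f \<longlongrightarrow> f z0) (at z0 within S)" for f
    using continuous_on_lg[of UNIV] that
    by (metis UNIV_I continuous_on_eq_continuous_at isCont_tendsto_compose open_UNIV)
  have "((\<lambda>z. K * exp (\<alpha> * (lg (p z) - lg (q z))) * norm (w z - ?x)) \<longlongrightarrow>
      K * exp (\<alpha> * (lg (p z0) - lg (q z0))) * norm (?x - ?x)) (at z0 within S)"
    by (intro tendsto_intros lg lim)
  then have "((\<lambda>z. K * exp (\<alpha> * (lg (p z) - lg (q z))) * norm (w z - ?x)) \<longlongrightarrow> 0) (at z0 within S)"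
    by simp
  then have "((\<lambda>z. U (p z) (q z) (w z - ?x)) \<longlongrightarrow> 0) (at z0 within S)"
    by (rule Lim_null_comparison[rotated])
      (auto simp: eventually_at_filter intro!: always_eventually norm_U_le le)
  from tendsto_add[OF 1 this]
  have "((\<lambda>z. U (p z) (q z) ?x + U (p z) (q z) (w z - ?x)) \<longlongrightarrow> U (p z0) (q z0) ?x) (at z0 within S)"
    by simp
  then show "((\<lambda>z. U (p z) (q z) (w z)) \<longlongrightarrow> U (p z0) (q z0) ?x) (at z0 within S)"
    by (rule Lim_transform_eventually)
      (auto simp: eventually_at_filter linear_diff[OF U_lin[OF le]] intro!: always_eventually)
qed

end

section \<open>Hyperbolic semigroups\<close>

lemma growth_rate_exp: "growth_rate exp"
  unfolding growth_rate_def
proof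
  show "strict_mono (exp :: real \<Rightarrow> real)"
    by (simp add: strict_mono_def)
  have "continuous_on {0<..} (ln :: real \<Rightarrow> real)"
    by (intro continuous_intros) auto
  moreover have "range (exp :: real \<Rightarrow> real) = {0<..}"
    by (auto simp: image_iff) (metis exp_ln)
  moreover have "ln ` {0<..} = (UNIV :: real set)"
    by (auto simp: image_iff intro!: bexI[of _ "exp _"])
  ultimately show "\<exists>k. homeomorphism UNIV {0<..} (exp :: real \<Rightarrow> real) k"
    by (intro exI[of _ ln]) (auto simp: homeomorphism_def intro!: continuous_intros)
qed

lemma star_unit_exp [simp]: "star_unit exp = 0"
  unfolding star_unit_def by (rule inv_f_eq) (auto simp: inj_def)

lemma right_difference_quotient:
  fixes f :: "real \<Rightarrow> 'a::real_normed_vector"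
  assumes "(f has_vector_derivative D) (at x within {x..b})" "x < b"
  shows "((\<lambda>\<tau>. (f (x + \<tau>) - f x) /\<^sub>R \<tau>) \<longlongrightarrow> D) (at_right 0)"
  unfolding tendsto_iff
proof (intro allI impI)
  fix e :: real assume e: "e > 0"
  have "\<exists>d>0. \<forall>y\<in>{x..b}. norm (y - x) < d \<longrightarrow>
      norm (f y - f x - (y - x) *\<^sub>R D) \<le> e / 2 * norm (y - x)"
    using assms(1) e half_gt_zero[OF e]
    unfolding has_vector_derivative_def has_derivative_within_alt by blast
  then obtain d where d: "d > 0" "\<And>y. y \<in> {x..b} \<Longrightarrow> norm (y - x) < d \<Longrightarrow>
      norm (f y - f x - (y - x) *\<^sub>R D) \<le> e / 2 * norm (y - x)"
    by blast
  have "dist ((f (x + \<tau>) - f x) /\<^sub>R \<tau>) D < e" if "0 < \<tau>" "\<tau> < min d (b - x)" for \<tau>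
  proof -
    have "norm (f (x + \<tau>) - f x - \<tau> *\<^sub>R D) \<le> e / 2 * \<tau>"
      using d(2)[of "x + \<tau>"] that by auto
    moreover have "(f (x + \<tau>) - f x) /\<^sub>R \<tau> - D = (f (x + \<tau>) - f x - \<tau> *\<^sub>R D) /\<^sub>R \<tau>"
      using that by (simp add: scaleR_diff_right)
    then have "dist ((f (x + \<tau>) - f x) /\<^sub>R \<tau>) D = norm (f (x + \<tau>) - f x - \<tau> *\<^sub>R D) / \<tau>"
      using that by (simp only: dist_norm norm_scaleR) (simp add: divide_inverse)
    ultimately have "dist ((f (x + \<tau>) - f x) /\<^sub>R \<tau>) D \<le> e / 2"
      using that by (simp add: pos_divide_le_eq)
    then show ?thesis
      using e by simp
  qed
  then show "\<forall>\<^sub>F \<tau> in at_right 0. dist ((f (x + \<tau>) - f x) /\<^sub>R \<tau>) D < e"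
    using d(1) assms(2) by (intro eventually_at_rightI[of 0 "min d (b - x)"]) auto
qed

lemma bounded_bilinear_scaleC:
  "bounded_bilinear (scaleC :: complex \<Rightarrow> 'a::complex_banach \<Rightarrow> 'a)"
proof
  show "(r *\<^sub>R a) *\<^sub>C b = r *\<^sub>R (a *\<^sub>C b)" for r a and b :: 'a
    by (metis scaleC_of_real scaleC_scaleC scaleR_conv_of_real)
  show "\<exists>K. \<forall>a b. norm (a *\<^sub>C (b::'a)) \<le> norm a * norm b * K"
    by (intro exI[of _ 1]) (simp add: norm_scaleC)
qed (rule scaleC_add_left scaleC_add_right scaleC_scaleR)+

lemma gen_limit_unique:
  assumes "gen_limit h T w v" "gen_limit h T w v'"
  shows "v = v'"
  using assms unfolding gen_limit_def by (rule tendsto_unique[rotated]) simp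

lemma generator_eq: "gen_limit h T w v \<Longrightarrow> generator h T w = v"
  unfolding generator_def by (rule the_equality) (auto intro: gen_limit_unique)

lemma gen_limit_generator: "w \<in> gen_domain h T \<Longrightarrow> gen_limit h T w (generator h T w)"
  using generator_eq by (auto simp: gen_domain_def)

text \<open>With B the generator, the hypothesis says that \<open>J\<close> and B - z have mutually
  inverse graphs. The resolvent is about z - B, so its inverse is \<open>J\<close> after a change of
  sign.\<close>

lemma invertible_on_shifted_generator:
  assumes J: "bounded_clinear J" and iff: "\<And>w v. gen_limit h T w v \<longleftrightarrow> w = J (v - z *\<^sub>C w)"
  shows "invertible_on (gen_domain h T) (\<lambda>w. z *\<^sub>C w - generator h T w)"
proof -
  let ?D = "gen_domain h T" and ?A = "\<lambda>w. z *\<^sub>C w - generator h T w"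
  have J_in: "J (- g) \<in> ?D" and A_J: "?A (J (- g)) = g" for g
  proof -
    have "gen_limit h T (J (- g)) (z *\<^sub>C J (- g) - g)"
      by (subst iff) simp
    then show "J (- g) \<in> ?D" "?A (J (- g)) = g"
      by (auto simp: gen_domain_def generator_eq)
  qed
  have J_A: "J (- ?A w) = w" if "w \<in> ?D" for w
    using gen_limit_generator[OF that] by (simp add: iff)
  have inj: "inj_on ?A ?D"
    by (rule inj_on_inverseI[of _ "\<lambda>g. J (- g)"]) (rule J_A)
  have "g \<in> ?A ` ?D" for g
    by (rule image_eqI[where x = "J (- g)"]) (rule A_J[symmetric], rule J_in)
  then have "?A ` ?D = UNIV"
    by blast
  moreover have "inv_into ?D ?A g = J (- g)" for g
    by (rule inv_into_f_eq[OF inj]) (rule J_in, rule A_J)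
  then have "inv_into ?D ?A = (\<lambda>g. J (- g))"
    by blast
  moreover have "bounded_clinear (\<lambda>g. J (- g))"
    using J bounded_linear_compose[OF bounded_clinear_bounded_linear[OF J]
        bounded_linear_minus[OF bounded_linear_ident]]
    by (simp add: bounded_clinear_def flip: scaleC_minus_right)
  ultimately show ?thesis
    using inj by (simp add: invertible_on_def bij_betw_def)
qed

text \<open>The fixed point equation below splits \<open>A y - y = z\<close> along \<open>P\<close>: on the range of \<open>P\<close> it reads
  \<open>y = A y - z\<close>, on the kernel of \<open>P\<close>, where \<open>W\<close> inverts \<open>A\<close>, it reads \<open>y = W (y + z)\<close>.\<close>

lemma hyperbolic_resolvent:
  fixes A P W :: "'y::complex_banach \<Rightarrow> 'y"
  assumes A: "bounded_clinear A" and P: "is_projection P" and AP: "\<And>x. A (P x) = P (A x)"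
    and PW: "\<And>y. P (W y) = 0" and AW: "\<And>y. A (W y) = y - P y"
    and inj: "\<And>y. P y = 0 \<Longrightarrow> A y = 0 \<Longrightarrow> y = 0"
    and nA: "\<And>y. norm (A (P y)) \<le> norm y / 4" and nW: "\<And>y. norm (W y) \<le> norm y / 4"
  obtains R where "bounded_clinear R" "\<And>y z. A y - y = z \<longleftrightarrow> y = R z"
proof -
  have Pc: "bounded_clinear P" and PP: "P (P y) = P y" for y
    using P by (auto simp: is_projection_def)
  note [simp] = linear_add[OF bounded_clinear_linear[OF A]] linear_diff[OF bounded_clinear_linear[OF A]]
    linear_add[OF bounded_clinear_linear[OF Pc]] linear_diff[OF bounded_clinear_linear[OF Pc]]
    linear_0[OF bounded_clinear_linear[OF Pc]]
    bounded_clinear_scaleC[OF A] bounded_clinear_scaleC[OF Pc] PP PW AW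
  \<comment> \<open>\<open>W\<close> is only given as a map with values in the kernel of
    \<open>P\<close>; injectivity of \<open>A\<close> on that kernel determines it, and linearity
    follows from this uniqueness.\<close>
  have W_eqI: "W y = x" if "P x = 0" "A x = y - P y" for x y
    using inj[of "W y - x"] that by simp
  have W_add: "W (x + y) = W x + W y" for x y
    by (rule W_eqI) simp_all
  have W_diff: "W (x - y) = W x - W y" for x y
    by (rule W_eqI) simp_all
  have W_scaleC: "W (c *\<^sub>C x) = c *\<^sub>C W x" for c x
    by (rule W_eqI) (simp_all add: scaleC_diff_right)
  let ?f = "\<lambda>z y. A (P y) + W y + (W z - P z)"
  have iff: "A y - y = z \<longleftrightarrow> ?f z y = y" for y z
  proof
    assume "A y - y = z"
    then have Ay: "A y = y + z" by (simp add: algebra_simps)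
    then have "A (P y) = P y + P z"
      by (simp add: AP)
    moreover have "W (y + z) = y - P y"
      by (rule W_eqI) (simp_all add: Ay AP)
    ultimately show "?f z y = y"
      by (simp add: W_add algebra_simps)
  next
    assume y: "?f z y = y"
    have "P y = A (P y) - P z"
      using arg_cong[OF y, of P] by (simp add: AP)
    moreover from this have "y - P y = ?f z y - (A (P y) - P z)"
      using y by simp
    then have "y - P y = W y + W z"
      by simp
    then have "A (y - P y) = A (W y) + A (W z)"
      by simp
    ultimately show "A y - y = z"
      by (simp add: algebra_simps)
  qed
  have ex1: "\<exists>!y. ?f z y = y" for z
  proof (rule banach_fix_type[of "1/2"]; (intro allI)?)
    fix x y
    have "?f z x - ?f z y = A (P (x - y)) + W (x - y)"
      by (simp add: W_diff)
    then have "norm (?f z x - ?f z y) \<le> norm (A (P (x - y))) + norm (W (x - y))"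
      by (simp only: norm_triangle_ineq)
    with nA[of "x - y"] nW[of "x - y"] show "dist (?f z x) (?f z y) \<le> 1 / 2 * dist x y"
      by (simp add: dist_norm)
  qed auto
  define R where "R z = (THE y. ?f z y = y)" for z
  have R: "A y - y = z \<longleftrightarrow> y = R z" for y z
    unfolding iff R_def using theI'[OF ex1[of z]] the1_equality[OF ex1[of z], of y] by auto
  have AR: "A (R z) - R z = z" for z
    by (simp add: R)
  obtain p where p: "p > 0" "\<And>z. norm (P z) \<le> norm z * p"
    using bounded_linear.pos_bounded[OF bounded_clinear_bounded_linear[OF Pc]] by blast
  have "bounded_clinear R"
  proof (rule bounded_clinearI)
    show "R (x + y) = R x + R y" for x y
      using AR[of x] AR[of y] by (intro R[THEN iffD1, symmetric]) (simp add: algebra_simps)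
    show "R (c *\<^sub>C x) = c *\<^sub>C R x" for c x
      using AR[of x] by (intro R[THEN iffD1, symmetric]) (simp flip: scaleC_diff_right)
    \<comment> \<open>The fixed point equation bounds the norm of \<open>R z\<close> by half of
      itself plus 1/4 + p times the norm of z; absorbing the half doubles the constant.\<close>
    show "norm (R z) \<le> (2 * (1/4 + p)) * norm z" for z
    proof -
      let ?y = "R z"
      have y: "A (P ?y) + W ?y + (W z - P z) = ?y"
        using AR[of z] iff[of ?y z] by simp
      have "norm (A (P ?y) + W ?y + (W z - P z)) \<le>
          norm (A (P ?y)) + norm (W ?y) + (norm (W z) + norm (P z))"
        by (intro norm_triangle_le add_mono norm_triangle_ineq norm_triangle_ineq4)
      then have "norm ?y \<le> norm (A (P ?y)) + norm (W ?y) + (norm (W z) + norm (P z))"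
        unfolding y .
      with nA[of ?y] nW[of ?y] nW[of z] p(2)[of z] show ?thesis
        by (simp add: algebra_simps)
    qed
  qed
  with R that show ?thesis by blast
qed

section \<open>Strongly continuous semigroups, their integrals and generators\<close>

locale C0_semigroup =
  fixes T :: "real \<Rightarrow> 'y::complex_banach \<Rightarrow> 'y" and M :: "real \<Rightarrow> real"
  assumes T_clin: "\<And>t. 0 \<le> t \<Longrightarrow> bounded_clinear (T t)"
    and T_0 [simp]: "\<And>y. T 0 y = y"
    and T_add: "\<And>s t y. 0 \<le> s \<Longrightarrow> 0 \<le> t \<Longrightarrow> T (s + t) y = T s (T t y)"
    and T_cont: "\<And>y. continuous_on {0..} (\<lambda>t. T t y)"
    and T_bound: "\<And>s t y. 0 \<le> s \<Longrightarrow> s \<le> t \<Longrightarrow> norm (T s y) \<le> M t * norm y"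
begin

lemmas T_blin = bounded_clinear_bounded_linear[OF T_clin]
lemmas T_lin = bounded_clinear_linear[OF T_clin]

lemma T_cont_Icc: "0 \<le> a \<Longrightarrow> continuous_on {a..b} (\<lambda>t. T t y)"
  using T_cont by (rule continuous_on_subset) auto

lemma T_integrable: "0 \<le> a \<Longrightarrow> (\<lambda>t. T t y) integrable_on {a..b}"
  by (intro integrable_continuous_interval T_cont_Icc)

definition F :: "real \<Rightarrow> 'y \<Rightarrow> 'y" where
  "F t y = integral {0..t} (\<lambda>s. T s y)"

lemma F_clin:
  assumes t: "0 \<le> t"
  shows "bounded_clinear (F t)"
proof (rule bounded_clinearI)
  show "F t (x + y) = F t x + F t y" for x y
  proof -
    have "F t (x + y) = integral {0..t} (\<lambda>s. T s x + T s y)"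
      unfolding F_def by (rule integral_cong) (simp add: linear_add[OF T_lin])
    then show ?thesis
      by (simp add: F_def integral_add T_integrable)
  qed
  show "F t (c *\<^sub>C x) = c *\<^sub>C F t x" for c x
  proof -
    have "F t (c *\<^sub>C x) = integral {0..t} (scaleC c \<circ> (\<lambda>s. T s x))"
      unfolding F_def by (rule integral_cong) (simp add: bounded_clinear_scaleC[OF T_clin])
    then show ?thesis
      using integral_linear[OF T_integrable bounded_linear_scaleC] by (simp add: F_def)
  qed
  show "norm (F t x) \<le> (M t * t) * norm x" for x
  proof -
    have "norm (F t x) \<le> M t * norm x * (t - 0)"
      unfolding F_def using t by (intro integral_bound T_cont_Icc) (auto intro: T_bound)
    then show ?thesis by (simp add: ac_simps)
  qed
qed

lemma T_F:
  assumes "0 \<le> \<tau>" "0 \<le> t"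
  shows "T \<tau> (F t y) = F (t + \<tau>) y - F \<tau> y" "F t (T \<tau> y) = F (t + \<tau>) y - F \<tau> y"
proof -
  have "T \<tau> (F t y) = integral {0..t} (T \<tau> \<circ> (\<lambda>s. T s y))"
    unfolding F_def using assms by (intro integral_linear[symmetric] T_integrable T_blin) auto
  also have "\<dots> = integral {0..t} ((\<lambda>s. T s y) \<circ> (+) \<tau>)"
    using assms by (intro integral_cong) (simp add: T_add)
  also have "\<dots> = integral {\<tau>..t + \<tau>} (\<lambda>s. T s y)"
    by (subst integral_shift_Icc_real) simp
  also have "F \<tau> y + \<dots> = F (t + \<tau>) y"
    unfolding F_def using assms
    by (intro Henstock_Kurzweil_Integration.integral_combine T_integrable) auto
  then have "integral {\<tau>..t + \<tau>} (\<lambda>s. T s y) = F (t + \<tau>) y - F \<tau> y"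
    by (simp add: algebra_simps)
  finally show 1: "T \<tau> (F t y) = F (t + \<tau>) y - F \<tau> y" .
  have "F t (T \<tau> y) = integral {0..t} (T \<tau> \<circ> (\<lambda>s. T s y))"
    unfolding F_def using assms
    by (intro integral_cong) (simp add: T_add[symmetric] add.commute)
  also have "\<dots> = T \<tau> (F t y)"
    unfolding F_def using assms by (intro integral_linear T_integrable T_blin) auto
  finally show "F t (T \<tau> y) = F (t + \<tau>) y - F \<tau> y"
    using 1 by simp
qed

lemma T_F_commute: "0 \<le> \<tau> \<Longrightarrow> 0 \<le> t \<Longrightarrow> T \<tau> (F t y) = F t (T \<tau> y)"
  by (simp add: T_F)

lemma gen_limit_exp_iff:
  "gen_limit exp S w v \<longleftrightarrow> ((\<lambda>\<tau>. (S \<tau> w - w) /\<^sub>R \<tau>) \<longlongrightarrow> v) (at_right 0)"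
  by (simp add: gen_limit_def)

text \<open>By \<open>T_F\<close>, applying \<open>T \<tau> - I\<close> to \<open>F t y\<close>
  leaves the increment of \<open>F\<close> at t minus its increment at 0, and the right derivatives
  there are \<open>T t y\<close> and \<open>y\<close>.\<close>

lemma gen_limit_F:
  assumes t: "0 \<le> t"
  shows "gen_limit exp T (F t y) (T t y - y)"
proof -
  have deriv: "((\<lambda>t. F t y) has_vector_derivative T a y) (at a within {a..t + 1})"
    if "0 \<le> a" "a \<le> t" for a
  proof -
    have "((\<lambda>t. F t y) has_vector_derivative T a y) (at a within {0..t + 1})"
      unfolding F_def using that by (intro integral_has_vector_derivative T_cont_Icc) auto
    then show ?thesis
      by (rule has_vector_derivative_within_subset) (use that in auto)
  qed
  have F0: "F 0 y = 0"
    by (simp add: F_def)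
  have "((\<lambda>\<tau>. (F (t + \<tau>) y - F t y) /\<^sub>R \<tau> - (F (0 + \<tau>) y - F 0 y) /\<^sub>R \<tau>) \<longlongrightarrow> T t y - T 0 y)
      (at_right 0)"
    using t by (intro tendsto_diff right_difference_quotient[where b = "t + 1"] deriv) auto
  then have "((\<lambda>\<tau>. (T \<tau> (F t y) - F t y) /\<^sub>R \<tau>) \<longlongrightarrow> T t y - T 0 y) (at_right 0)"
  proof (rule Lim_transform_eventually[OF _ eventually_at_rightI[of 0 1]])
    show "(F (t + \<tau>) y - F t y) /\<^sub>R \<tau> - (F (0 + \<tau>) y - F 0 y) /\<^sub>R \<tau> =
        (T \<tau> (F t y) - F t y) /\<^sub>R \<tau>" if "\<tau> \<in> {0<..<1}" for \<tau>
      using that t by (simp add: T_F F0 algebra_simps)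
  qed simp
  then show ?thesis
    unfolding gen_limit_exp_iff by simp
qed

text \<open>\<open>F t\<close> is bounded and commutes with the semigroup, so it can be pulled
  inside the difference quotient, whose limit is then the one from
  \<open>gen_limit_F\<close>.\<close>

lemma F_gen_limit:
  assumes t: "0 \<le> t" and v: "gen_limit exp T w v"
  shows "F t v = T t w - w"
proof -
  have "((\<lambda>\<tau>. F t ((T \<tau> w - w) /\<^sub>R \<tau>)) \<longlongrightarrow> F t v) (at_right 0)"
    using v[unfolded gen_limit_exp_iff]
    by (rule bounded_linear.tendsto[OF bounded_clinear_bounded_linear[OF F_clin[OF t]]])
  moreover have "((\<lambda>\<tau>. F t ((T \<tau> w - w) /\<^sub>R \<tau>)) \<longlongrightarrow> T t w - w) (at_right 0)"
  proof (rule Lim_transform_eventually[OF gen_limit_F[OF t, unfolded gen_limit_exp_iff]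
        eventually_at_rightI[of 0 1]])
    show "(T \<tau> (F t w) - F t w) /\<^sub>R \<tau> = F t ((T \<tau> w - w) /\<^sub>R \<tau>)" if "\<tau> \<in> {0<..<1}" for \<tau>
      using that t linear_diff[OF bounded_clinear_linear[OF F_clin[OF t]]]
        linear_cmul[OF bounded_clinear_linear[OF F_clin[OF t]]]
      by (simp add: T_F_commute)
  qed simp
  ultimately show ?thesis
    by (rule tendsto_unique[rotated]) simp
qed

text \<open>If \<open>R\<close> inverts \<open>T t - I\<close>, then \<open>F t\<close> after
  \<open>R\<close> inverts the generator: \<open>gen_limit_F\<close> makes it a right inverse, and
  \<open>F_gen_limit\<close> a left inverse once \<open>R\<close> and \<open>F t\<close>
  commute.\<close>

lemma gen_limit_iff_resolvent:
  assumes t: "0 \<le> t" and R: "bounded_clinear R" "\<And>y z. T t y - y = z \<longleftrightarrow> y = R z"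
  obtains J where "bounded_clinear J" "\<And>w v. gen_limit exp T w v \<longleftrightarrow> w = J v"
proof (rule that)
  show "bounded_clinear (\<lambda>v. F t (R v))"
    using R(1) F_clin[OF t] bounded_linear_compose by (auto simp: bounded_clinear_def)
  show "gen_limit exp T w v \<longleftrightarrow> w = F t (R v)" for w v
  proof
    assume "gen_limit exp T w v"
    then have "w = R (F t v)"
      using F_gen_limit[OF t] R(2) by metis
    \<comment> \<open>\<open>R\<close> inherits commutation with \<open>F t\<close> from
      \<open>T t\<close>: the right-hand side solves the equation that characterizes
      \<open>R (F t v)\<close>.\<close>
    also have "\<dots> = F t (R v)"
    proof -
      have "T t (F t (R v)) - F t (R v) = F t (T t (R v) - R v)"
        using t linear_diff[OF bounded_clinear_linear[OF F_clin[OF t]]]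
        by (simp add: T_F_commute)
      also have "\<dots> = F t v"
        using R(2) by metis
      finally show ?thesis
        using R(2) by metis
    qed
    finally show "w = F t (R v)" .
  next
    assume "w = F t (R v)"
    moreover have "T t (R v) - R v = v"
      using R(2) by metis
    ultimately show "gen_limit exp T w v"
      using gen_limit_F[OF t, of "R v"] by simp
  qed
qed

end

section \<open>Multiplication of a semigroup by an exponential factor\<close>

lemma exp_difference_quotient:
  "((\<lambda>\<tau>. (exp (z * of_real \<tau>) - 1) /\<^sub>R \<tau>) \<longlongrightarrow> (z::complex)) (at_right 0)"
proof -
  have "((\<lambda>\<tau>. exp (z * of_real \<tau>)) has_vector_derivative z) (at 0 within {0..1})"
    by (rule has_vector_derivative_real_field[of "\<lambda>w. exp (z * w)"])
      (auto intro!: derivative_eq_intros)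
  from right_difference_quotient[OF this] show ?thesis
    by simp
qed

definition rescale :: "complex \<Rightarrow> (real \<Rightarrow> 'y::complex_banach \<Rightarrow> 'y) \<Rightarrow> real \<Rightarrow> 'y \<Rightarrow> 'y" where
  "rescale z T t y = exp (z * of_real t) *\<^sub>C T t y"

text \<open>Product rule: the derivative of the scalar factor at 0 contributes
  \<open>z *\<^sub>C w\<close>.\<close>

lemma gen_limit_rescale:
  assumes "gen_limit exp T w v"
  shows "gen_limit exp (rescale z T) w (v + z *\<^sub>C w)"
proof -
  have v: "((\<lambda>\<tau>. (T \<tau> w - w) /\<^sub>R \<tau>) \<longlongrightarrow> v) (at_right 0)"
    using assms by (simp add: gen_limit_def)
  have "((\<lambda>\<tau>. exp (z * of_real \<tau>) *\<^sub>C ((T \<tau> w - w) /\<^sub>R \<tau>) +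
      ((exp (z * of_real \<tau>) - 1) /\<^sub>R \<tau>) *\<^sub>C w) \<longlongrightarrow> exp (z * of_real 0) *\<^sub>C v + z *\<^sub>C w) (at_right 0)"
    by (intro tendsto_add bounded_bilinear.tendsto[OF bounded_bilinear_scaleC]
        exp_difference_quotient v tendsto_const tendsto_intros)
  moreover have "exp (z * of_real \<tau>) *\<^sub>C ((T \<tau> w - w) /\<^sub>R \<tau>) + ((exp (z * of_real \<tau>) - 1) /\<^sub>R \<tau>) *\<^sub>C w
      = (rescale z T \<tau> w - w) /\<^sub>R \<tau>" for \<tau>
    by (simp add: rescale_def scaleC_scaleR scaleC_diff_left scaleC_diff_right
        bounded_bilinear.scaleR_left[OF bounded_bilinear_scaleC] scaleR_diff_right)
  ultimately show ?thesis
    by (simp add: gen_limit_def)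
qed

lemma rescale_rescale: "rescale z (rescale z' T) = rescale (z + z') T"
  by (intro ext) (simp add: rescale_def scaleC_scaleC exp_add[symmetric] algebra_simps)

lemma rescale_0: "rescale 0 T = T"
  by (intro ext) (simp add: rescale_def)

lemma gen_limit_rescale_iff:
  "gen_limit exp (rescale (- z) T) w (v - z *\<^sub>C w) \<longleftrightarrow> gen_limit exp T w v"
  using gen_limit_rescale[of T w v "- z"]
    gen_limit_rescale[of "rescale (- z) T" w "v - z *\<^sub>C w" z]
  by (auto simp: rescale_rescale rescale_0 scaleC_minus_left)

context C0_semigroup
begin

lemma C0_semigroup_rescale:
  assumes z: "Re z = 0"
  shows "C0_semigroup (rescale z T) M"
proof
  have n: "norm (exp (z * of_real t)) = 1" for t
    using z by (simp add: norm_exp_eq_Re)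
  fix s t y
  show "bounded_clinear (rescale z T t)" if "0 \<le> t"
    using T_clin[OF that] bounded_linear_compose[OF bounded_linear_scaleC T_blin[OF that]]
    by (simp add: bounded_clinear_def rescale_def[abs_def] scaleC_scaleC mult.commute)
  show "rescale z T 0 y = y"
    by (simp add: rescale_def)
  show "rescale z T (s + t) y = rescale z T s (rescale z T t y)" if "0 \<le> s" "0 \<le> t"
    using that by (simp add: rescale_def T_add bounded_clinear_scaleC[OF T_clin] scaleC_scaleC
        exp_add[symmetric] algebra_simps)
  show "continuous_on {0..} (\<lambda>t. rescale z T t y)"
    unfolding rescale_def
    by (intro bounded_bilinear.continuous_on[OF bounded_bilinear_scaleC] T_cont continuous_intros)
  show "norm (rescale z T s y) \<le> M t * norm y" if "0 \<le> s" "s \<le> t"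
    using T_bound[OF that] by (simp only: rescale_def norm_scaleC n mult_1)
qed

theorem hyperbolic_imp_spectrum:
  assumes hyp: "h_hyperbolic exp T"
  shows "op_spectrum (gen_domain exp T) (generator exp T) \<inter> {z. Re z = 0} = {}"
proof -
  obtain P \<nu> N where P: "is_projection P" and TP: "\<And>t. 0 \<le> t \<Longrightarrow> T t \<circ> P = P \<circ> T t"
    and bij: "\<And>t. 0 \<le> t \<Longrightarrow> bij_betw (T t) (range (compl_proj P)) (range (compl_proj P))"
    and \<nu>: "\<nu> > 0" and N: "N \<ge> 1"
    and est: "\<And>t y. 0 \<le> t \<Longrightarrow> norm (T t (P y)) \<le> N * exp t powr (- \<nu>) * norm y \<and>
        norm (restr_inv (T t) (compl_proj P) (compl_proj P) y) \<le> N * exp t powr (- \<nu>) * norm y"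
    using hyp unfolding h_hyperbolic_def by auto
  \<comment> \<open>The time at which the hyperbolic estimates have dropped to 1/4, the bound that
    \<open>hyperbolic_resolvent\<close> asks for.\<close>
  define t where "t = ln (4 * N) / \<nu>"
  have t: "0 \<le> t"
    using \<nu> N by (simp add: t_def)
  have "N * exp t powr (- \<nu>) = 1 / 4"
    using \<nu> N by (simp add: t_def powr_def exp_minus)
  note est' = est[OF t, unfolded this]
  have Pc: "bounded_clinear P" and PP: "P (P y) = P y" for y
    using P by (auto simp: is_projection_def)
  note P_diff = linear_diff[OF bounded_clinear_linear[OF Pc]]
  have range: "y \<in> range (compl_proj P) \<longleftrightarrow> P y = 0" for y
    by (auto simp: compl_proj_def P_diff PP intro!: image_eqI[where x = y])
  define W where "W = restr_inv (T t) (compl_proj P) (compl_proj P)"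
  have PW: "P (W y) = 0" and TW: "T t (W y) = y - P y" for y
  proof -
    have "compl_proj P y \<in> T t ` range (compl_proj P)"
      using bij[OF t] by (simp add: bij_betw_def)
    then show "P (W y) = 0" "T t (W y) = y - P y"
      using f_inv_into_f[of "compl_proj P y" "T t"]
      by (simp_all add: W_def restr_inv_def inv_into_into flip: range) (simp add: compl_proj_def)
  qed
  have inj: "y = 0" if "P y = 0" "T t y = 0" for y
  proof (rule inj_onD[OF bij_betw_imp_inj_on[OF bij[OF t]]])
    show "T t y = T t 0"
      using that linear_0[OF T_lin[OF t]] by simp
  qed (use that linear_0[OF bounded_clinear_linear[OF Pc]] in \<open>auto simp only: range\<close>)
  have "z \<in> resolvent_set (gen_domain exp T) (generator exp T)" if z: "Re z = 0" for z
  proof -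
    interpret R: C0_semigroup "rescale (- z) T" M
      by (rule C0_semigroup_rescale) (simp add: z)
    have n: "norm (exp (- z * of_real t)) = 1" "norm (exp (z * of_real t)) = 1"
      using z by (simp_all add: norm_exp_eq_Re)
    have e: "exp (- z * of_real t) *\<^sub>C exp (z * of_real t) *\<^sub>C y = y" for y :: 'y
      by (simp add: scaleC_scaleC exp_add[symmetric])
    have TP': "T t (P y) = P (T t y)" for y
      using TP[OF t] by (simp add: fun_eq_iff)
    \<comment> \<open>The same projection splits the rotated operator, and its inverse on the kernel
      of \<open>P\<close> is \<open>W\<close> rotated the opposite way; unimodular factors leave the
      estimates unchanged.\<close>
    obtain R where R: "bounded_clinear R" "\<And>y x. rescale (- z) T t y - y = x \<longleftrightarrow> y = R x"
    proof (rule hyperbolic_resolvent[OF R.T_clin[OF t] P,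
          where W = "\<lambda>y. exp (z * of_real t) *\<^sub>C W y"])
      fix y
      show "rescale (- z) T t (P y) = P (rescale (- z) T t y)"
        by (simp add: rescale_def TP' bounded_clinear_scaleC[OF Pc])
      show "P (exp (z * of_real t) *\<^sub>C W y) = 0"
        by (simp add: bounded_clinear_scaleC[OF Pc] PW)
      show "rescale (- z) T t (exp (z * of_real t) *\<^sub>C W y) = y - P y"
        unfolding rescale_def by (simp only: bounded_clinear_scaleC[OF T_clin[OF t]] TW e)
      show "y = 0" if "P y = 0" "rescale (- z) T t y = 0"
      proof (rule inj[OF that(1)])
        have "norm (T t y) = norm (rescale (- z) T t y)"
          by (simp only: rescale_def norm_scaleC n mult_1)
        with that(2) show "T t y = 0" by simp
      qed
      show "norm (rescale (- z) T t (P y)) \<le> norm y / 4"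
        using est'[of y] by (simp only: rescale_def norm_scaleC n mult_1) simp
      show "norm (exp (z * of_real t) *\<^sub>C W y) \<le> norm y / 4"
        using est'[of y] by (simp only: W_def norm_scaleC n mult_1) simp
    qed blast
    obtain J where J: "bounded_clinear J" "\<And>w v. gen_limit exp (rescale (- z) T) w v \<longleftrightarrow> w = J v"
      by (rule R.gen_limit_iff_resolvent[OF t R]) blast+
    have "gen_limit exp T w v \<longleftrightarrow> w = J (v - z *\<^sub>C w)" for w v
      unfolding J(2)[symmetric] by (rule gen_limit_rescale_iff[symmetric])
    from invertible_on_shifted_generator[OF J(1) this] show ?thesis
      by (simp add: resolvent_set_def)
  qed
  then show ?thesis
    by (auto simp: op_spectrum_def)
qed

end

section \<open>The evolution semigroup in logarithmic time\<close>

context h_evolution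
begin

definition S :: "real \<Rightarrow> 'a c0 \<Rightarrow> 'a c0" where
  "S \<tau> = evol_semigroup h U (ex \<tau>)"

lemma S_apply:
  "0 \<le> \<tau> \<Longrightarrow> c0_apply (S \<tau> u) s = U s (ex (lg s - \<tau>)) (c0_apply u (ex (lg s - \<tau>)))"
  unfolding S_def
  by (subst evol_semigroup_apply[OF growth evol])
    (use alpha_pos K_ge_1 onorm_U in \<open>auto simp: h_bounded_def star_unit_eq star_mult_eq star_inverse_eq\<close>)

lemma S_le [simp]: "0 \<le> \<tau> \<Longrightarrow> ex (lg s - \<tau>) \<le> s"
  by (simp add: ex_le_iff')

lemma norm_S_le:
  assumes "0 \<le> \<tau>"
  shows "norm (S \<tau> u) \<le> K * exp (\<alpha> * \<tau>) * norm u"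
proof (rule norm_c0_le_scaled)
  show "0 \<le> K * exp (\<alpha> * \<tau>)"
    using K_ge_1 by simp
  show "\<exists>r. norm (c0_apply (S \<tau> u) s) \<le> K * exp (\<alpha> * \<tau>) * norm (c0_apply u r)" for s
    using norm_U_le[of "ex (lg s - \<tau>)" s] assms by (auto simp: S_apply)
qed

text \<open>Far out both \<open>u\<close> and its transported values are small; on the remaining
  compact range of times, uniform continuity of the transported function, jointly in time and shift,
  gives the estimate.\<close>

lemma S_right_continuous:
  assumes e: "e > 0"
  shows "\<exists>d>0. \<forall>\<tau>. 0 \<le> \<tau> \<longrightarrow> \<tau> < d \<longrightarrow> norm (S \<tau> u - u) \<le> e"
proof -
  define v where "v \<sigma> = c0_apply u (ex \<sigma>)" for \<sigma>
  have v: "v \<in> vanishing"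
    unfolding v_def
    by (rule vanishing_compose[OF c0_apply_vanishing continuous_on_ex filterlim_ex])
  define \<epsilon> where "\<epsilon> = e / (K * exp \<alpha> + 1)"
  have pos: "K * exp \<alpha> + 1 > 0"
    using K_ge_1 by (intro add_nonneg_pos) auto
  then have "(K * exp \<alpha> + 1) * \<epsilon> = e"
    unfolding \<epsilon>_def by simp
  then have \<epsilon>: "(K * exp \<alpha>) * \<epsilon> + \<epsilon> = e" "\<epsilon> > 0"
    using e pos by (simp add: distrib_right) (simp add: \<epsilon>_def e pos)
  have "\<forall>\<^sub>F \<sigma> in at_top. dist (v \<sigma>) 0 < \<epsilon>" "\<forall>\<^sub>F \<sigma> in at_bot. dist (v \<sigma>) 0 < \<epsilon>"
    using v \<epsilon>(2) unfolding vanishing_def by (auto simp only: mem_Collect_eq intro!: tendstoD)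
  then obtain a b where a: "\<And>\<sigma>. \<sigma> \<le> a \<Longrightarrow> norm (v \<sigma>) < \<epsilon>"
    and b: "\<And>\<sigma>. b \<le> \<sigma> \<Longrightarrow> norm (v \<sigma>) < \<epsilon>"
    unfolding eventually_at_top_linorder eventually_at_bot_linorder dist_norm diff_zero by blast
  let ?G = "\<lambda>(\<sigma>, \<tau>). U (ex \<sigma>) (ex (\<sigma> - \<tau>)) (v (\<sigma> - \<tau>))"
  \<comment> \<open>The extra 1 on the right leaves room for the shift: beyond b + 1 a time shifted
    back by less than 1 still exceeds b.\<close>
  let ?C = "{a..b + 1} \<times> {0..1::real}"
  have "continuous_on UNIV v"
    using v by (simp add: vanishing_def)
  then have "continuous_on ?C (\<lambda>z. v (fst z - snd z))" "continuous_on ?C (\<lambda>z. ex (fst z))"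
    "continuous_on ?C (\<lambda>z. ex (fst z - snd z))"
    using continuous_on_ex[of UNIV]
    by (auto elim!: continuous_on_compose2 intro!: continuous_intros)
  then have "continuous_on ?C ?G"
    unfolding case_prod_beta by (intro continuous_on_U) auto
  then have "uniformly_continuous_on ?C ?G"
    by (intro compact_uniformly_continuous compact_Times) auto
  then obtain d where d: "d > 0" "\<And>x y. x \<in> ?C \<Longrightarrow> y \<in> ?C \<Longrightarrow> dist y x < d \<Longrightarrow> dist (?G y) (?G x) < e"
    using e unfolding uniformly_continuous_on_def by meson
  have "norm (S \<tau> u - u) \<le> e" if \<tau>: "0 \<le> \<tau>" "\<tau> < min d 1" for \<tau>
  proof (rule norm_c0_le)
    fix s
    define \<sigma> where "\<sigma> = lg s"
    have s: "s = ex \<sigma>"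
      by (simp add: \<sigma>_def)
    have eq: "c0_apply (S \<tau> u - u) s = ?G (\<sigma>, \<tau>) - v \<sigma>"
      using \<tau> by (simp add: S_apply v_def s)
    show "norm (c0_apply (S \<tau> u - u) s) \<le> e"
    proof (cases "\<sigma> \<in> {a..b + 1}")
      case True
      have "dist (?G (\<sigma>, \<tau>)) (?G (\<sigma>, 0)) < e"
        by (rule d(2)) (use True \<tau> in \<open>auto simp: dist_prod_def\<close>)
      then show ?thesis
        unfolding eq by (simp add: dist_norm)
    next
      case False
      then have v_small: "norm (v \<sigma>) < \<epsilon>" "norm (v (\<sigma> - \<tau>)) < \<epsilon>"
        using \<tau> a[of \<sigma>] a[of "\<sigma> - \<tau>"] b[of \<sigma>] b[of "\<sigma> - \<tau>"]
        by (cases "\<sigma> \<le> a"; force)+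
      have "norm (?G (\<sigma>, \<tau>)) \<le> K * exp (\<alpha> * \<tau>) * norm (v (\<sigma> - \<tau>))"
        using norm_U_le[of "ex (\<sigma> - \<tau>)" "ex \<sigma>"] \<tau> by simp
      also have "\<dots> \<le> K * exp \<alpha> * \<epsilon>"
        using v_small \<tau> alpha_pos K_ge_1 by (intro mult_mono) (auto simp: mult_le_cancel_left1)
      finally show ?thesis
        unfolding eq using v_small \<epsilon>(1) norm_triangle_ineq4[of "?G (\<sigma>, \<tau>)" "v \<sigma>"] by linarith
    qed
  qed
  then show ?thesis
    using d(1) by (intro exI[of _ "min d 1"]) auto
qed

sublocale S: C0_semigroup S "\<lambda>t. K * exp (\<alpha> * t)"
proof
  fix s t y
  show clin: "bounded_clinear (S t)" if "0 \<le> t" for t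
  proof (rule bounded_clinearI)
    show "norm (S t u) \<le> (K * exp (\<alpha> * t)) * norm u" for u
      by (rule norm_S_le[OF that])
  qed (use that in \<open>auto intro!: c0_eqI
      simp: S_apply linear_add[OF U_lin] bounded_clinear_scaleC[OF U_clin]\<close>)
  show S_0: "S 0 y = y" for y
    by (rule c0_eqI) (simp add: S_apply)
  show S_add: "S (s + t) y = S s (S t y)" if "0 \<le> s" "0 \<le> t" for s t y
    using that by (intro c0_eqI) (simp add: S_apply U_comp diff_diff_eq)
  show "continuous_on {0..} (\<lambda>t. S t y)"
    unfolding continuous_on_iff
  proof (intro ballI allI impI)
    fix t0 e :: real assume t0: "t0 \<in> {0..}" and e: "0 < e"
    define C where "C = K * exp (\<alpha> * t0)"
    have C: "C > 0"
      using K_ge_1 by (simp add: C_def)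
    obtain d where d: "d > 0" "\<And>\<tau>. 0 \<le> \<tau> \<Longrightarrow> \<tau> < d \<Longrightarrow> norm (S \<tau> y - y) \<le> e / (2 * C)"
      using S_right_continuous[of "e / (2 * C)" y] e C by auto
    \<comment> \<open>With the smaller time factored out, only right continuity at 0 is needed.
      Whichever side of \<open>t0\<close> is considered, the smaller time is at most
      \<open>t0\<close>, so one constant \<open>C\<close> serves both sides.\<close>
    have "norm (S t1 y - S t2 y) < e" if "0 \<le> t2" "t2 \<le> t1" "t1 - t2 < d" "t2 \<le> t0" for t1 t2
    proof -
      have "S t1 y - S t2 y = S t2 (S (t1 - t2) y - y)"
        using that S_add[of t2 "t1 - t2" y]
        by (simp add: linear_diff[OF bounded_clinear_linear[OF clin]])
      also have "norm \<dots> \<le> K * exp (\<alpha> * t2) * norm (S (t1 - t2) y - y)"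
        using that by (intro norm_S_le)
      also have "\<dots> \<le> C * (e / (2 * C))"
        unfolding C_def using that alpha_pos K_ge_1 d(2)[of "t1 - t2"]
        by (intro mult_mono) (auto simp: C_def)
      also have "\<dots> < e"
        using C e by simp
      finally show ?thesis .
    qed
    then have "dist (S t1 y) (S t2 y) < e" if "0 \<le> t2" "t2 \<le> t1" "t1 - t2 < d" "t2 \<le> t0" for t1 t2
      using that by (simp add: dist_norm)
    from this[of t0] this[of _ t0]
    have "dist (S t0 y) (S t y) < e \<or> dist (S t y) (S t0 y) < e" if "t \<in> {0..}" "dist t t0 < d" for t
      using that t0 by (cases "t \<le> t0") (auto simp: dist_real_def)
    then have "dist (S t y) (S t0 y) < e" if "t \<in> {0..}" "dist t t0 < d" for t
      using that by (subst disj_absorb[symmetric], subst dist_commute) blast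
    then show "\<exists>d>0. \<forall>t\<in>{0..}. dist t t0 < d \<longrightarrow> dist (S t y) (S t0 y) < e"
      using d(1) by blast
  qed
  show "norm (S s y) \<le> K * exp (\<alpha> * t) * norm y" if "0 \<le> s" "s \<le> t"
  proof -
    have "norm (S s y) \<le> K * exp (\<alpha> * s) * norm y"
      by (rule norm_S_le[OF that(1)])
    also have "\<dots> \<le> K * exp (\<alpha> * t) * norm y"
      using that alpha_pos K_ge_1 by (intro mult_right_mono) auto
    finally show ?thesis .
  qed
qed

lemma all_ge_star_unit: "(\<forall>t\<ge>star_unit h. Q t) \<longleftrightarrow> (\<forall>\<tau>\<ge>0. Q (ex \<tau>))"
  unfolding star_unit_eq by (metis ex_le_iff ex_lg)

lemma h_hyperbolic_S: "h_hyperbolic h (evol_semigroup h U) \<longleftrightarrow> h_hyperbolic exp S"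
  unfolding h_hyperbolic_def all_ge_star_unit by (simp add: S_def h_lg)

lemma at_right_star_unit: "at_right (star_unit h) = filtermap ex (at_right 0)"
proof (rule filtermap_fun_inverse[symmetric])
  have cont: "(lg \<longlongrightarrow> lg x) (at x within A)" "(ex \<longlongrightarrow> ex x) (at x within A)" for x A
    using continuous_on_lg[of UNIV] continuous_on_ex[of UNIV]
    by (auto simp: continuous_on_def intro: tendsto_within_subset)
  have "0 < lg t \<and> lg t \<noteq> 0" if "ex 0 < t" for t
    using lg_less_iff[of "ex 0" t] that by (simp del: lg_less_iff)
  then show "filterlim lg (at_right 0) (at_right (star_unit h))"
    using cont(1)[of "ex 0"]
    by (auto simp: filterlim_at star_unit_eq eventually_at_filter
        intro!: always_eventually)
  show "filterlim ex (at_right (star_unit h)) (at_right 0)"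
    using cont(2)[of 0]
    by (auto simp: filterlim_at star_unit_eq eventually_at_filter intro!: always_eventually)
qed simp

lemma gen_limit_S: "gen_limit h (evol_semigroup h U) w v \<longleftrightarrow> gen_limit exp S w v"
  by (simp add: gen_limit_def at_right_star_unit filterlim_filtermap h_lg S_def)

lemma generator_S:
  "gen_domain h (evol_semigroup h U) = gen_domain exp S"
  "generator h (evol_semigroup h U) = generator exp S"
proof -
  have "gen_limit h (evol_semigroup h U) = gen_limit exp S"
    by (intro ext) (rule gen_limit_S)
  then show "gen_domain h (evol_semigroup h U) = gen_domain exp S"
    "generator h (evol_semigroup h U) = generator exp S"
    by (simp_all add: gen_domain_def generator_def[abs_def])
qed

end

section \<open>Dichotomies yield hyperbolic semigroups\<close>

locale h_dichotomy = h_evolution +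
  fixes P :: "real \<Rightarrow> 'a \<Rightarrow> 'a"
  assumes dich: "is_h_dichotomy h U P"
begin

lemma P_clin: "bounded_clinear (P t)" and PP [simp]: "P t (P t x) = P t x"
  using dich by (auto simp: is_h_dichotomy_def is_projection_def)

lemmas P_lin = bounded_clinear_linear[OF P_clin]
lemmas P_linear_simps [simp] = linear_add[OF P_lin] linear_diff[OF P_lin] linear_0[OF P_lin]
  bounded_clinear_scaleC[OF P_clin]

lemma PU: "s \<le> t \<Longrightarrow> P t (U t s x) = U t s (P s x)"
  using dich by (auto simp: is_h_dichotomy_def fun_eq_iff)

lemma range_compl_P: "y \<in> range (compl_proj (P t)) \<longleftrightarrow> P t y = 0"
  by (auto simp: compl_proj_def intro!: image_eqI[where x = y])

text \<open>Backward evolution from time \<open>t\<close> to time \<open>s\<close> on the kernels of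
  the projections; it annihilates the range of \<open>P t\<close>.\<close>

definition W :: "real \<Rightarrow> real \<Rightarrow> 'a \<Rightarrow> 'a" where
  "W t s = restr_inv (U t s) (compl_proj (P s)) (compl_proj (P t))"

lemma bij_U:
  "s \<le> t \<Longrightarrow> bij_betw (U t s) (range (compl_proj (P s))) (range (compl_proj (P t)))"
  using dich by (auto simp: is_h_dichotomy_def)

lemma PW: "s \<le> t \<Longrightarrow> P s (W t s x) = 0" and UW: "s \<le> t \<Longrightarrow> U t s (W t s x) = x - P t x"
proof -
  assume "s \<le> t"
  then have "compl_proj (P t) x \<in> U t s ` range (compl_proj (P s))"
    using bij_U[of s t] by (simp add: bij_betw_def)
  then show "P s (W t s x) = 0" "U t s (W t s x) = x - P t x"
    using f_inv_into_f[of "compl_proj (P t) x" "U t s"]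
    by (simp_all add: W_def restr_inv_def inv_into_into flip: range_compl_P) (simp add: compl_proj_def)
qed

lemma U_inj:
  assumes "s \<le> t" "P s y = 0" "U t s y = 0"
  shows "y = 0"
proof (rule inj_onD[OF bij_betw_imp_inj_on[OF bij_U[OF assms(1)]]])
  show "U t s y = U t s 0"
    using assms linear_0[OF U_lin] by simp
qed (use assms in \<open>auto simp only: range_compl_P P_linear_simps\<close>)

lemma W_eqI:
  assumes "s \<le> t" "P s z = 0" "U t s z = x - P t x"
  shows "W t s x = z"
  using U_inj[OF assms(1), of "W t s x - z"] assms
  by (simp add: PW UW linear_diff[OF U_lin])

lemma W_U: "s \<le> t \<Longrightarrow> P s x = 0 \<Longrightarrow> W t s (U t s x) = x"
  by (rule W_eqI) (simp_all add: PU linear_0[OF U_lin])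

lemma exponent:
  obtains \<nu> N where "\<nu> > 0" "N \<ge> 1"
    "\<And>t s x. s \<le> t \<Longrightarrow> norm (U t s (P s x)) \<le> N * exp (- \<nu> * (lg t - lg s)) * norm x"
    "\<And>t s x. s \<le> t \<Longrightarrow> norm (W t s x) \<le> N * exp (- \<nu> * (lg t - lg s)) * norm x"
proof -
  have "(h t / h s) powr a = exp (a * (lg t - lg s))" for t s a
    by (simp add: h_lg powr_def ln_div)
  then show ?thesis
    using dich that unfolding is_h_dichotomy_def W_def by metis
qed

text \<open>\<open>W\<close> is built from a set-theoretic inverse, so linearity has to come from
  uniqueness of preimages and boundedness from the dichotomy estimate.\<close>

lemma W_clin: "s \<le> t \<Longrightarrow> bounded_clinear (W t s)"
proof -
  assume st: "s \<le> t"
  obtain b where "\<And>x. norm (W t s x) \<le> b * norm x"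
    using exponent st by metis
  then show ?thesis
    by (intro bounded_clinearI W_eqI st)
      (simp_all add: st PW UW linear_add[OF U_lin] bounded_clinear_scaleC[OF U_clin] scaleC_diff_right)
qed

lemma W_refl: "W t t x = x - P t x"
  by (rule W_eqI) simp_all

text \<open>The inverses inherit the strong continuity of \<open>U\<close> from this factorization, in which
  \<open>W b r\<close> is one fixed operator; the case \<open>s = t\<close> covers the projections.\<close>

lemma W_factor:
  assumes "r \<le> s" "s \<le> t" "t \<le> b"
  shows "W t s x = U s r (W b r (U b t x))"
proof (rule W_eqI)
  let ?z = "U t r (W b r (U b t x))"
  have "?z - (x - P t x) = 0"
  proof (rule U_inj)
    show "P t (?z - (x - P t x)) = 0"
      using assms by (simp add: PU PW linear_0[OF U_lin])
    show "U b t (?z - (x - P t x)) = 0"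
      using assms by (simp add: linear_diff[OF U_lin] U_comp UW PU)
  qed (use assms in simp)
  then show "U t s (U s r (W b r (U b t x))) = x - P t x"
    using assms by (simp add: U_comp)
qed (use assms in \<open>simp_all add: PU PW linear_0[OF U_lin]\<close>)

lemma continuous_on_W:
  fixes p q :: "'c::topological_space \<Rightarrow> real"
  assumes p: "continuous_on A p" and q: "continuous_on A q" and w: "continuous_on A w"
    and le: "\<And>z. z \<in> A \<Longrightarrow> q z \<le> p z"
  shows "continuous_on A (\<lambda>z. W (p z) (q z) (w z))"
  unfolding continuous_on_def
proof
  fix z0 assume z0: "z0 \<in> A"
  \<comment> \<open>Fixed times with margin 1 on both sides, so that near \<open>z0\<close> the
    factorization through \<open>W b r\<close> applies. The clamping by \<open>max\<close> and
    \<open>min\<close> below keeps the time arguments ordered on all of \<open>A\<close>.\<close>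
  define b r where "b = p z0 + 1" and "r = q z0 - 1"
  have "r \<le> b"
    using le[OF z0] by (simp add: b_def r_def)
  then have lin: "bounded_linear (W b r)"
    by (rule bounded_clinear_bounded_linear[OF W_clin])
  have "continuous_on A (\<lambda>z. U (max (q z) r) r (W b r (U b (min (p z) b) (w z))))"
    by (intro continuous_on_U continuous_intros p q w bounded_linear.continuous_on[OF lin]) auto
  then have "((\<lambda>z. U (max (q z) r) r (W b r (U b (min (p z) b) (w z)))) \<longlongrightarrow>
      U (max (q z0) r) r (W b r (U b (min (p z0) b) (w z0)))) (at z0 within A)"
    using z0 by (auto simp: continuous_on_def)
  moreover have "U (max (q z) r) r (W b r (U b (min (p z) b) (w z))) = W (p z) (q z) (w z)"
    if "z \<in> A" "p z < b" "r < q z" for z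
    using that le[of z] W_factor[of r "q z" "p z" b "w z"] by (simp add: max_def min_def)
  moreover have "\<forall>\<^sub>F z in at z0 within A. z \<in> A \<and> p z < b \<and> r < q z"
  proof (intro eventually_conj)
    show "\<forall>\<^sub>F z in at z0 within A. z \<in> A"
      by (simp add: eventually_at_filter)
    have "(p \<longlongrightarrow> p z0) (at z0 within A)" "(q \<longlongrightarrow> q z0) (at z0 within A)"
      using p q z0 by (auto simp: continuous_on_def)
    then show "\<forall>\<^sub>F z in at z0 within A. p z < b" "\<forall>\<^sub>F z in at z0 within A. r < q z"
      by (auto intro!: order_tendstoD simp: b_def r_def)
  qed
  ultimately show "((\<lambda>z. W (p z) (q z) (w z)) \<longlongrightarrow> W (p z0) (q z0) (w z0)) (at z0 within A)"
    using z0 by (auto simp: b_def r_def elim!: Lim_transform_eventually eventually_mono)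
qed

lemma continuous_on_P:
  assumes "continuous_on A p" "continuous_on A w"
  shows "continuous_on A (\<lambda>z. P (p z) (w z))"
proof -
  have "P t x = x - W t t x" for t x
    by (simp add: W_refl)
  then show ?thesis
    by (simp only:) (intro continuous_intros continuous_on_W assms order_refl)
qed

definition Proj :: "'a c0 \<Rightarrow> 'a c0" where
  "Proj u = Abs_c0 (\<lambda>s. P s (c0_apply u s))"

text \<open>The inverse of \<open>S \<tau>\<close> on the kernel of \<open>Proj\<close>: where
  \<open>S \<tau>\<close> looks back by \<tau> in logarithmic time, this looks ahead by
  \<tau>.\<close>

definition Back :: "real \<Rightarrow> 'a c0 \<Rightarrow> 'a c0" where
  "Back \<tau> u = Abs_c0 (\<lambda>s. W (ex (lg s + \<tau>)) s (c0_apply u (ex (lg s + \<tau>))))"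

lemma Proj_apply: "c0_apply (Proj u) s = P s (c0_apply u s)"
proof -
  obtain \<nu> N where "\<And>t s x. s \<le> t \<Longrightarrow>
      norm (U t s (P s x)) \<le> N * exp (- \<nu> * (lg t - lg s)) * norm x"
    using exponent by metis
  from this[of s s for s] have "norm (P s x) \<le> N * norm x" for s x
    by simp
  then have "(\<lambda>s. P s (c0_apply u s)) \<in> vanishing"
    by (intro vanishing_comparison[OF c0_apply_vanishing[of u]]
        continuous_on_P continuous_on_c0_apply continuous_on_id)
  then show ?thesis
    by (simp add: Proj_def c0_apply_Abs_c0)
qed

lemma le_forward [simp]: "0 \<le> \<tau> \<Longrightarrow> s \<le> ex (lg s + \<tau>)"
  by (simp add: le_ex_iff)

lemma Back_apply:
  assumes "0 \<le> \<tau>"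
  shows "c0_apply (Back \<tau> u) s = W (ex (lg s + \<tau>)) s (c0_apply u (ex (lg s + \<tau>)))"
proof -
  obtain \<nu> N where "\<And>t s x. s \<le> t \<Longrightarrow> norm (W t s x) \<le> N * exp (- \<nu> * (lg t - lg s)) * norm x"
    using exponent by metis
  from this[of s "ex (lg s + \<tau>)" for s]
  have "norm (W (ex (lg s + \<tau>)) s x) \<le> N * exp (- \<nu> * \<tau>) * norm x" for s x
    using assms by simp
  moreover have cont: "continuous_on UNIV (\<lambda>s. ex (lg s + \<tau>))"
    by (intro continuous_on_compose2[OF continuous_on_ex[of UNIV]] continuous_intros
        continuous_on_lg) auto
  moreover have "Z \<le> ex (lg s + \<tau>) \<longleftrightarrow> ex (lg Z - \<tau>) \<le> s"
    "ex (lg s + \<tau>) \<le> Z \<longleftrightarrow> s \<le> ex (lg Z - \<tau>)" for Z s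
    by (auto simp: le_ex_iff ex_le_iff')
  then have "filterlim (\<lambda>s. ex (lg s + \<tau>)) at_top at_top"
    "filterlim (\<lambda>s. ex (lg s + \<tau>)) at_bot at_bot"
    unfolding filterlim_at_top filterlim_at_bot eventually_at_top_linorder eventually_at_bot_linorder
    by blast+
  ultimately have "(\<lambda>s. W (ex (lg s + \<tau>)) s (c0_apply u (ex (lg s + \<tau>)))) \<in> vanishing"
    using assms
    by (intro vanishing_comparison[OF vanishing_compose[OF c0_apply_vanishing[of u]]]
        continuous_on_W continuous_on_compose2[OF continuous_on_c0_apply] continuous_on_id) auto
  then show ?thesis
    by (simp add: Back_def c0_apply_Abs_c0)
qed

lemma is_projection_Proj: "is_projection Proj"
proof -
  obtain \<nu> N where N: "N \<ge> 1" "\<And>t s x. s \<le> t \<Longrightarrow>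
      norm (U t s (P s x)) \<le> N * exp (- \<nu> * (lg t - lg s)) * norm x"
    using exponent by metis
  from N(2)[of s s for s] have "norm (P s x) \<le> N * norm x" for s x
    by simp
  then have "norm (Proj u) \<le> N * norm u" for u
    using N(1) by (intro norm_c0_le_scaled) (auto simp: Proj_apply)
  then have "bounded_clinear Proj"
    by (intro bounded_clinearI c0_eqI) (auto simp: Proj_apply)
  then show ?thesis
    by (auto simp: is_projection_def Proj_apply intro!: c0_eqI)
qed

text \<open>All identities and estimates can be checked at a single time s. The two times involved
  there are exactly \<tau> apart in logarithmic time, so rate and constant of the dichotomy carry
  over unchanged.\<close>

lemma h_hyperbolic_exp_S: "h_hyperbolic exp S"
proof -
  obtain \<nu> N where \<nu>: "\<nu> > 0" "N \<ge> 1"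
    and est: "\<And>t s x. s \<le> t \<Longrightarrow> norm (U t s (P s x)) \<le> N * exp (- \<nu> * (lg t - lg s)) * norm x"
      "\<And>t s x. s \<le> t \<Longrightarrow> norm (W t s x) \<le> N * exp (- \<nu> * (lg t - lg s)) * norm x"
    using exponent by metis
  have SP: "S \<tau> (Proj u) = Proj (S \<tau> u)" if "0 \<le> \<tau>" for \<tau> u
    using that by (intro c0_eqI) (simp add: S_apply Proj_apply PU)
  have PB: "Proj (Back \<tau> u) = 0" if "0 \<le> \<tau>" for \<tau> u
    using that by (intro c0_eqI) (simp add: Back_apply Proj_apply PW)
  have SB: "S \<tau> (Back \<tau> u) = u - Proj u" if "0 \<le> \<tau>" for \<tau> u
    using that by (intro c0_eqI) (simp add: Back_apply S_apply Proj_apply UW)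
  have BS: "Back \<tau> (S \<tau> u) = u" if "0 \<le> \<tau>" "Proj u = 0" for \<tau> u
  proof (rule c0_eqI)
    fix s
    have "P s (c0_apply u s) = 0"
      using that(2) by (metis Proj_apply zero_c0.rep_eq)
    then show "c0_apply (Back \<tau> (S \<tau> u)) s = c0_apply u s"
      using that by (simp add: Back_apply S_apply W_U)
  qed
  have Proj_lin: "linear Proj" and Proj_Proj: "Proj (Proj u) = Proj u" for u
    using is_projection_Proj bounded_clinear_linear by (auto simp: is_projection_def)
  have "u \<in> range (compl_proj Proj) \<longleftrightarrow> Proj u = 0" for u
    by (auto simp: compl_proj_def linear_diff[OF Proj_lin] Proj_Proj intro!: image_eqI[where x = u])
  then have range: "range (compl_proj Proj) = {u. Proj u = 0}"
    by blast
  have bij: "bij_betw (S \<tau>) (range (compl_proj Proj)) (range (compl_proj Proj))" if "0 \<le> \<tau>" for \<tau>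
    unfolding range by (rule bij_betw_byWitness[where f' = "Back \<tau>"])
      (use that in \<open>auto simp: BS SB PB SP[symmetric] linear_0[OF S.T_lin]\<close>)
  have inv: "restr_inv (S \<tau>) (compl_proj Proj) (compl_proj Proj) u = Back \<tau> u" if "0 \<le> \<tau>" for \<tau> u
    unfolding restr_inv_def
  proof (rule inv_into_f_eq)
    show "inj_on (S \<tau>) (range (compl_proj Proj))"
      using bij[OF that] by (rule bij_betw_imp_inj_on)
    show "Back \<tau> u \<in> range (compl_proj Proj)"
      by (simp add: range PB[OF that])
    show "S \<tau> (Back \<tau> u) = compl_proj Proj u"
      by (simp add: SB[OF that] compl_proj_def)
  qed
  have "norm (S \<tau> (Proj u)) \<le> N * exp \<tau> powr (- \<nu>) * norm u" if "0 \<le> \<tau>" for \<tau> u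
  proof (rule norm_c0_le_scaled)
    show "\<exists>r. norm (c0_apply (S \<tau> (Proj u)) s) \<le> N * exp \<tau> powr - \<nu> * norm (c0_apply u r)" for s
      using est(1)[of "ex (lg s - \<tau>)" s] that by (auto simp: S_apply Proj_apply powr_def)
  qed (use \<nu> in simp)
  moreover have "norm (Back \<tau> u) \<le> N * exp \<tau> powr (- \<nu>) * norm u" if "0 \<le> \<tau>" for \<tau> u
  proof (rule norm_c0_le_scaled)
    show "\<exists>r. norm (c0_apply (Back \<tau> u) s) \<le> N * exp \<tau> powr - \<nu> * norm (c0_apply u r)" for s
      using est(2)[of s "ex (lg s + \<tau>)"] that by (auto simp: Back_apply powr_def)
  qed (use \<nu> in simp)
  ultimately show ?thesis
    unfolding h_hyperbolic_def using \<nu> is_projection_Proj SP bij inv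
    by (intro exI[of _ Proj] conjI exI[of _ \<nu>] exI[of _ N]) (auto simp: fun_eq_iff)
qed

end

section \<open>Invertible generators yield dichotomies\<close>

text \<open>\<open>evol_gen V u g\<close> says that \<open>u\<close> is in the domain of the generator, which maps it to \<open>g\<close>; the
  difference quotient is spelled out so that \<open>u\<close> and \<open>g\<close> need not be elements of the type \<open>c0\<close>.\<close>

definition evol_gen ::
  "(real \<Rightarrow> real \<Rightarrow> 'a::real_normed_vector \<Rightarrow> 'a) \<Rightarrow> (real \<Rightarrow> 'a) \<Rightarrow> (real \<Rightarrow> 'a) \<Rightarrow> bool" where
  "evol_gen V u g \<longleftrightarrow> (\<forall>e>0. \<exists>d>0. \<forall>\<tau>. 0 < \<tau> \<longrightarrow> \<tau> < d \<longrightarrow>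
     (\<forall>s. norm (V s (s - \<tau>) (u (s - \<tau>)) - u s - \<tau> *\<^sub>R g s) \<le> e * \<tau>))"

text \<open>\<open>F s t c\<close> abstracts a growth bound by the factor \<open>c\<close> between
  the times s and t, so that forward decay of stable vectors and backward decay of unstable ones are
  instances of one argument. As many full steps of length \<Lambda> as fit are taken; the rest costs
  \<open>C\<close>, and rounding down the number of steps costs the factor 2.\<close>

lemma exponential_decay_from_halving:
  fixes F :: "real \<Rightarrow> real \<Rightarrow> real \<Rightarrow> bool"
  assumes trans: "\<And>s r t c d. s \<le> r \<Longrightarrow> r \<le> t \<Longrightarrow> 0 \<le> c \<Longrightarrow> 0 \<le> d \<Longrightarrow> F s r c \<Longrightarrow> F r t d \<Longrightarrow> F s t (c * d)"
    and mono: "\<And>s t c d. F s t c \<Longrightarrow> c \<le> d \<Longrightarrow> F s t d"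
    and half: "\<And>s. F s (s + \<Lambda>) (1 / 2)" and bound: "\<And>s t. s \<le> t \<Longrightarrow> F s t C"
    and \<Lambda>: "\<Lambda> > 0" and C: "C \<ge> 0" and st: "s \<le> t"
  shows "F s t (2 * C * exp (- (ln 2 / \<Lambda>) * (t - s)))"
proof -
  have power: "F s t (C * (1 / 2) ^ k)" if "s + real k * \<Lambda> \<le> t" for s t k
    using that
  proof (induction k arbitrary: s)
    case 0
    then show ?case by (simp add: bound)
  next
    case (Suc k)
    have le: "s + \<Lambda> + real k * \<Lambda> \<le> t"
      using Suc.prems by (simp add: algebra_simps)
    have "0 \<le> real k * \<Lambda>"
      using \<Lambda> by simp
    with le have "s + \<Lambda> \<le> t" by linarith
    then have "F s t (1 / 2 * (C * (1 / 2) ^ k))"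
      using \<Lambda> C by (intro trans[OF _ _ _ _ half Suc.IH[OF le]]) auto
    then show ?case
      by (simp add: mult.left_commute)
  qed
  define k where "k = nat \<lfloor>(t - s) / \<Lambda>\<rfloor>"
  have "(t - s) / \<Lambda> \<ge> 0"
    using st \<Lambda> by simp
  then have k: "real k \<le> (t - s) / \<Lambda>" "(t - s) / \<Lambda> \<le> real k + 1"
    unfolding k_def by linarith+
  have "real k * \<Lambda> \<le> (t - s) / \<Lambda> * \<Lambda>"
    using k(1) \<Lambda> by (intro mult_right_mono) auto
  then have "F s t (C * (1 / 2) ^ k)"
    using \<Lambda> by (intro power) simp
  have "(1 / 2) ^ k = exp (- (real k * ln 2))"
    by (simp add: exp_minus exp_of_nat_mult power_one_over inverse_eq_divide)
  moreover have "exp (- (real k * ln 2)) \<le> exp (ln 2 + - (ln 2 / \<Lambda>) * (t - s))"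
    using mult_right_mono[OF k(2), of "ln 2"] by (simp add: algebra_simps)
  then have "exp (- (real k * ln 2)) \<le> 2 * exp (- (ln 2 / \<Lambda>) * (t - s))"
    by (simp only: exp_add) simp
  ultimately have "C * (1 / 2) ^ k \<le> C * (2 * exp (- (ln 2 / \<Lambda>) * (t - s)))"
    using C by (simp only: mult_left_mono)
  then have "C * (1 / 2) ^ k \<le> 2 * C * exp (- (ln 2 / \<Lambda>) * (t - s))"
    by (simp only: mult.assoc mult.left_commute[of 2])
  with \<open>F s t (C * (1 / 2) ^ k)\<close> show ?thesis
    by (rule mono)
qed

subsection \<open>Cut-off functions\<close>

text \<open>A continuously differentiable version of the positive part, quadratic on [0, 1]. The
  smoothing gives the derivative the Lipschitz property that \<open>evol_gen_weight\<close> relies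
  on.\<close>

definition ramp :: "real \<Rightarrow> real" where
  "ramp x = (max 0 x)\<^sup>2 / 2 - (max 0 (x - 1))\<^sup>2 / 2"

definition ramp' :: "real \<Rightarrow> real" where
  "ramp' x = max 0 x - max 0 (x - 1)"

text \<open>\<open>bump n\<close> rises from \<open>0\<close> to \<open>n + 1\<close>, with slope \<open>1\<close> except on \<open>[0, 1]\<close> and \<open>[n + 1, n + 2]\<close>.\<close>

definition bump :: "nat \<Rightarrow> real \<Rightarrow> real" where
  "bump n x = ramp x - ramp (x - (real n + 1))"

definition bump' :: "nat \<Rightarrow> real \<Rightarrow> real" where
  "bump' n x = ramp' x - ramp' (x - (real n + 1))"

text \<open>The first-order remainder is at most the square of y - x for all x and y, which covers
  the kink at 0 as well.\<close>

lemma DERIV_half_square_max: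
  "((\<lambda>x. (max 0 x)\<^sup>2 / 2) has_real_derivative max 0 x) (at (x::real))"
  unfolding has_field_derivative_def has_derivative_within_alt
proof (intro conjI allI impI)
  show "bounded_linear ((*) (max 0 x))"
    by (rule bounded_linear_mult_right)
  fix e :: real assume e: "e > 0"
  have bound: "\<bar>(max 0 y)\<^sup>2 / 2 - (max 0 x)\<^sup>2 / 2 - max 0 x * (y - x)\<bar> \<le> \<bar>y - x\<bar> * \<bar>y - x\<bar>" for y
  proof -
    have "(max 0 y)\<^sup>2 / 2 - (max 0 x)\<^sup>2 / 2 - max 0 x * (y - x) =
        (max 0 y - max 0 x)\<^sup>2 / 2 + max 0 x * (max 0 y - y)"
      by (cases "x \<le> 0") (simp_all add: max_def power2_eq_square field_simps)
    moreover have "0 \<le> max 0 x * (max 0 y - y)"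
      by simp
    moreover have "(max 0 y - max 0 x)\<^sup>2 / 2 + max 0 x * (max 0 y - y) \<le> (y - x)\<^sup>2"
    proof (cases "0 < x \<and> y < 0")
      case True
      then have "x * y \<le> 0" by (simp add: mult_le_0_iff)
      then have "x * y + x * x / 2 \<le> x * x + y * y"
        using zero_le_square[of x] zero_le_square[of y] by linarith
      then show ?thesis
        using True by (simp add: max_def power2_eq_square algebra_simps)
    next
      case False
      then have "\<bar>max 0 y - max 0 x\<bar> \<le> \<bar>y - x\<bar>" "max 0 x * (max 0 y - y) = 0"
        by (auto simp: max_def)
      then have "(max 0 y - max 0 x)\<^sup>2 \<le> (y - x)\<^sup>2"
        by (simp add: abs_le_square_iff)
      with \<open>max 0 x * (max 0 y - y) = 0\<close> show ?thesis
        using zero_le_power2[of "y - x"] by linarith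
    qed
    ultimately show ?thesis
      by (simp add: power2_eq_square abs_mult_self_eq)
  qed
  show "\<exists>d>0. \<forall>y\<in>UNIV. norm (y - x) < d \<longrightarrow>
      norm ((max 0 y)\<^sup>2 / 2 - (max 0 x)\<^sup>2 / 2 - max 0 x * (y - x)) \<le> e * norm (y - x)"
  proof (intro exI[of _ e] conjI ballI impI e)
    fix y assume "norm (y - x) < e"
    then have "\<bar>y - x\<bar> * \<bar>y - x\<bar> \<le> e * \<bar>y - x\<bar>"
      by (intro mult_right_mono) auto
    with bound[of y] show "norm ((max 0 y)\<^sup>2 / 2 - (max 0 x)\<^sup>2 / 2 - max 0 x * (y - x)) \<le> e * norm (y - x)"
      by simp
  qed
qed

lemma DERIV_ramp: "(ramp has_real_derivative ramp' x) (at x)"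
proof -
  have "((\<lambda>x. x - 1) has_real_derivative 1) (at x)"
    by (auto intro!: derivative_eq_intros)
  then have "((\<lambda>x. (max 0 (x - 1))\<^sup>2 / 2) has_real_derivative max 0 (x - 1)) (at x)"
    using DERIV_chain2[OF DERIV_half_square_max, of "\<lambda>x. x - 1" 1 x UNIV] by simp
  from DERIV_diff[OF DERIV_half_square_max this] show ?thesis
    by (simp add: ramp_def[abs_def] ramp'_def)
qed

lemma DERIV_bump: "(bump n has_real_derivative bump' n x) (at x)"
proof -
  have "((\<lambda>x. x - (real n + 1)) has_real_derivative 1) (at x)"
    by (auto intro!: derivative_eq_intros)
  then have "((\<lambda>x. ramp (x - (real n + 1))) has_real_derivative ramp' (x - (real n + 1))) (at x)"
    using DERIV_chain2[OF DERIV_ramp, of "\<lambda>x. x - (real n + 1)" 1 x UNIV] by simp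
  from DERIV_diff[OF DERIV_ramp this] show ?thesis
    by (simp add: bump_def[abs_def] bump'_def)
qed

lemma bump'_bounds: "0 \<le> bump' n x" "bump' n x \<le> 1"
  by (auto simp: bump'_def ramp'_def max_def)

lemma bump'_eq_0: "x \<le> 0 \<or> real n + 2 \<le> x \<Longrightarrow> bump' n x = 0"
  by (auto simp: bump'_def ramp'_def max_def)

lemma bump'_Lipschitz: "\<bar>bump' n x - bump' n y\<bar> \<le> 2 * \<bar>x - y\<bar>"
proof -
  have lip: "\<bar>ramp' x - ramp' y\<bar> \<le> \<bar>x - y\<bar>" for x y
    by (auto simp: ramp'_def max_def)
  let ?a = "ramp' x - ramp' y" and ?b = "ramp' (x - (real n + 1)) - ramp' (y - (real n + 1))"
  have "bump' n x - bump' n y = ?a - ?b"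
    by (simp add: bump'_def)
  moreover have "\<bar>?b\<bar> \<le> \<bar>x - y\<bar>"
    using lip[of "x - (real n + 1)" "y - (real n + 1)"] by simp
  ultimately show ?thesis
    using abs_triangle_ineq4[of ?a ?b] lip[of x y] by simp
qed

lemma ramp_eq: "x \<le> 0 \<Longrightarrow> ramp x = 0" "1 \<le> x \<Longrightarrow> ramp x = x - 1 / 2"
  by (simp_all add: ramp_def max_def power2_eq_square field_simps)

lemma bump_eq:
  "x \<le> 0 \<Longrightarrow> bump n x = 0" "real n + 2 \<le> x \<Longrightarrow> bump n x = real n + 1"
  "bump n (real n + 1) = real n + 1 / 2"
  by (simp_all add: bump_def ramp_eq)

lemma bump_mono: "x \<le> y \<Longrightarrow> bump n x \<le> bump n y"
  by (rule DERIV_nonneg_imp_nondecreasing) (use DERIV_bump bump'_bounds in blast)+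

lemma bump_bounds: "0 \<le> bump n x" "bump n x \<le> real n + 1"
  using bump_mono[of "min x 0" x n] bump_mono[of x "max x (real n + 2)" n] by (auto simp: bump_eq)

lemma continuous_on_bump: "continuous_on A (bump n)"
  by (rule DERIV_continuous_on) (rule has_field_derivative_at_within[OF DERIV_bump])

lemma continuous_on_bump': "continuous_on A (bump' n)"
  unfolding bump'_def[abs_def] ramp'_def by (intro continuous_intros)

lemma vanishing_compact_support:
  assumes "continuous_on UNIV g" "\<And>t. t \<le> a \<or> b \<le> t \<Longrightarrow> g t = 0"
  shows "g \<in> vanishing"
proof -
  have "\<forall>\<^sub>F t in at_top. g t = 0" "\<forall>\<^sub>F t in at_bot. g t = 0"
    using assms(2) unfolding eventually_at_top_linorder eventually_at_bot_linorder by blast+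
  then show ?thesis
    using assms(1) by (auto simp: vanishing_def intro: tendsto_eventually)
qed

subsection \<open>Trajectories and the generator\<close>

locale exp_evolution = h_evolution exp V \<alpha> K
  for V :: "real \<Rightarrow> real \<Rightarrow> 'a::complex_banach \<Rightarrow> 'a" and \<alpha> K
begin

lemma lg_id [simp]: "lg s = s"
  by (simp add: lg_def)

lemma norm_V_le: "s \<le> t \<Longrightarrow> norm (V t s x) \<le> K * exp (\<alpha> * (t - s)) * norm x"
  using norm_U_le[of s t x] by simp

lemma norm_V_le_within: 
  assumes "s \<le> t" "t - s \<le> b"
  shows "norm (V t s x) \<le> K * exp (\<alpha> * b) * norm x"
proof -
  have "K * exp (\<alpha> * (t - s)) * norm x \<le> K * exp (\<alpha> * b) * norm x"
    using assms alpha_pos K_ge_1 by (intro mult_right_mono mult_left_mono) auto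
  with norm_V_le[OF assms(1), of x] show ?thesis by linarith
qed

lemmas V_lin_simps = linear_add[OF U_lin] linear_diff[OF U_lin] linear_0[OF U_lin]
  linear_cmul[OF U_lin] linear_neg[OF U_lin]

text \<open>Transporting everything to time t turns an increment of the differentiated function into
  the image under \<open>V\<close> of the expression that \<open>evol_gen\<close> controls.\<close>

lemma evol_gen_derivative:
  assumes u: "continuous_on UNIV u" and g: "continuous_on UNIV g" and gen: "evol_gen V u g"
    and r: "r \<le> t"
  shows "((\<lambda>r. V t r (u r)) has_vector_derivative - V t r (g r)) (at r within {..t})"
  unfolding has_vector_derivative_def has_derivative_within_alt
proof (intro conjI allI impI)
  show "bounded_linear (\<lambda>x. x *\<^sub>R - V t r (g r))"
    by (rule bounded_linear_scaleR_left)
  fix e :: real assume e: "e > 0"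
  define M where "M = K * exp (\<alpha> * (t - r + 1))"
  have M: "M > 0"
    using K_ge_1 by (simp add: M_def)
  let ?f = "\<lambda>r. V t r (u r)" and ?X = "V t r (g r)"
  obtain d1 where d1: "d1 > 0" "\<And>\<tau> s. 0 < \<tau> \<Longrightarrow> \<tau> < d1 \<Longrightarrow>
      norm (V s (s - \<tau>) (u (s - \<tau>)) - u s - \<tau> *\<^sub>R g s) \<le> e / (2 * M) * \<tau>"
    using gen e M unfolding evol_gen_def by (metis divide_pos_pos mult_pos_pos zero_less_numeral)
  have "continuous_on {..t} (\<lambda>q. V t q (g q))"
    by (intro continuous_on_U continuous_intros continuous_on_subset[OF g]) auto
  then obtain d2 where d2: "d2 > 0" "\<And>q. q \<le> t \<Longrightarrow> dist q r < d2 \<Longrightarrow> dist (V t q (g q)) ?X < e / 2"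
    using r e unfolding continuous_on_iff by (metis atMost_iff half_gt_zero)
  \<comment> \<open>\<open>evol_gen\<close> compares a time with an earlier one, so the remainder is
    taken at the later time \<open>q\<close>. As its bound is uniform in time, \<open>q\<close> may
    be \<open>r\<close> or the moving point, which yields both one-sided derivatives.\<close>
  have key: "norm (?f q - ?f p + (q - p) *\<^sub>R ?X) \<le> e * (q - p)"
    if "p < q" "q \<le> t" "p = r \<or> q = r" "q - p < min d1 (min d2 1)" for p q
  proof -
    let ?R = "V q p (u p) - u q - (q - p) *\<^sub>R g q"
    have "?f q - ?f p + (q - p) *\<^sub>R ?X = (q - p) *\<^sub>R (?X - V t q (g q)) - V t q ?R"
      using that by (simp add: V_lin_simps U_comp algebra_simps)
    also have "norm \<dots> \<le> norm ((q - p) *\<^sub>R (?X - V t q (g q))) + norm (V t q ?R)"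
      by (rule norm_triangle_ineq4)
    also have "norm ((q - p) *\<^sub>R (?X - V t q (g q))) \<le> (q - p) * (e / 2)"
      using d2(2)[of q] that
      by (auto simp: dist_norm norm_minus_commute dist_real_def intro!: mult_left_mono)
    also have "norm (V t q ?R) \<le> M * norm ?R"
      unfolding M_def using that by (intro norm_V_le_within) auto
    also have "\<dots> \<le> M * (e / (2 * M) * (q - p))"
      using d1(2)[of "q - p" q] that M by (intro mult_left_mono) auto
    also have "\<dots> = (q - p) * (e / 2)"
      using M by simp
    finally show ?thesis
      by (simp add: algebra_simps)
  qed
  show "\<exists>d>0. \<forall>y\<in>{..t}. norm (y - r) < d \<longrightarrow>
      norm (?f y - ?f r - (y - r) *\<^sub>R - ?X) \<le> e * norm (y - r)"
  proof (intro exI[of _ "min d1 (min d2 1)"] conjI ballI impI)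
    fix y assume y: "y \<in> {..t}" "norm (y - r) < min d1 (min d2 1)"
    consider "y = r" | "r < y" | "y < r" by linarith
    then show "norm (?f y - ?f r - (y - r) *\<^sub>R - ?X) \<le> e * norm (y - r)"
    proof cases
      case 2
      then show ?thesis
        using key[of r y] y by simp
    next
      case 3
      have "?f y - ?f r - (y - r) *\<^sub>R - ?X = - (?f r - ?f y + (r - y) *\<^sub>R ?X)"
        by (simp add: algebra_simps)
      then have "norm (?f y - ?f r - (y - r) *\<^sub>R - ?X) = norm (?f r - ?f y + (r - y) *\<^sub>R ?X)"
        by (simp only: norm_minus_cancel)
      then show ?thesis
        using key[of y r] y r 3 by simp
    qed simp
  qed (use d1 d2 in auto)
qed

text \<open>Variation of constants without an integral: the transported source runs along a single
  vector \<open>z\<close>, so an antiderivative of its coefficient is enough, and the combination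
  stated here has derivative 0.\<close>

lemma evol_gen_solution:
  assumes u: "continuous_on UNIV u" and g: "continuous_on UNIV g" and gen: "evol_gen V u g"
    and r: "r \<le> t" and z: "\<And>\<rho>. r \<le> \<rho> \<Longrightarrow> \<rho> \<le> t \<Longrightarrow> V t \<rho> (g \<rho>) = \<psi> \<rho> *\<^sub>R z"
    and \<phi>: "\<And>\<rho>. (\<phi> has_real_derivative \<psi> \<rho>) (at \<rho>)"
  shows "V t r (u r) + \<phi> r *\<^sub>R z = u t + \<phi> t *\<^sub>R z"
proof -
  let ?f = "\<lambda>\<rho>. V t \<rho> (u \<rho>) + \<phi> \<rho> *\<^sub>R z"
  have "(?f has_vector_derivative 0) (at \<rho> within {r..t})" if "\<rho> \<in> {r..t}" for \<rho>
  proof -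
    have "((\<lambda>\<rho>. V t \<rho> (u \<rho>)) has_vector_derivative - V t \<rho> (g \<rho>)) (at \<rho> within {r..t})"
      by (rule has_vector_derivative_within_subset[OF evol_gen_derivative[OF u g gen]])
        (use that in auto)
    moreover have "((\<lambda>\<rho>. \<phi> \<rho> *\<^sub>R z) has_vector_derivative \<psi> \<rho> *\<^sub>R z) (at \<rho> within {r..t})"
      using has_vector_derivative_scaleR[OF has_field_derivative_at_within[OF \<phi>]
          has_vector_derivative_const[of z]] by simp
    ultimately show ?thesis
      using has_vector_derivative_add z that by fastforce
  qed
  then obtain c where "\<And>\<rho>. \<rho> \<in> {r..t} \<Longrightarrow> ?f \<rho> = c"
    using has_vector_derivative_zero_constant[of "{r..t}" ?f] by auto
  from this[of r] this[of t] r show ?thesis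
    by simp
qed

text \<open>Product rule for a trajectory times a scalar weight. The hypothesis on \<open>V\<close>
  asks \<open>y\<close> to be a trajectory only where the weight is nonzero. Compact support and the
  Lipschitz bound on the derivative of the weight make the error uniform in time.\<close>

lemma evol_gen_weight:
  assumes y: "continuous_on UNIV y"
    and V: "\<And>t \<tau>. 0 \<le> \<tau> \<Longrightarrow> V t (t - \<tau>) (\<phi> (t - \<tau>) *\<^sub>R y (t - \<tau>)) = \<phi> (t - \<tau>) *\<^sub>R y t"
    and \<phi>: "\<And>t. (\<phi> has_real_derivative \<psi> t) (at t)"
    and supp: "\<And>t. t \<le> a \<or> b \<le> t \<Longrightarrow> \<psi> t = 0"
    and lip: "\<And>s t. \<bar>\<psi> s - \<psi> t\<bar> \<le> 2 * \<bar>s - t\<bar>"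
  shows "evol_gen V (\<lambda>t. \<phi> t *\<^sub>R y t) (\<lambda>t. - \<psi> t *\<^sub>R y t)"
  unfolding evol_gen_def
proof (intro allI impI)
  fix e :: real assume e: "e > 0"
  have "bounded (y ` {a..b + 1})"
    by (intro compact_imp_bounded compact_continuous_image continuous_on_subset[OF y]) auto
  then obtain M where M: "M > 0" "\<And>t. t \<in> {a..b + 1} \<Longrightarrow> norm (y t) \<le> M"
    unfolding bounded_pos by blast
  have "norm (V s (s - \<tau>) (\<phi> (s - \<tau>) *\<^sub>R y (s - \<tau>)) - \<phi> s *\<^sub>R y s - \<tau> *\<^sub>R - \<psi> s *\<^sub>R y s) \<le> e * \<tau>"
    if \<tau>: "0 < \<tau>" "\<tau> < min 1 (e / (2 * M))" for \<tau> s
  proof -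
    obtain \<xi> where \<xi>: "s - \<tau> < \<xi>" "\<xi> < s" "\<phi> s - \<phi> (s - \<tau>) = (s - (s - \<tau>)) * \<psi> \<xi>"
      using MVT2[of "s - \<tau>" s \<phi> \<psi>] \<phi> \<tau>(1) by auto
    have \<phi>_eq: "\<phi> (s - \<tau>) = \<phi> s - \<tau> * \<psi> \<xi>"
      using \<xi>(3) by simp
    have "V s (s - \<tau>) (\<phi> (s - \<tau>) *\<^sub>R y (s - \<tau>)) - \<phi> s *\<^sub>R y s - \<tau> *\<^sub>R - \<psi> s *\<^sub>R y s
        = (\<tau> * (\<psi> s - \<psi> \<xi>)) *\<^sub>R y s"
      using \<tau>(1) by (simp add: V) (simp add: \<phi>_eq algebra_simps)
    \<comment> \<open>Where \<psi> can matter, its oscillation is at most 2 \<tau> and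
      \<open>y\<close> is at most \<open>M\<close>. Outside, \<xi> lies less than 1 before s, so
      both values of \<psi> vanish; this is why the interval reaches up to b + 1.\<close>
    moreover have "\<bar>\<psi> s - \<psi> \<xi>\<bar> * norm (y s) \<le> e"
    proof (cases "s \<in> {a..b + 1}")
      case True
      have "\<bar>\<psi> s - \<psi> \<xi>\<bar> \<le> 2 * \<tau>"
        using lip[of s \<xi>] \<xi> by simp
      then have "\<bar>\<psi> s - \<psi> \<xi>\<bar> * norm (y s) \<le> (2 * \<tau>) * M"
        using M(2)[OF True] \<tau> by (intro mult_mono) auto
      also have "\<dots> \<le> e"
        using \<tau> M(1) by (simp add: field_simps)
      finally show ?thesis .
    next
      case False
      then have "\<psi> s = 0 \<and> \<psi> \<xi> = 0"
        using \<xi> \<tau> supp[of s] supp[of \<xi>] by auto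
      then show ?thesis
        using e by simp
    qed
    then have "\<tau> * (\<bar>\<psi> s - \<psi> \<xi>\<bar> * norm (y s)) \<le> \<tau> * e"
      using \<tau>(1) by (intro mult_left_mono) auto
    ultimately show ?thesis
      using \<tau>(1) by (simp add: abs_mult mult.assoc mult.commute[of e])
  qed
  then show "\<exists>d>0. \<forall>\<tau>. 0 < \<tau> \<longrightarrow> \<tau> < d \<longrightarrow> (\<forall>s. norm (V s (s - \<tau>) (\<phi> (s - \<tau>) *\<^sub>R y (s - \<tau>)) -
      \<phi> s *\<^sub>R y s - \<tau> *\<^sub>R - \<psi> s *\<^sub>R y s) \<le> e * \<tau>)"
    using e M(1) by (intro exI[of _ "min 1 (e / (2 * M))"]) auto
qed

lemma continuous_on_trajectory:
  assumes "\<And>r t. r \<le> t \<Longrightarrow> w t = V t r (w r)"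
  shows "continuous_on UNIV w"
proof -
  have "isCont w t0" for t0
  proof -
    have "continuous_on {t0 - 1<..} (\<lambda>t. V t (t0 - 1) (w (t0 - 1)))"
      by (intro continuous_on_U continuous_intros) auto
    moreover have "V t (t0 - 1) (w (t0 - 1)) = w t" if "t \<in> {t0 - 1<..}" for t
      using that assms[of "t0 - 1" t] by simp
    ultimately have "continuous_on {t0 - 1<..} w"
      by (rule continuous_on_eq)
    then show ?thesis
      by (simp add: continuous_on_eq_continuous_at)
  qed
  then show ?thesis
    by (simp add: continuous_on_eq_continuous_at)
qed

section \<open>Stable and unstable subspaces\<close>

definition stable :: "real \<Rightarrow> 'a set" where
  "stable s = {x. ((\<lambda>t. V t s x) \<longlongrightarrow> 0) at_top}"

text \<open>\<open>V\<close> may fail to be invertible, so a backward orbit through \<open>x\<close>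
  may not exist or not be unique; it is therefore carried along as a complete trajectory.\<close>

definition trajectory_to :: "real \<Rightarrow> 'a \<Rightarrow> (real \<Rightarrow> 'a) \<Rightarrow> bool" where
  "trajectory_to s x y \<longleftrightarrow>
     y s = x \<and> (\<forall>r t. r \<le> t \<longrightarrow> y t = V t r (y r)) \<and> (y \<longlongrightarrow> 0) at_bot"

definition unstable :: "real \<Rightarrow> 'a set" where
  "unstable s = {x. \<exists>y. trajectory_to s x y}"

lemma trajectory_toI:
  assumes "y s = x" "\<And>r t. r \<le> t \<Longrightarrow> t \<le> s \<Longrightarrow> y t = V t r (y r)" "(y \<longlongrightarrow> 0) at_bot"
  shows "trajectory_to s x (\<lambda>t. if t \<le> s then y t else V t s x)"
  unfolding trajectory_to_def
proof (intro conjI allI impI)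
  have "\<forall>\<^sub>F t in at_bot. y t = (if t \<le> s then y t else V t s x)"
    using eventually_le_at_bot[of s] by eventually_elim simp
  then show "((\<lambda>t. if t \<le> s then y t else V t s x) \<longlongrightarrow> 0) at_bot"
    by (rule Lim_transform_eventually[OF assms(3)])
  fix r t :: real assume "r \<le> t"
  then show "(if t \<le> s then y t else V t s x) = V t r (if r \<le> s then y r else V r s x)"
    using assms(1) assms(2)[of r t] assms(2)[of r s] by (auto simp: U_comp)
qed (use assms(1) in simp)

lemma unstableI:
  assumes "\<And>r t. r \<le> t \<Longrightarrow> t \<le> s \<Longrightarrow> y t = V t r (y r)" "(y \<longlongrightarrow> 0) at_bot"
  shows "y s \<in> unstable s"
  using trajectory_toI[of y s "y s"] assms by (auto simp: unstable_def)

lemma trajectory_to_shift: "trajectory_to s x y \<Longrightarrow> trajectory_to t (y t) y"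
  by (simp add: trajectory_to_def)

lemma stable_V:
  assumes "x \<in> stable s" "s \<le> t"
  shows "V t s x \<in> stable t"
proof -
  have "\<forall>\<^sub>F \<tau> in at_top. V \<tau> s x = V \<tau> t (V t s x)"
    using eventually_ge_at_top[of t] by eventually_elim (simp add: U_comp assms)
  then show ?thesis
    using assms(1) by (auto simp: stable_def elim: Lim_transform_eventually)
qed

lemma unstable_V:
  assumes "x \<in> unstable s" "s \<le> t"
  shows "V t s x \<in> unstable t"
proof -
  obtain y where y: "trajectory_to s x y"
    using assms(1) by (auto simp: unstable_def)
  then have "y t = V t s x"
    using assms(2) by (auto simp: trajectory_to_def)
  then show ?thesis
    using trajectory_to_shift[OF y, of t] by (auto simp: unstable_def)
qed

lemma stable_zero_image:
  assumes "s \<le> t" "V t s x = 0"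
  shows "x \<in> stable s"
proof -
  have "\<forall>\<^sub>F \<tau> in at_top. V \<tau> s x = 0"
    using eventually_ge_at_top[of t]
  proof eventually_elim
    case (elim \<tau>)
    then show ?case
      using assms U_comp[of s t \<tau> x] by (simp add: V_lin_simps)
  qed
  then show ?thesis
    by (simp add: stable_def tendsto_eventually)
qed

lemma stable_lin:
  assumes "x \<in> stable s" "x' \<in> stable s"
  shows "x + x' \<in> stable s" "x - x' \<in> stable s" "c *\<^sub>C x \<in> stable s"
proof -
  have x: "((\<lambda>t. V t s x) \<longlongrightarrow> 0) at_top" "((\<lambda>t. V t s x') \<longlongrightarrow> 0) at_top"
    using assms by (auto simp: stable_def)
  have lim: "z \<in> stable s" if "(f \<longlongrightarrow> 0) at_top" "\<And>t. s \<le> t \<Longrightarrow> f t = V t s z" for f z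
    unfolding stable_def mem_Collect_eq
    by (rule Lim_transform_eventually[OF that(1)])
      (rule eventually_mono[OF eventually_ge_at_top[of s] that(2)])
  show "x + x' \<in> stable s"
    using tendsto_add[OF x] by (intro lim[of "\<lambda>t. V t s x + V t s x'"]) (simp_all add: V_lin_simps)
  show "x - x' \<in> stable s"
    using tendsto_diff[OF x] by (intro lim[of "\<lambda>t. V t s x - V t s x'"]) (simp_all add: V_lin_simps)
  show "c *\<^sub>C x \<in> stable s"
    using bounded_linear.tendsto[OF bounded_linear_scaleC x(1), of c]
    by (intro lim[of "\<lambda>t. c *\<^sub>C V t s x"]) (simp_all add: bounded_clinear_scaleC[OF U_clin])
qed

lemma unstable_lin:
  assumes "x \<in> unstable s" "x' \<in> unstable s"
  shows "x + x' \<in> unstable s" "x - x' \<in> unstable s" "c *\<^sub>C x \<in> unstable s"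
proof -
  obtain y y' where y: "y s = x" "\<And>r t. r \<le> t \<Longrightarrow> y t = V t r (y r)" "(y \<longlongrightarrow> 0) at_bot"
    and y': "y' s = x'" "\<And>r t. r \<le> t \<Longrightarrow> y' t = V t r (y' r)" "(y' \<longlongrightarrow> 0) at_bot"
    using assms unfolding unstable_def trajectory_to_def by blast
  show "x + x' \<in> unstable s"
    using unstableI[of s "\<lambda>t. y t + y' t"] y y' tendsto_add[OF y(3) y'(3)]
    by (simp add: V_lin_simps)
  show "x - x' \<in> unstable s"
    using unstableI[of s "\<lambda>t. y t - y' t"] y y' tendsto_diff[OF y(3) y'(3)]
    by (simp add: V_lin_simps)
  show "c *\<^sub>C x \<in> unstable s"
    using unstableI[of s "\<lambda>t. c *\<^sub>C y t"] y bounded_linear.tendsto[OF bounded_linear_scaleC y(3), of c]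
    by (simp add: bounded_clinear_scaleC[OF U_clin])
qed

end

text \<open>Invertibility of the generator; uniqueness of the solution is the bound with \<open>M = 0\<close>.\<close>

locale admissible = exp_evolution V \<alpha> K
  for V :: "real \<Rightarrow> real \<Rightarrow> 'a::complex_banach \<Rightarrow> 'a" and \<alpha> K +
  fixes C :: real
  assumes C_pos: "C > 0"
    and solvable: "\<And>g. g \<in> vanishing \<Longrightarrow> \<exists>u\<in>vanishing. evol_gen V u g"
    and solution_bound: "\<And>u g M t. u \<in> vanishing \<Longrightarrow> g \<in> vanishing \<Longrightarrow> evol_gen V u g \<Longrightarrow>
      (\<And>s. norm (g s) \<le> M) \<Longrightarrow> norm (u t) \<le> C * M"
begin

text \<open>Such a vector lies on a complete trajectory vanishing at both ends, which is an element
  of the kernel of the generator.\<close>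

lemma stable_unstable_trivial:
  assumes "x \<in> stable s" "x \<in> unstable s"
  shows "x = 0"
proof -
  obtain w where w: "w s = x" "\<And>r t. r \<le> t \<Longrightarrow> w t = V t r (w r)" "(w \<longlongrightarrow> 0) at_bot"
    using assms(2) unfolding unstable_def trajectory_to_def by blast
  have "\<forall>\<^sub>F t in at_top. V t s x = w t"
    using eventually_ge_at_top[of s] by eventually_elim (use w in simp)
  then have "(w \<longlongrightarrow> 0) at_top"
    using assms(1) by (auto simp: stable_def elim: Lim_transform_eventually)
  then have "w \<in> vanishing"
    using w(3) continuous_on_trajectory[OF w(2)] by (simp add: vanishing_def)
  moreover have "(\<lambda>_. 0) \<in> vanishing"
    by (simp add: vanishing_def)
  moreover have "V t (t - \<tau>) (w (t - \<tau>)) = w t" if "0 < \<tau>" for t \<tau>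
    using w(2)[of "t - \<tau>" t] that by simp
  then have "evol_gen V w (\<lambda>_. 0)"
    by (auto simp: evol_gen_def intro!: exI[of _ 1])
  ultimately have "norm (w s) \<le> C * 0"
    by (rule solution_bound) simp
  then show ?thesis
    using w(1) by simp
qed

text \<open>Solving for the source \<open>- bump' 0 (t - s) *\<^sub>R V t s x\<close> splits \<open>x\<close> at time \<open>s\<close> into a part that
  decays forwards and a part that decays backwards.\<close>

definition source :: "real \<Rightarrow> 'a \<Rightarrow> real \<Rightarrow> 'a" where
  "source s x t = - bump' 0 (t - s) *\<^sub>R V (max t s) s x"

definition sol :: "real \<Rightarrow> 'a \<Rightarrow> real \<Rightarrow> 'a" where
  "sol s x = (SOME u. u \<in> vanishing \<and> evol_gen V u (source s x))"

text \<open>The minus sign: from time s + 2 on the solution equals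
  \<open>V t s (sol s x s + x)\<close>, so it is \<open>x + sol s x s\<close> that decays forwards,
  while \<open>sol s x s\<close> continues the solution's decaying past.\<close>

definition Q :: "real \<Rightarrow> 'a \<Rightarrow> 'a" where "Q s x = - sol s x s"

definition P :: "real \<Rightarrow> 'a \<Rightarrow> 'a" where "P s x = x - Q s x"

text \<open>The source lives on an interval of length 2, over which trajectories grow by at most
  \<open>K * exp (\<alpha> * 2)\<close>; \<open>C\<close> bounds the resulting solution. Adding 1
  lets the same constant cover the initial stretch in \<open>stable_bound\<close>.\<close>

definition C1 :: real where "C1 = (C + 1) * (K * exp (\<alpha> * 2))"

lemma C1_pos: "C1 \<ge> 1"
proof -
  have "1 * (1 * 1) \<le> (C + 1) * (K * exp (\<alpha> * 2))"
    using C_pos K_ge_1 alpha_pos by (intro mult_mono) auto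
  then show ?thesis by (simp add: C1_def)
qed

lemma continuous_on_forward: "continuous_on UNIV (\<lambda>t. V (max t s) s x)"
  by (intro continuous_on_U continuous_intros) auto

lemma source_continuous: "continuous_on UNIV (source s x)"
  unfolding source_def
  by (intro continuous_intros continuous_on_forward continuous_on_compose2[OF continuous_on_bump'[of UNIV]]) auto

lemma source_vanishing: "source s x \<in> vanishing"
  by (rule vanishing_compact_support[OF source_continuous, where a = s and b = "s + 2"])
    (auto simp: source_def intro: bump'_eq_0)

lemma sol: "sol s x \<in> vanishing" "evol_gen V (sol s x) (source s x)"
  using someI_ex[of "\<lambda>u. u \<in> vanishing \<and> evol_gen V u (source s x)"] solvable[OF source_vanishing]
  unfolding sol_def by auto

lemma sol_continuous: "continuous_on UNIV (sol s x)"
  using sol by (simp add: vanishing_def)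

lemma norm_sol_le: "norm (sol s x t) \<le> C * (K * exp (\<alpha> * 2) * norm x)"
proof (rule solution_bound[OF sol(1) source_vanishing sol(2)])
  fix t
  show "norm (source s x t) \<le> K * exp (\<alpha> * 2) * norm x"
  proof (cases "s \<le> t \<and> t \<le> s + 2")
    case True
    have "norm (source s x t) \<le> 1 * norm (V (max t s) s x)"
      unfolding source_def norm_scaleR using bump'_bounds[of 0 "t - s"]
      by (intro mult_right_mono) auto
    also have "\<dots> \<le> K * exp (\<alpha> * 2) * norm x"
      using norm_V_le_within[of s "max t s" 2 x] True by simp
    finally show ?thesis .
  next
    case False
    then show ?thesis
      using K_ge_1 by (auto simp: source_def bump'_eq_0)
  qed
qed

lemma norm_sol_le': "norm (sol s x t) \<le> C1 * norm x"
proof -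
  have "C * (K * exp (\<alpha> * 2) * norm x) \<le> (C + 1) * (K * exp (\<alpha> * 2) * norm x)"
    using K_ge_1 by (intro mult_right_mono) auto
  with norm_sol_le[of s x t] show ?thesis
    by (simp add: C1_def mult.assoc)
qed

lemma sol_before:
  assumes "r \<le> t" "t \<le> s"
  shows "sol s x t = V t r (sol s x r)"
  using evol_gen_solution[OF sol_continuous source_continuous sol(2) assms(1),
      where \<psi> = "\<lambda>_. 0" and \<phi> = "\<lambda>_. 0" and z = 0] assms(2)
  by (simp add: source_def bump'_eq_0 V_lin_simps)

text \<open>The source is a multiple of the trajectory starting at \<open>x\<close>; transported to
  time t all its values are multiples of \<open>V t s x\<close>, and \<open>bump 0\<close> records
  the accumulated coefficient.\<close>

lemma sol_after:
  assumes "s \<le> t"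
  shows "sol s x t = V t s (sol s x s) + bump 0 (t - s) *\<^sub>R V t s x"
proof -
  have "V t s (sol s x s) + (- bump 0 (s - s)) *\<^sub>R V t s x = sol s x t + (- bump 0 (t - s)) *\<^sub>R V t s x"
  proof (rule evol_gen_solution[OF sol_continuous source_continuous sol(2) assms,
      where \<psi> = "\<lambda>\<rho>. - bump' 0 (\<rho> - s)" and \<phi> = "\<lambda>\<rho>. - bump 0 (\<rho> - s)"])
    show "V t \<rho> (source s x \<rho>) = - bump' 0 (\<rho> - s) *\<^sub>R V t s x" if "s \<le> \<rho>" "\<rho> \<le> t" for \<rho>
      using that by (simp add: source_def V_lin_simps U_comp)
    show "((\<lambda>\<rho>. - bump 0 (\<rho> - s)) has_real_derivative - bump' 0 (\<rho> - s)) (at \<rho>)" for \<rho>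
    proof -
      have "((\<lambda>\<rho>. \<rho> - s) has_real_derivative 1) (at \<rho>)"
        by (auto intro!: derivative_eq_intros)
      from DERIV_minus[OF DERIV_chain2[OF DERIV_bump this]] show ?thesis by simp
    qed
  qed
  then show ?thesis
    by (simp add: bump_eq algebra_simps)
qed

lemma P_stable: "P s x \<in> stable s"
proof -
  have "\<forall>\<^sub>F t in at_top. sol s x t = V t s (P s x)"
    using eventually_ge_at_top[of "s + 2"]
  proof eventually_elim
    case (elim t)
    then have "bump 0 (t - s) = 1"
      by (simp add: bump_eq)
    then show ?case
      using elim sol_after[of s t x] by (simp add: P_def Q_def V_lin_simps)
  qed
  moreover have "(sol s x \<longlongrightarrow> 0) at_top"
    using sol by (simp add: vanishing_def)
  ultimately show ?thesis
    by (auto simp: stable_def elim: Lim_transform_eventually)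
qed

lemma sol_unstable:
  assumes "r \<le> s"
  shows "- sol s x r \<in> unstable r"
  using unstableI[of r "\<lambda>t. - sol s x t"] sol_before[of _ _ s x] sol(1)[of s x] assms
  by (simp add: V_lin_simps vanishing_def tendsto_minus_cancel_left[symmetric])

lemma Q_unstable: "Q s x \<in> unstable s"
  unfolding Q_def by (rule sol_unstable) simp

text \<open>Two splittings differ by a vector that is both stable and unstable. Since
  \<open>sol\<close> is merely a chosen solution, linearity of \<open>P\<close> and its
  compatibility with \<open>V\<close> are derived from this uniqueness.\<close>

lemma P_eqI:
  assumes "a \<in> stable s" "b \<in> unstable s" "a + b = x"
  shows "P s x = a" "Q s x = b"
proof -
  have "a - P s x = Q s x - b"
    using assms(3) by (simp add: P_def algebra_simps)
  then have "a - P s x = 0"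
    using stable_unstable_trivial[of "a - P s x" s] stable_lin(2)[OF assms(1) P_stable]
      unstable_lin(2)[OF Q_unstable assms(2)] by metis
  then show "P s x = a" "Q s x = b"
    using assms(3) by (auto simp: P_def algebra_simps)
qed

lemma zero_stable: "0 \<in> stable s" and zero_unstable: "0 \<in> unstable s"
  using stable_lin(2)[OF P_stable P_stable] unstable_lin(2)[OF Q_unstable Q_unstable]
  by (metis diff_self)+

lemma P_plus_Q: "P s x + Q s x = x"
  by (simp add: P_def)

lemma norm_Q_le: "norm (Q s x) \<le> C1 * norm x"
  unfolding Q_def using norm_sol_le' by simp

lemma norm_P_le: "norm (P s x) \<le> (1 + C1) * norm x"
  unfolding P_def using norm_triangle_ineq4[of x "Q s x"] norm_Q_le[of s x] by (simp add: algebra_simps)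

lemma is_projection_P: "is_projection (P s)"
  unfolding is_projection_def
proof (intro conjI allI)
  show "P s (P s x) = P s x" for x
    by (rule P_eqI[OF P_stable zero_unstable]) simp
  show "bounded_clinear (P s)"
  proof (rule bounded_clinearI)
    show "P s (x + y) = P s x + P s y" for x y
      by (rule P_eqI[OF stable_lin(1)[OF P_stable P_stable] unstable_lin(1)[OF Q_unstable[of s x] Q_unstable[of s y]]])
        (simp add: P_def)
    show "P s (c *\<^sub>C x) = c *\<^sub>C P s x" for c x
      by (rule P_eqI[OF stable_lin(3)[OF P_stable P_stable] unstable_lin(3)[OF Q_unstable[of s x] Q_unstable, of c]])
        (simp add: P_plus_Q flip: scaleC_add_right)
  qed (rule norm_P_le)
qed

lemma PV:
  assumes "s \<le> t"
  shows "P t (V t s x) = V t s (P s x)"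
proof (rule P_eqI[OF stable_V[OF P_stable assms] unstable_V[OF Q_unstable assms]])
  show "V t s (P s x) + V t s (Q s x) = V t s x"
    by (simp add: P_plus_Q flip: linear_add[OF U_lin[OF assms]])
qed

lemma range_compl_P: "range (compl_proj (P s)) = unstable s"
proof (intro set_eqI iffI)
  show "x \<in> range (compl_proj (P s))" if "x \<in> unstable s" for x
    using P_eqI(1)[OF zero_stable that, of x] by (auto simp: compl_proj_def intro: image_eqI[of _ _ x])
qed (auto simp: compl_proj_def P_def Q_unstable)

text \<open>Whatever \<open>V t s\<close> sends to zero is stable, so an unstable vector in the
  kernel vanishes.\<close>

lemma V_inj_unstable:
  assumes "s \<le> t" "x \<in> unstable s" "x' \<in> unstable s" "V t s x = V t s x'"
  shows "x = x'"
proof -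
  have "x - x' \<in> stable s"
    using assms by (intro stable_zero_image[OF assms(1)]) (simp add: V_lin_simps)
  then have "x - x' = 0"
    using unstable_lin(2)[OF assms(2,3)] by (rule stable_unstable_trivial)
  then show ?thesis by simp
qed

lemma bij_V_unstable:
  assumes "s \<le> t"
  shows "bij_betw (V t s) (unstable s) (unstable t)"
  unfolding bij_betw_def
proof (intro conjI inj_onI equalityI subsetI)
  fix x assume "x \<in> unstable t"
  then obtain y where y: "trajectory_to t x y"
    by (auto simp: unstable_def)
  then have "V t s (y s) = x" "y s \<in> unstable s"
    using assms trajectory_to_shift[OF y, of s] by (auto simp: trajectory_to_def unstable_def)
  then show "x \<in> V t s ` unstable s"
    by blast
qed (use assms V_inj_unstable unstable_V in blast)+

text \<open>For a stable vector the unstable part is 0, so from time s + 2 on the solution coincides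
  with the trajectory and its supremum bound applies; before that the growth bound suffices.\<close>

lemma stable_bound:
  assumes "x \<in> stable s" "s \<le> t"
  shows "norm (V t s x) \<le> C1 * norm x"
proof (cases "t \<le> s + 2")
  case True
  then have "norm (V t s x) \<le> 1 * (K * exp (\<alpha> * 2) * norm x)"
    using norm_V_le_within[of s t 2 x] assms(2) by simp
  also have "\<dots> \<le> (C + 1) * (K * exp (\<alpha> * 2) * norm x)"
    using C_pos K_ge_1 by (intro mult_right_mono) auto
  finally show ?thesis
    by (simp add: C1_def mult.assoc)
next
  case False
  have "Q s x = 0"
    by (rule P_eqI(2)[OF assms(1) zero_unstable]) simp
  then have "sol s x t = V t s x"
    using False sol_after[of s t x] by (simp add: Q_def V_lin_simps bump_eq)
  then show ?thesis
    using norm_sol_le'[of s x t] by simp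
qed

text \<open>The image at time t is unstable, hence equals its own \<open>Q\<close> part. Its
  backward orbit is minus the solution for the source at t, which at time s returns
  \<open>x\<close>; so the bound on solutions bounds \<open>x\<close>.\<close>

lemma unstable_bound:
  assumes "x \<in> unstable s" "s \<le> t"
  shows "norm x \<le> C1 * norm (V t s x)"
proof -
  let ?z = "V t s x"
  have "Q t ?z = ?z"
    by (rule P_eqI(2)[OF zero_stable unstable_V[OF assms]]) simp
  then have "V t s (- sol t ?z s) = V t s x"
    using sol_before[of s t t ?z] assms by (simp add: Q_def V_lin_simps)
  then have "- sol t ?z s = x"
    using V_inj_unstable[OF assms(2) sol_unstable[OF assms(2)] assms(1)] by blast
  then show ?thesis
    using norm_sol_le'[of t ?z s] by (metis norm_minus_cancel)
qed

text \<open>Both halving lemmas test the solution bound on \<open>bump n\<close> times a trajectory: the source has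
  slope at most one while the solution grows like \<open>n\<close>.\<close>

lemma stable_decay:
  assumes x: "x \<in> stable s"
  shows "(real n + 1 / 2) * norm (V (s + (real n + 1)) s x) \<le> C * (C1 * norm x)"
proof -
  \<comment> \<open>Before s this is the constant x, not a trajectory; \<open>bump n (t - s)\<close>
    vanishes there, and continuity is preserved.\<close>
  let ?y = "\<lambda>t. V (max t s) s x"
  let ?u = "\<lambda>t. bump n (t - s) *\<^sub>R ?y t" and ?g = "\<lambda>t. - bump' n (t - s) *\<^sub>R ?y t"
  have y_bound: "norm (?y t) \<le> C1 * norm x" for t
    by (rule stable_bound[OF x]) simp
  have gen: "evol_gen V ?u ?g"
  proof (rule evol_gen_weight[OF continuous_on_forward, where a = s and b = "s + real n + 2"])
    show "V t (t - \<tau>) (bump n (t - \<tau> - s) *\<^sub>R ?y (t - \<tau>)) = bump n (t - \<tau> - s) *\<^sub>R ?y t"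
      if "0 \<le> \<tau>" for t \<tau>
      using that by (cases "s \<le> t - \<tau>") (simp_all add: V_lin_simps U_comp max_def bump_eq)
    show "((\<lambda>t. bump n (t - s)) has_real_derivative bump' n (t - s)) (at t)" for t
    proof -
      have "((\<lambda>t. t - s) has_real_derivative 1) (at t)"
        by (auto intro!: derivative_eq_intros)
      from DERIV_chain2[OF DERIV_bump this] show ?thesis by simp
    qed
    show "\<bar>bump' n (r - s) - bump' n (t - s)\<bar> \<le> 2 * \<bar>r - t\<bar>" for r t
      using bump'_Lipschitz[of n "r - s" "t - s"] by simp
  qed (auto intro: bump'_eq_0)
  have cont: "continuous_on UNIV ?u" "continuous_on UNIV ?g"
    by (intro continuous_intros continuous_on_forward
        continuous_on_compose2[OF continuous_on_bump'[of UNIV]]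
        continuous_on_compose2[OF continuous_on_bump[of UNIV]]; simp)+
  have "(?y \<longlongrightarrow> 0) at_top"
  proof (rule Lim_transform_eventually)
    show "((\<lambda>t. V t s x) \<longlongrightarrow> 0) at_top"
      using x by (simp add: stable_def)
    show "\<forall>\<^sub>F t in at_top. V t s x = ?y t"
      using eventually_ge_at_top[of s] by eventually_elim (simp add: max_def)
  qed
  then have "(?u \<longlongrightarrow> 0) at_top"
    by (rule tendsto_zero_comparison[where b = "real n + 1"])
      (simp add: bump_bounds mult_right_mono)
  moreover have "(?u \<longlongrightarrow> 0) at_bot"
  proof (rule tendsto_eventually)
    show "\<forall>\<^sub>F t in at_bot. ?u t = 0"
      using eventually_le_at_bot[of s] by eventually_elim (simp add: bump_eq)
  qed
  ultimately have "?u \<in> vanishing"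
    using cont(1) by (simp add: vanishing_def)
  moreover have "?g \<in> vanishing"
    by (rule vanishing_compact_support[OF cont(2), where a = s and b = "s + real n + 2"])
      (auto simp: bump'_eq_0)
  moreover have "norm (?g t) \<le> C1 * norm x" for t
  proof -
    have "norm (?g t) \<le> 1 * norm (?y t)"
      unfolding norm_scaleR using bump'_bounds[of n "t - s"] by (intro mult_right_mono) auto
    with y_bound[of t] show ?thesis by simp
  qed
  \<comment> \<open>Evaluated where \<open>bump n\<close> has the value n + 1/2, just before its
    slope starts to fall.\<close>
  ultimately have "norm (?u (s + (real n + 1))) \<le> C * (C1 * norm x)"
    using gen by (intro solution_bound) auto
  then show ?thesis
    by (simp add: bump_eq max_def)
qed

lemma unstable_decay:
  assumes x: "x \<in> unstable s"
  shows "(real n + 1 / 2) * norm x \<le> C * (C1 * norm (V (s + (real n + 1)) s x))"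
proof -
  define t0 where "t0 = s + (real n + 1)"
  have t0: "s \<le> t0" by (simp add: t0_def)
  let ?z = "V t0 s x"
  obtain y0 where "trajectory_to s x y0"
    using x by (auto simp: unstable_def)
  then have y: "y0 s = x" "\<And>r t. r \<le> t \<Longrightarrow> y0 t = V t r (y0 r)" "(y0 \<longlongrightarrow> 0) at_bot"
    and unst: "y0 r \<in> unstable r" for r
    using trajectory_to_shift by (auto simp: trajectory_to_def unstable_def)
  \<comment> \<open>The weight is reflected: it vanishes from \<open>t0\<close> on and grows towards
    the past. The double minus sign matches the derivative of the reflected weight in the form that
    \<open>evol_gen_weight\<close> expects.\<close>
  let ?u = "\<lambda>t. bump n (t0 - t) *\<^sub>R y0 t" and ?g = "\<lambda>t. - (- bump' n (t0 - t)) *\<^sub>R y0 t"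
  have cont_y: "continuous_on UNIV y0"
    by (rule continuous_on_trajectory[OF y(2)])
  have gen: "evol_gen V ?u ?g"
  proof (rule evol_gen_weight[OF cont_y, where a = "t0 - real n - 2" and b = t0])
    show "V t (t - \<tau>) (bump n (t0 - (t - \<tau>)) *\<^sub>R y0 (t - \<tau>)) = bump n (t0 - (t - \<tau>)) *\<^sub>R y0 t"
      if "0 \<le> \<tau>" for t \<tau>
      using that y(2)[of "t - \<tau>" t] by (simp add: V_lin_simps)
    show "((\<lambda>t. bump n (t0 - t)) has_real_derivative - bump' n (t0 - t)) (at t)" for t
    proof -
      have "((\<lambda>t. t0 - t) has_real_derivative - 1) (at t)"
        by (auto intro!: derivative_eq_intros)
      from DERIV_chain2[OF DERIV_bump this] show ?thesis by simp
    qed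
    show "\<bar>- bump' n (t0 - r) - - bump' n (t0 - t)\<bar> \<le> 2 * \<bar>r - t\<bar>" for r t
      using bump'_Lipschitz[of n "t0 - t" "t0 - r"] by simp
  qed (auto intro: bump'_eq_0)
  have cont: "continuous_on UNIV ?u" "continuous_on UNIV ?g"
    by (intro continuous_intros cont_y continuous_on_compose2[OF continuous_on_bump'[of UNIV]]
        continuous_on_compose2[OF continuous_on_bump[of UNIV]]; simp)+
  have "(?u \<longlongrightarrow> 0) at_bot"
    using y(3) by (rule tendsto_zero_comparison[where b = "real n + 1"])
      (simp add: bump_bounds mult_right_mono)
  moreover have "(?u \<longlongrightarrow> 0) at_top"
  proof (rule tendsto_eventually)
    show "\<forall>\<^sub>F t in at_top. ?u t = 0"
      using eventually_ge_at_top[of t0] by eventually_elim (simp add: bump_eq)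
  qed
  ultimately have "?u \<in> vanishing"
    using cont(1) by (simp add: vanishing_def)
  moreover have "?g \<in> vanishing"
    by (rule vanishing_compact_support[OF cont(2), where a = "t0 - real n - 2" and b = t0])
      (auto simp: bump'_eq_0)
  moreover have "norm (?g t) \<le> C1 * norm ?z" for t
  proof (cases "t \<le> t0")
    case True
    have "norm (?g t) \<le> 1 * norm (y0 t)"
      unfolding norm_scaleR using bump'_bounds[of n "t0 - t"] by (intro mult_right_mono) auto
    also have "\<dots> \<le> C1 * norm (V t0 t (y0 t))"
      using unstable_bound[OF unst True] by simp
    also have "V t0 t (y0 t) = ?z"
      using y(2)[OF True] y(2)[OF t0] y(1) by simp
    finally show ?thesis .
  next
    case False
    then show ?thesis
      using C1_pos by (simp add: bump'_eq_0)
  qed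
  ultimately have "norm (?u s) \<le> C * (C1 * norm ?z)"
    using gen by (intro solution_bound) auto
  then show ?thesis
    by (simp add: bump_eq y(1) t0_def)
qed

lemma is_h_dichotomy_P: "is_h_dichotomy exp V P"
proof -
  \<comment> \<open>Large enough for \<open>C * C1\<close> divided by n + 1/2 to be at most 1/2, so
    that the two decay lemmas halve norms over time n + 1.\<close>
  obtain n :: nat where n: "2 * (C * C1) \<le> real n"
    using real_arch_simple by blast
  define \<Lambda> where "\<Lambda> = real n + 1"
  define \<nu> where "\<nu> = ln 2 / \<Lambda>"
  have \<Lambda>: "\<Lambda> > 0" by (simp add: \<Lambda>_def)
  have halve: "a \<le> 1 / 2 * b" if "(real n + 1 / 2) * a \<le> C * (C1 * b)" "0 \<le> b" for a b :: real
  proof -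
    have "2 * (C * C1) * b \<le> (real n + 1 / 2) * b"
      using n that(2) by (intro mult_right_mono) auto
    with that(1) have "(real n + 1 / 2) * (2 * a) \<le> (real n + 1 / 2) * b"
      by (simp add: algebra_simps)
    then have "2 * a \<le> b"
      by (rule mult_left_le_imp_le) simp
    then show ?thesis by simp
  qed
  have st: "\<forall>x\<in>stable s. norm (V t s x) \<le> 2 * C1 * exp (- \<nu> * (t - s)) * norm x" if "s \<le> t" for s t
    unfolding \<nu>_def
  proof (rule exponential_decay_from_halving[where
        F = "\<lambda>s t c. \<forall>x\<in>stable s. norm (V t s x) \<le> c * norm x", OF _ _ _ _ \<Lambda> _ that])
    show "\<forall>x\<in>stable s. norm (V t s x) \<le> c * d * norm x"
      if "s \<le> r" "r \<le> t" "0 \<le> c" "0 \<le> d" "\<forall>x\<in>stable s. norm (V r s x) \<le> c * norm x"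
        "\<forall>x\<in>stable r. norm (V t r x) \<le> d * norm x" for s r t c d
    proof
      fix x assume x: "x \<in> stable s"
      have "norm (V t s x) \<le> d * norm (V r s x)"
        using that(6) stable_V[OF x that(1)] U_comp[OF that(1,2), of x] by metis
      also have "\<dots> \<le> d * (c * norm x)"
        using that x by (intro mult_left_mono) auto
      finally show "norm (V t s x) \<le> c * d * norm x" by (simp add: ac_simps)
    qed
    show "\<forall>x\<in>stable s. norm (V (s + \<Lambda>) s x) \<le> 1 / 2 * norm x" for s
      using stable_decay[of _ s n] halve by (simp add: \<Lambda>_def)
    show "\<forall>x\<in>stable s. norm (V t s x) \<le> d * norm x"
      if "\<forall>x\<in>stable s. norm (V t s x) \<le> c * norm x" "c \<le> d" for s t c d
      using that by (meson mult_right_mono norm_ge_zero order_trans)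
  qed (use stable_bound C1_pos in auto)
  have unst: "\<forall>x\<in>unstable s. norm x \<le> 2 * C1 * exp (- \<nu> * (t - s)) * norm (V t s x)"
    if "s \<le> t" for s t
    unfolding \<nu>_def
  proof (rule exponential_decay_from_halving[where
        F = "\<lambda>s t c. \<forall>x\<in>unstable s. norm x \<le> c * norm (V t s x)", OF _ _ _ _ \<Lambda> _ that])
    show "\<forall>x\<in>unstable s. norm x \<le> c * d * norm (V t s x)"
      if "s \<le> r" "r \<le> t" "0 \<le> c" "0 \<le> d" "\<forall>x\<in>unstable s. norm x \<le> c * norm (V r s x)"
        "\<forall>x\<in>unstable r. norm x \<le> d * norm (V t r x)" for s r t c d
    proof
      fix x assume x: "x \<in> unstable s"
      have "norm x \<le> c * norm (V r s x)"
        using that x by auto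
      also have "\<dots> \<le> c * (d * norm (V t r (V r s x)))"
        using that unstable_V[OF x that(1)] by (intro mult_left_mono) auto
      finally show "norm x \<le> c * d * norm (V t s x)"
        using that by (simp add: U_comp ac_simps)
    qed
    show "\<forall>x\<in>unstable s. norm x \<le> 1 / 2 * norm (V (s + \<Lambda>) s x)" for s
      using unstable_decay[of _ s n] halve by (simp add: \<Lambda>_def)
    show "\<forall>x\<in>unstable s. norm x \<le> d * norm (V t s x)"
      if "\<forall>x\<in>unstable s. norm x \<le> c * norm (V t s x)" "c \<le> d" for s t c d
      using that by (meson mult_right_mono norm_ge_zero order_trans)
  qed (use unstable_bound C1_pos in auto)
  \<comment> \<open>The bound on \<open>P\<close> costs a factor 1 + C1, the bound on
    \<open>Q\<close> a factor C1; one constant serves both estimates.\<close>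
  define N where "N = 2 * C1 * (1 + C1)"
  have N: "N \<ge> 1" "2 * C1 \<le> N" "2 * C1 * C1 \<le> N"
    using C1_pos mult_mono[of 1 C1 1 C1] by (simp_all add: N_def algebra_simps)
  have "norm (V t s (P s x)) \<le> N * exp (- \<nu> * (t - s)) * norm x" if "s \<le> t" for s t x
  proof -
    have "norm (V t s (P s x)) \<le> 2 * C1 * exp (- \<nu> * (t - s)) * norm (P s x)"
      using st[OF that] P_stable by blast
    also have "\<dots> \<le> 2 * C1 * exp (- \<nu> * (t - s)) * ((1 + C1) * norm x)"
      using C1_pos norm_P_le by (intro mult_left_mono) auto
    finally show ?thesis by (simp add: N_def ac_simps)
  qed
  moreover have "norm (restr_inv (V t s) (compl_proj (P s)) (compl_proj (P t)) x)
      \<le> N * exp (- \<nu> * (t - s)) * norm x" if "s \<le> t" for s t x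
  proof -
    define z where "z = restr_inv (V t s) (compl_proj (P s)) (compl_proj (P t)) x"
    have "compl_proj (P t) x = Q t x"
      by (simp add: compl_proj_def P_def)
    moreover have "Q t x \<in> V t s ` unstable s"
      using bij_V_unstable[OF that] Q_unstable by (simp add: bij_betw_def)
    ultimately have z: "z \<in> unstable s" "V t s z = Q t x"
      unfolding z_def restr_inv_def range_compl_P by (auto intro: inv_into_into f_inv_into_f)
    have "norm z \<le> 2 * C1 * exp (- \<nu> * (t - s)) * norm (Q t x)"
      using unst[OF that] z by auto
    also have "\<dots> \<le> 2 * C1 * exp (- \<nu> * (t - s)) * (C1 * norm x)"
      using C1_pos norm_Q_le by (intro mult_left_mono) auto
    also have "\<dots> = (2 * C1 * C1) * (exp (- \<nu> * (t - s)) * norm x)"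
      by simp
    also have "\<dots> \<le> N * (exp (- \<nu> * (t - s)) * norm x)"
      using N by (intro mult_right_mono) auto
    finally show ?thesis
      unfolding z_def by (simp add: mult.assoc)
  qed
  moreover have "(exp t / exp s) powr - \<nu> = exp (- \<nu> * (t - s))" for t s :: real
    by (simp add: powr_def flip: exp_diff)
  ultimately have est: "\<exists>N\<ge>1. \<forall>t s. s \<le> t \<longrightarrow> (\<forall>x.
      norm (V t s (P s x)) \<le> N * (exp t / exp s) powr - \<nu> * norm x \<and>
      norm (restr_inv (V t s) (compl_proj (P s)) (compl_proj (P t)) x)
        \<le> N * (exp t / exp s) powr - \<nu> * norm x)"
    using N(1) by (intro exI[of _ N]) simp
  have "\<nu> > 0"
    using \<Lambda> by (simp add: \<nu>_def)
  with est show ?thesis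
    unfolding is_h_dichotomy_def using is_projection_P bij_V_unstable
    by (intro conjI) (auto simp: range_compl_P fun_eq_iff PV)
qed

end

section \<open>Passage between the original and the logarithmic time\<close>

context h_evolution
begin

definition V :: "real \<Rightarrow> real \<Rightarrow> 'a \<Rightarrow> 'a" where
  "V t s = U (ex t) (ex s)"

lemma exp_evolution_V: "exp_evolution V \<alpha> K"
proof
  show "growth_rate exp" by (rule growth_rate_exp)
  show "\<alpha> > 0" "K \<ge> 1" by (rule alpha_pos, rule K_ge_1)
  show "onorm (V t s) \<le> K * (exp t / exp s) powr \<alpha>" if "s \<le> t" for t s
    using onorm_U[of "ex s" "ex t"] that by (simp add: V_def h_lg)
  have ex: "continuous_on A (\<lambda>z. ex (f z))" if "continuous_on A f" for f and A :: "(real \<times> real) set"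
    by (rule continuous_on_compose2[OF continuous_on_ex[of UNIV] that]) simp
  have "continuous_on {(t, s). s \<le> t} (\<lambda>(t, s). V t s x)" for x
    unfolding case_prod_beta V_def
    by (intro continuous_on_U ex continuous_intros) auto
  then show "evolution_family V"
    unfolding evolution_family_def V_def by (auto simp: U_clin U_comp fun_eq_iff)
qed

text \<open>The supremum norm of \<open>c0\<close> is the uniformity in time demanded by
  \<open>evol_gen\<close>, and reparametrization by \<open>ex\<close> does not affect it.\<close>

lemma gen_limit_iff_evol_gen:
  "gen_limit exp S w g \<longleftrightarrow> evol_gen V (\<lambda>\<sigma>. c0_apply w (ex \<sigma>)) (\<lambda>\<sigma>. c0_apply g (ex \<sigma>))"
proof -
  have pointwise: "V \<sigma> (\<sigma> - \<tau>) (c0_apply w (ex (\<sigma> - \<tau>))) - c0_apply w (ex \<sigma>) - \<tau> *\<^sub>R c0_apply g (ex \<sigma>)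
      = c0_apply (S \<tau> w - w - \<tau> *\<^sub>R g) (ex \<sigma>)" if "0 < \<tau>" for \<tau> \<sigma>
    using that by (simp add: S_apply V_def)
  have norm: "(\<forall>\<sigma>. norm (V \<sigma> (\<sigma> - \<tau>) (c0_apply w (ex (\<sigma> - \<tau>))) - c0_apply w (ex \<sigma>) - \<tau> *\<^sub>R c0_apply g (ex \<sigma>)) \<le> b)
      \<longleftrightarrow> norm (S \<tau> w - w - \<tau> *\<^sub>R g) \<le> b" (is "?l \<longleftrightarrow> ?r") if "0 < \<tau>" for \<tau> b
  proof
    assume l: ?l
    show ?r
    proof (rule norm_c0_le)
      show "norm (c0_apply (S \<tau> w - w - \<tau> *\<^sub>R g) s) \<le> b" for s
        using l[rule_format, of "lg s"] pointwise[OF that, of "lg s"] by simp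
    qed
  next
    assume ?r
    then show ?l
      unfolding pointwise[OF that] using norm_c0_ge order_trans by blast
  qed
  have quotient: "dist ((S \<tau> w - w) /\<^sub>R \<tau>) g = norm (S \<tau> w - w - \<tau> *\<^sub>R g) / \<tau>" if "0 < \<tau>" for \<tau>
  proof -
    have "(S \<tau> w - w) /\<^sub>R \<tau> - g = (S \<tau> w - w - \<tau> *\<^sub>R g) /\<^sub>R \<tau>"
      using that by (simp add: scaleR_diff_right)
    then show ?thesis
      using that by (simp only: dist_norm norm_scaleR) (simp add: divide_inverse)
  qed
  have "gen_limit exp S w g \<longleftrightarrow> (\<forall>e>0. \<exists>d>0. \<forall>\<tau>. 0 < \<tau> \<longrightarrow> \<tau> < d \<longrightarrow>
      norm (S \<tau> w - w - \<tau> *\<^sub>R g) / \<tau> < e)"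
    unfolding S.gen_limit_exp_iff tendsto_iff eventually_at_right_field
    using quotient by (metis (no_types, lifting))
  also have "\<dots> \<longleftrightarrow> (\<forall>e>0. \<exists>d>0. \<forall>\<tau>. 0 < \<tau> \<longrightarrow> \<tau> < d \<longrightarrow> norm (S \<tau> w - w - \<tau> *\<^sub>R g) \<le> e * \<tau>)"
  proof (intro iffI allI impI)
    fix e :: real
    assume "\<forall>e>0. \<exists>d>0. \<forall>\<tau>. 0 < \<tau> \<longrightarrow> \<tau> < d \<longrightarrow> norm (S \<tau> w - w - \<tau> *\<^sub>R g) / \<tau> < e" "e > 0"
    then obtain d where "d > 0" "\<And>\<tau>. 0 < \<tau> \<Longrightarrow> \<tau> < d \<Longrightarrow> norm (S \<tau> w - w - \<tau> *\<^sub>R g) / \<tau> < e"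
      by blast
    then show "\<exists>d>0. \<forall>\<tau>. 0 < \<tau> \<longrightarrow> \<tau> < d \<longrightarrow> norm (S \<tau> w - w - \<tau> *\<^sub>R g) \<le> e * \<tau>"
      by (intro exI[of _ d]) (auto simp: pos_divide_less_eq less_imp_le)
  next
    fix e :: real
    assume "\<forall>e>0. \<exists>d>0. \<forall>\<tau>. 0 < \<tau> \<longrightarrow> \<tau> < d \<longrightarrow> norm (S \<tau> w - w - \<tau> *\<^sub>R g) \<le> e * \<tau>" "e > 0"
    then obtain d where d: "d > 0" "\<And>\<tau>. 0 < \<tau> \<Longrightarrow> \<tau> < d \<Longrightarrow> norm (S \<tau> w - w - \<tau> *\<^sub>R g) \<le> e / 2 * \<tau>"
      using half_gt_zero by blast
    have "norm (S \<tau> w - w - \<tau> *\<^sub>R g) / \<tau> < e" if "0 < \<tau>" "\<tau> < d" for \<tau>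
    proof -
      have "norm (S \<tau> w - w - \<tau> *\<^sub>R g) / \<tau> \<le> e / 2"
        using d(2)[OF that] that by (simp add: pos_divide_le_eq)
      also have "\<dots> < e" using \<open>e > 0\<close> by simp
      finally show ?thesis .
    qed
    then show "\<exists>d>0. \<forall>\<tau>. 0 < \<tau> \<longrightarrow> \<tau> < d \<longrightarrow> norm (S \<tau> w - w - \<tau> *\<^sub>R g) / \<tau> < e"
      using d(1) by blast
  qed
  also have "\<dots> \<longleftrightarrow> evol_gen V (\<lambda>\<sigma>. c0_apply w (ex \<sigma>)) (\<lambda>\<sigma>. c0_apply g (ex \<sigma>))"
    unfolding evol_gen_def using norm by (metis (no_types, lifting))
  finally show ?thesis .
qed

definition from_log :: "(real \<Rightarrow> 'a) \<Rightarrow> 'a c0" where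
  "from_log u = Abs_c0 (\<lambda>s. u (lg s))"

lemma from_log_apply: "u \<in> vanishing \<Longrightarrow> c0_apply (from_log u) s = u (lg s)"
  unfolding from_log_def
  by (subst c0_apply_Abs_c0[OF vanishing_compose[OF _ continuous_on_lg filterlim_lg]]) auto

lemma to_log_vanishing: "(\<lambda>\<sigma>. c0_apply u (ex \<sigma>)) \<in> vanishing"
  by (rule vanishing_compose[OF c0_apply_vanishing continuous_on_ex filterlim_ex])

text \<open>\<open>C\<close> bounds the inverse of minus the generator, which is the operator that
  the resolvent at 0 provides; this is why sources enter with a minus sign.\<close>

lemma admissible_V:
  assumes inv: "invertible_on (gen_domain exp S) (\<lambda>w. 0 *\<^sub>C w - generator exp S w)"
  obtains C where "admissible V \<alpha> K C"
proof -
  let ?D = "gen_domain exp S" and ?A = "\<lambda>w. 0 *\<^sub>C w - generator exp S w"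
  define R where "R = inv_into ?D ?A"
  have bij: "bij_betw ?A ?D UNIV" and "bounded_clinear R"
    using inv by (auto simp: invertible_on_def R_def)
  then obtain C where C: "C > 0" "\<And>x. norm (R x) \<le> norm x * C"
    using bounded_linear.pos_bounded[OF bounded_clinear_bounded_linear] by blast
  interpret E: exp_evolution V \<alpha> K by (rule exp_evolution_V)
  have "admissible V \<alpha> K C"
  proof
    show "C > 0" by (rule C(1))
    show "\<exists>u\<in>vanishing. evol_gen V u g" if g: "g \<in> vanishing" for g
    proof -
      let ?G = "from_log g"
      have "- ?G \<in> ?A ` ?D"
        using bij by (auto simp: bij_betw_def)
      then obtain w where w: "w \<in> ?D" "?A w = - ?G"
        by force
      then have "gen_limit exp S w ?G"
        using gen_limit_generator[OF w(1)] by simp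
      then have "evol_gen V (\<lambda>\<sigma>. c0_apply w (ex \<sigma>)) g"
        unfolding gen_limit_iff_evol_gen by (simp add: from_log_apply[OF g])
      then show ?thesis
        using to_log_vanishing by blast
    qed
    show "norm (u t) \<le> C * M" if u: "u \<in> vanishing" and g: "g \<in> vanishing"
      and gen: "evol_gen V u g" and M: "\<And>s. norm (g s) \<le> M" for u g M t
    proof -
      let ?w = "from_log u" and ?G = "from_log g"
      have "gen_limit exp S ?w ?G"
        unfolding gen_limit_iff_evol_gen using gen by (simp add: from_log_apply u g)
      then have w: "?w \<in> ?D" "?A ?w = - ?G"
        by (auto simp: gen_domain_def generator_eq)
      have "R (- ?G) = ?w"
        using inv_into_f_f[OF bij_betw_imp_inj_on[OF bij] w(1)] by (simp only: R_def w(2))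
      then have "norm ?w \<le> norm (- ?G) * C"
        using C(2)[of "- ?G"] by simp
      also have "\<dots> \<le> M * C"
        using C(1) norm_c0_le[of ?G M] M by (auto simp: from_log_apply[OF g] intro!: mult_right_mono)
      finally show ?thesis
        using norm_c0_ge[of ?w "ex t"] by (simp add: from_log_apply[OF u] mult.commute)
    qed
  qed
  then show ?thesis by (rule that)
qed

lemma is_h_dichotomy_transfer:
  assumes dich: "is_h_dichotomy exp V P"
  shows "is_h_dichotomy h U (\<lambda>s. P (lg s))"
proof -
  have U: "U t s = V (lg t) (lg s)" for t s
    by (simp add: V_def)
  have le: "lg s \<le> lg t" if "s \<le> t" for s t
    using that by simp
  obtain \<nu> N where \<nu>: "\<nu> > 0" "N \<ge> 1" and est: "\<forall>t s. s \<le> t \<longrightarrow> (\<forall>x.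
      norm (V t s (P s x)) \<le> N * (exp t / exp s) powr - \<nu> * norm x \<and>
      norm (restr_inv (V t s) (compl_proj (P s)) (compl_proj (P t)) x)
        \<le> N * (exp t / exp s) powr - \<nu> * norm x)"
    using dich unfolding is_h_dichotomy_def by blast
  have "\<forall>t s. s \<le> t \<longrightarrow> (\<forall>x.
      norm (U t s (P (lg s) x)) \<le> N * (h t / h s) powr - \<nu> * norm x \<and>
      norm (restr_inv (U t s) (compl_proj (P (lg s))) (compl_proj (P (lg t))) x)
        \<le> N * (h t / h s) powr - \<nu> * norm x)"
  proof (intro allI impI)
    fix t s :: real and x assume "s \<le> t"
    from est[rule_format, OF le[OF this], of x]
    show "norm (U t s (P (lg s) x)) \<le> N * (h t / h s) powr - \<nu> * norm x \<and>
        norm (restr_inv (U t s) (compl_proj (P (lg s))) (compl_proj (P (lg t))) x)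
          \<le> N * (h t / h s) powr - \<nu> * norm x"
      by (simp only: U h_lg)
  qed
  moreover have "P (lg t) \<circ> U t s = U t s \<circ> P (lg s)"
    "bij_betw (U t s) (range (compl_proj (P (lg s)))) (range (compl_proj (P (lg t))))"
    if "s \<le> t" for t s
    using dich le[OF that] by (simp_all only: is_h_dichotomy_def U)
  moreover have "is_projection (P (lg t))" for t
    using dich by (simp only: is_h_dichotomy_def)
  ultimately show ?thesis
    unfolding is_h_dichotomy_def using \<nu> by blast
qed

lemma admits_h_dichotomy_if_resolvent:
  assumes "0 \<in> resolvent_set (gen_domain exp S) (generator exp S)"
  shows "admits_h_dichotomy h U"
proof -
  obtain C where "admissible V \<alpha> K C"
    using assms admissible_V by (auto simp only: resolvent_set_def mem_Collect_eq)
  then interpret A: admissible V \<alpha> K C .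
  show ?thesis
    using is_h_dichotomy_transfer[OF A.is_h_dichotomy_P] by (auto simp: admits_h_dichotomy_def)
qed

end

section \<open>The Green function\<close>

text \<open>On intervals containing \<open>c\<close> the integral is known exactly, up to one
  boundary term per end point; both die out as the interval grows.\<close>

lemma has_integral_UNIV_limit:
  fixes f :: "real \<Rightarrow> 'b::banach"
  assumes int: "\<And>a b. a \<le> c \<Longrightarrow> c \<le> b \<Longrightarrow> (f has_integral (G a + H b + i)) {a..b}"
    and G: "(G \<longlongrightarrow> 0) at_bot" and H: "(H \<longlongrightarrow> 0) at_top"
  shows "(f has_integral i) UNIV"
  unfolding has_integral'[of f i UNIV]
proof (intro allI impI)
  fix e :: real assume e: "e > 0"
  have "\<forall>\<^sub>F a in at_bot. dist (G a) 0 < e / 2" "\<forall>\<^sub>F b in at_top. dist (H b) 0 < e / 2"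
    using tendstoD[OF G, of "e / 2"] tendstoD[OF H, of "e / 2"] e by simp_all
  then obtain a0 b0 where a0: "\<And>a. a \<le> a0 \<Longrightarrow> norm (G a) < e / 2"
    and b0: "\<And>b. b0 \<le> b \<Longrightarrow> norm (H b) < e / 2"
    unfolding eventually_at_bot_linorder eventually_at_top_linorder dist_norm diff_zero by blast
  define B where "B = \<bar>a0\<bar> + \<bar>b0\<bar> + \<bar>c\<bar> + 2"
  have "\<exists>z. (f has_integral z) (cbox a b) \<and> norm (z - i) < e" if "ball 0 B \<subseteq> cbox a b" for a b
  proof -
    have "1 - B \<in> ball 0 B" "B - 1 \<in> ball 0 B"
      by (auto simp: B_def dist_real_def)
    then have "a \<le> 1 - B" "B - 1 \<le> b"
      using that by auto
    then have "a \<le> c" "c \<le> b" "a \<le> a0" "b0 \<le> b"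
      by (auto simp: B_def)
    moreover from this have "norm (G a + H b + i - i) < e"
      using norm_triangle_ineq[of "G a" "H b"] a0[of a] b0[of b] by simp
    ultimately show ?thesis
      using int by (intro exI[of _ "G a + H b + i"]) auto
  qed
  then show "\<exists>B>0. \<forall>a b. ball 0 B \<subseteq> cbox a b \<longrightarrow>
      (\<exists>z. ((\<lambda>x. if x \<in> UNIV then f x else 0) has_integral z) (cbox a b) \<and> norm (z - i) < e)"
    by (intro exI[of _ B]) (auto simp: B_def)
qed

context h_dichotomy
begin

context
  fixes g u :: "'a c0" and t :: real
  assumes C1: "h C1_differentiable_on UNIV" and gen: "gen_limit exp S u g"
begin

text \<open>The density of the measure \<mu>_*, that is, the derivative of
  \<open>lg\<close>.\<close>

definition l :: "real \<Rightarrow> real" where "l s = deriv h s / h s"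

lemma h_derivative: "(h has_real_derivative deriv h s) (at s)"
  and continuous_on_l: "continuous_on A l"
proof -
  obtain D where D: "\<And>x. (h has_real_derivative D x) (at x)" "continuous_on UNIV D"
    using C1 by (auto simp: C1_differentiable_on_def has_real_derivative_iff_has_vector_derivative)
  then have "deriv h = D"
    by (auto intro: DERIV_imp_deriv)
  then show "(h has_real_derivative deriv h s) (at s)"
    using D by simp
  have "h s \<noteq> 0" for s
    using h_facts(1)[of s] by simp
  then have "continuous_on UNIV l"
    unfolding l_def[abs_def] \<open>deriv h = D\<close> by (intro continuous_intros D h_facts(4)) auto
  then show "continuous_on A l"
    by (rule continuous_on_subset) simp
qed

lemma l_nonneg: "0 \<le> l s"
proof -
  have "mono_on UNIV h"
    using h_facts(3) by (auto simp: mono_on_def)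
  from mono_on_imp_deriv_nonneg[OF this h_derivative, of s] show ?thesis
    using h_facts(1)[of s] by (simp add: l_def)
qed

lemma lg_derivative: "(lg has_real_derivative l s) (at s within A)"
proof -
  have "((\<lambda>s. ln (h s)) has_real_derivative inverse (h s) * deriv h s) (at s)"
    using DERIV_chain2[OF DERIV_ln[OF h_facts(1)] h_derivative] .
  then show ?thesis
    by (auto simp: lg_def[abs_def] l_def field_simps intro: has_field_derivative_at_within)
qed

text \<open>Chain rule: in logarithmic time the derivative comes from
  \<open>evol_gen_derivative\<close>, and \<open>lg\<close> contributes the factor
  \<open>l s\<close>.\<close>

lemma U_derivative:
  assumes "s \<le> b"
  shows "((\<lambda>s. U b s (c0_apply u s)) has_vector_derivative - (l s *\<^sub>R U b s (c0_apply g s)))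
    (at s within {..b})"
proof -
  interpret E: exp_evolution V \<alpha> K by (rule exp_evolution_V)
  have cont: "continuous_on UNIV (\<lambda>\<sigma>. c0_apply w (ex \<sigma>))" for w :: "'a c0"
    using to_log_vanishing by (auto simp: vanishing_def)
  have "((\<lambda>\<sigma>. V (lg b) \<sigma> (c0_apply u (ex \<sigma>))) has_vector_derivative
      - V (lg b) (lg s) (c0_apply g (ex (lg s)))) (at (lg s) within {..lg b})"
    using gen assms
    by (intro E.evol_gen_derivative[OF cont cont]) (auto simp: gen_limit_iff_evol_gen)
  then have "((\<lambda>\<sigma>. V (lg b) \<sigma> (c0_apply u (ex \<sigma>))) has_vector_derivative
      - V (lg b) (lg s) (c0_apply g (ex (lg s)))) (at (lg s) within lg ` {..b})"
    by (rule has_vector_derivative_within_subset) auto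
  from vector_diff_chain_within[OF _ this] lg_derivative[of s "{..b}"] show ?thesis
    by (simp add: V_def o_def has_real_derivative_iff_has_vector_derivative)
qed

text \<open>\<open>P t\<close> is applied to the transported function and the derivative is
  integrated; moving the projection past \<open>U\<close> turns the integrand into the stable branch
  of the kernel.\<close>

lemma stable_integral:
  assumes "a \<le> t"
  shows "((\<lambda>s. l s *\<^sub>R green_kernel U P t s (c0_apply g s)) has_integral
    (U t a (P a (c0_apply u a)) - P t (c0_apply u t))) {a..t}"
proof -
  have lin: "bounded_linear (P t)"
    by (rule bounded_clinear_bounded_linear[OF P_clin])
  have "((\<lambda>s. - (l s *\<^sub>R U t s (P s (c0_apply g s)))) has_integral
      (P t (U t t (c0_apply u t)) - P t (U t a (c0_apply u a)))) {a..t}"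
  proof (rule fundamental_theorem_of_calculus[OF assms])
    fix s assume s: "s \<in> {a..t}"
    have "((\<lambda>s. P t (U t s (c0_apply u s))) has_vector_derivative
        P t (- (l s *\<^sub>R U t s (c0_apply g s)))) (at s within {a..t})"
      using s by (intro bounded_linear.has_vector_derivative[OF lin]
          has_vector_derivative_within_subset[OF U_derivative]) auto
    moreover have "P t (- (l s *\<^sub>R U t s (c0_apply g s))) = - (l s *\<^sub>R U t s (P s (c0_apply g s)))"
      using s by (simp add: linear_neg[OF P_lin] linear_cmul[OF P_lin] PU)
    ultimately show "((\<lambda>s. P t (U t s (c0_apply u s))) has_vector_derivative
        - (l s *\<^sub>R U t s (P s (c0_apply g s)))) (at s within {a..t})"
      by simp
  qed
  from has_integral_neg[OF this]
  have "((\<lambda>s. l s *\<^sub>R U t s (P s (c0_apply g s))) has_integral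
      (U t a (P a (c0_apply u a)) - P t (c0_apply u t))) {a..t}"
    using assms by (simp add: PU)
  then show ?thesis
    by (rule has_integral_spike_finite[of "{t}", rotated 2]) (auto simp: green_kernel_def)
qed

text \<open>Times s after t cannot be transported to t directly. The values are carried forward to b
  and brought back by the one bounded operator \<open>W b t\<close>, and \<open>W_factor\<close>
  recognizes the composition as \<open>W s t\<close>.\<close>

lemma unstable_integral:
  assumes "t \<le> b"
  shows "((\<lambda>s. l s *\<^sub>R green_kernel U P t s (c0_apply g s)) has_integral
    (W b t (c0_apply u b) - (c0_apply u t - P t (c0_apply u t)))) {t..b}"
proof -
  have lin: "bounded_linear (W b t)"
    by (rule bounded_clinear_bounded_linear[OF W_clin[OF assms]])
  have factor: "W s t x = W b t (U b s x)" if "s \<in> {t..b}" for s x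
    using W_factor[of t t s b x] that by simp
  have "((\<lambda>s. - (l s *\<^sub>R W s t (c0_apply g s))) has_integral
      (W b t (U b b (c0_apply u b)) - W b t (U b t (c0_apply u t)))) {t..b}"
  proof (rule fundamental_theorem_of_calculus[OF assms])
    fix s assume s: "s \<in> {t..b}"
    have "((\<lambda>s. W b t (U b s (c0_apply u s))) has_vector_derivative
        W b t (- (l s *\<^sub>R U b s (c0_apply g s)))) (at s within {t..b})"
      using s by (intro bounded_linear.has_vector_derivative[OF lin]
          has_vector_derivative_within_subset[OF U_derivative]) auto
    moreover have "W b t (- (l s *\<^sub>R U b s (c0_apply g s))) = - (l s *\<^sub>R W s t (c0_apply g s))"
      unfolding factor[OF s]
      by (simp add: linear_neg[OF bounded_linear.linear[OF lin]] linear_cmul[OF bounded_linear.linear[OF lin]])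
    ultimately show "((\<lambda>s. W b t (U b s (c0_apply u s))) has_vector_derivative
        - (l s *\<^sub>R W s t (c0_apply g s))) (at s within {t..b})"
      by simp
  qed
  moreover have "W b t (U b t (c0_apply u t)) = c0_apply u t - P t (c0_apply u t)"
    using factor[of t] assms by (simp flip: W_refl)
  ultimately have "((\<lambda>s. - (l s *\<^sub>R W s t (c0_apply g s))) has_integral
      (W b t (c0_apply u b) - (c0_apply u t - P t (c0_apply u t)))) {t..b}"
    by simp
  then show ?thesis
    by (rule has_integral_spike_finite[of "{t}", rotated 2]) (auto simp: green_kernel_def W_def)
qed

lemma decay_at_infinity:
  assumes "\<nu> > 0"
  shows "((\<lambda>a. exp (- \<nu> * (lg t - lg a))) \<longlongrightarrow> 0) at_bot"
    and "((\<lambda>b. exp (- \<nu> * (lg b - lg t))) \<longlongrightarrow> 0) at_top"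
proof -
  have "Z \<ge> - \<nu> * (lg t - lg a)" if "a \<le> ex (lg t + Z / \<nu>)" for a Z
    using that assms by (simp add: le_ex_iff field_simps)
  then have "filterlim (\<lambda>a. - \<nu> * (lg t - lg a)) at_bot at_bot"
    unfolding filterlim_at_bot eventually_at_bot_linorder by blast
  then show "((\<lambda>a. exp (- \<nu> * (lg t - lg a))) \<longlongrightarrow> 0) at_bot"
    by (rule filterlim_compose[OF exp_at_bot])
  have "Z \<ge> - \<nu> * (lg b - lg t)" if "ex (lg t - Z / \<nu>) \<le> b" for b Z
    using that assms by (simp add: ex_le_iff' field_simps)
  then have "filterlim (\<lambda>b. - \<nu> * (lg b - lg t)) at_bot at_top"
    unfolding filterlim_at_bot eventually_at_top_linorder by blast
  then show "((\<lambda>b. exp (- \<nu> * (lg b - lg t))) \<longlongrightarrow> 0) at_top"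
    by (rule filterlim_compose[OF exp_at_bot])
qed

lemma green_has_integral:
  "((\<lambda>s. l s *\<^sub>R green_kernel U P t s (c0_apply g s)) has_integral - c0_apply u t) UNIV"
proof (rule has_integral_UNIV_limit)
  fix a b assume ab: "a \<le> t" "t \<le> b"
  from has_integral_combine[OF ab stable_integral[OF ab(1)] unstable_integral[OF ab(2)]]
  show "((\<lambda>s. l s *\<^sub>R green_kernel U P t s (c0_apply g s)) has_integral
      ((if a \<le> t then U t a (P a (c0_apply u a)) else 0) +
       (if t \<le> b then W b t (c0_apply u b) else 0) + - c0_apply u t)) {a..b}"
    using ab by (simp add: algebra_simps)
next
  obtain \<nu> N where \<nu>: "\<nu> > 0" "N \<ge> 1"
    and est: "\<And>t s x. s \<le> t \<Longrightarrow> norm (U t s (P s x)) \<le> N * exp (- \<nu> * (lg t - lg s)) * norm x"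
      "\<And>t s x. s \<le> t \<Longrightarrow> norm (W t s x) \<le> N * exp (- \<nu> * (lg t - lg s)) * norm x"
    using exponent by metis
  have le: "N * e * norm (c0_apply u s) \<le> N * norm u * e" if "0 \<le> e" for e s
    using norm_c0_ge[of u s] \<nu> that by (simp add: mult.commute mult.left_commute mult_left_mono)
  show "((\<lambda>a. if a \<le> t then U t a (P a (c0_apply u a)) else 0) \<longlongrightarrow> 0) at_bot"
  proof (rule Lim_null_comparison)
    show "((\<lambda>a. N * norm u * exp (- \<nu> * (lg t - lg a))) \<longlongrightarrow> 0) at_bot"
      by (intro tendsto_mult_right_zero decay_at_infinity \<nu>)
    have "norm (U t a (P a (c0_apply u a))) \<le> N * norm u * exp (- \<nu> * (lg t - lg a))"
      if "a \<le> t" for a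
      using est(1)[OF that] le[of "exp (- \<nu> * (lg t - lg a))" a] order_trans by fastforce
    then show "\<forall>\<^sub>F a in at_bot. norm (if a \<le> t then U t a (P a (c0_apply u a)) else 0)
        \<le> N * norm u * exp (- \<nu> * (lg t - lg a))"
      using \<nu> by (intro always_eventually) auto
  qed
  show "((\<lambda>b. if t \<le> b then W b t (c0_apply u b) else 0) \<longlongrightarrow> 0) at_top"
  proof (rule Lim_null_comparison)
    show "((\<lambda>b. N * norm u * exp (- \<nu> * (lg b - lg t))) \<longlongrightarrow> 0) at_top"
      by (intro tendsto_mult_right_zero decay_at_infinity \<nu>)
    have "norm (W b t (c0_apply u b)) \<le> N * norm u * exp (- \<nu> * (lg b - lg t))"
      if "t \<le> b" for b
      using est(2)[OF that] le[of "exp (- \<nu> * (lg b - lg t))" b] order_trans by fastforce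
    then show "\<forall>\<^sub>F b in at_top. norm (if t \<le> b then W b t (c0_apply u b) else 0)
        \<le> N * norm u * exp (- \<nu> * (lg b - lg t))"
      using \<nu> by (intro always_eventually) auto
  qed
qed

lemma exponential_has_integral:
  assumes \<nu>: "\<nu> > 0"
  shows "((\<lambda>s. l s * exp (- \<nu> * \<bar>lg s - lg t\<bar>)) has_integral 2 / \<nu>) UNIV"
proof (rule has_integral_UNIV_limit)
  let ?f = "\<lambda>s. l s * exp (- \<nu> * \<bar>lg s - lg t\<bar>)"
  fix a b assume ab: "a \<le> t" "t \<le> b"
  have exp_deriv: "((\<lambda>s. c * exp (d * (lg s - lg t))) has_vector_derivative
      c * d * (l s * exp (d * (lg s - lg t)))) (at s within A)" for c d s A
    unfolding has_real_derivative_iff_has_vector_derivative[symmetric]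
    by (auto intro!: derivative_eq_intros lg_derivative)
  have "(?f has_integral (1 / \<nu> * exp (\<nu> * (lg t - lg t)) - 1 / \<nu> * exp (\<nu> * (lg a - lg t)))) {a..t}"
  proof (rule fundamental_theorem_of_calculus[OF ab(1)])
    show "((\<lambda>s. 1 / \<nu> * exp (\<nu> * (lg s - lg t))) has_vector_derivative ?f s) (at s within {a..t})"
      if "s \<in> {a..t}" for s
    proof -
      have "- \<nu> * \<bar>lg s - lg t\<bar> = \<nu> * (lg s - lg t)"
        using that by (simp add: abs_of_nonpos algebra_simps)
      then show ?thesis
        using exp_deriv[of "1 / \<nu>" \<nu> s "{a..t}"] \<nu> by simp
    qed
  qed
  moreover have "(?f has_integral (- 1 / \<nu> * exp (- \<nu> * (lg b - lg t)) - - 1 / \<nu> * exp (- \<nu> * (lg t - lg t)))) {t..b}"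
  proof (rule fundamental_theorem_of_calculus[OF ab(2)])
    show "((\<lambda>s. - 1 / \<nu> * exp (- \<nu> * (lg s - lg t))) has_vector_derivative ?f s) (at s within {t..b})"
      if "s \<in> {t..b}" for s
      using exp_deriv[of "- 1 / \<nu>" "- \<nu>" s "{t..b}"] that \<nu> by simp
  qed
  ultimately have "(?f has_integral (1 / \<nu> * exp (\<nu> * (lg t - lg t)) - 1 / \<nu> * exp (\<nu> * (lg a - lg t))
      + (- 1 / \<nu> * exp (- \<nu> * (lg b - lg t)) - - 1 / \<nu> * exp (- \<nu> * (lg t - lg t))))) {a..b}"
    by (rule has_integral_combine[OF ab])
  then show "(?f has_integral (- 1 / \<nu> * exp (- \<nu> * (lg t - lg a)) + - 1 / \<nu> * exp (- \<nu> * (lg b - lg t))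
      + 2 / \<nu>)) {a..b}"
    by (rule has_integral_eq_rhs) (simp add: algebra_simps)
next
  show "((\<lambda>a. - 1 / \<nu> * exp (- \<nu> * (lg t - lg a))) \<longlongrightarrow> 0) at_bot"
    "((\<lambda>b. - 1 / \<nu> * exp (- \<nu> * (lg b - lg t))) \<longlongrightarrow> 0) at_top"
    by (intro tendsto_mult_right_zero decay_at_infinity \<nu>)+
qed

lemma green_norm_integrable:
  "(\<lambda>s. norm (l s *\<^sub>R green_kernel U P t s (c0_apply g s))) integrable_on UNIV"
proof -
  let ?f = "\<lambda>s. norm (l s *\<^sub>R green_kernel U P t s (c0_apply g s))"
  obtain \<nu> N where \<nu>: "\<nu> > 0" "N \<ge> 1"
    and est: "\<And>t s x. s \<le> t \<Longrightarrow> norm (U t s (P s x)) \<le> N * exp (- \<nu> * (lg t - lg s)) * norm x"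
      "\<And>t s x. s \<le> t \<Longrightarrow> norm (W t s x) \<le> N * exp (- \<nu> * (lg t - lg s)) * norm x"
    using exponent by metis
  have c0: "continuous_on A (c0_apply g)" for A
    using continuous_on_c0_apply by (rule continuous_on_subset) simp
  have left: "?f integrable_on {a..t}" for a
  proof (rule integrable_spike_finite[of "{t}"])
    show "(\<lambda>s. norm (l s *\<^sub>R U t s (P s (c0_apply g s)))) integrable_on {a..t}"
      by (intro integrable_continuous_interval continuous_intros continuous_on_l continuous_on_U
          continuous_on_P c0) auto
  qed (auto simp: green_kernel_def)
  have right: "?f integrable_on {t..b}" for b
  proof (rule integrable_spike_finite[of "{t}"])
    show "(\<lambda>s. norm (l s *\<^sub>R W s t (c0_apply g s))) integrable_on {t..b}"
      by (intro integrable_continuous_interval continuous_intros continuous_on_l continuous_on_W c0) auto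
  qed (auto simp: green_kernel_def W_def)
  have int: "?f integrable_on {a..b}" for a b
  proof -
    have "?f integrable_on {min a t..max b t}"
      by (rule Henstock_Kurzweil_Integration.integrable_combine[OF _ _ left right]) auto
    then show ?thesis
      by (rule integrable_on_subinterval) auto
  qed
  have bound: "norm (green_kernel U P t s (c0_apply g s)) \<le> N * exp (- \<nu> * \<bar>lg s - lg t\<bar>) * norm g" for s
  proof -
    have "norm (green_kernel U P t s (c0_apply g s)) \<le> N * exp (- \<nu> * \<bar>lg s - lg t\<bar>) * norm (c0_apply g s)"
    proof (cases s t rule: linorder_cases)
      case less
      then show ?thesis
        using est(1)[of s t] by (simp add: green_kernel_def abs_of_nonpos)
    next
      case greater
      then show ?thesis
        using est(2)[of t s] by (simp add: green_kernel_def flip: W_def)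
    qed (use \<nu> in \<open>simp add: green_kernel_def\<close>)
    also have "\<dots> \<le> N * exp (- \<nu> * \<bar>lg s - lg t\<bar>) * norm g"
      using \<nu> norm_c0_ge by (intro mult_left_mono) auto
    finally show ?thesis .
  qed
  have "(\<lambda>s. (N * norm g) * (l s * exp (- \<nu> * \<bar>lg s - lg t\<bar>))) integrable_on UNIV"
    using exponential_has_integral[OF \<nu>(1)] by (intro integrable_on_mult_right has_integral_integrable)
  then show ?thesis
  proof (rule integrable_on_all_intervals_integrable_bound[rotated 2])
    show "(\<lambda>s. if s \<in> UNIV then ?f s else 0) integrable_on cbox a b" for a b
      using int by simp
    show "norm (?f s) \<le> (N * norm g) * (l s * exp (- \<nu> * \<bar>lg s - lg t\<bar>))" for s
      using mult_left_mono[OF bound[of s] l_nonneg[of s]] l_nonneg[of s] by (simp add: ac_simps)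
  qed
qed

end

end

lemma invertible_on_uminus:
  assumes "invertible_on D (\<lambda>w. 0 *\<^sub>C w - B w)"
  shows "invertible_on D B"
proof -
  define R where "R = inv_into D (\<lambda>w. 0 *\<^sub>C w - B w)"
  have bij: "bij_betw (\<lambda>w. - B w) D UNIV" and R: "bounded_clinear R"
    using assms by (auto simp: invertible_on_def R_def)
  have R': "R = inv_into D (\<lambda>w. - B w)"
    by (simp add: R_def)
  have R_in: "R y \<in> D" and BR: "- B (R y) = y" for y
    using bij inv_into_into[of y "\<lambda>w. - B w" D] f_inv_into_f[of y "\<lambda>w. - B w" D]
    by (auto simp: R' bij_betw_def)
  have inj: "inj_on B D"
    using bij by (auto simp: bij_betw_def inj_on_def)
  have B: "B (R (- g)) = g" for g
    using BR[of "- g"] by simp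
  have "g \<in> B ` D" for g
    by (rule image_eqI[where x = "R (- g)"]) (simp_all add: B R_in)
  then have "bij_betw B D UNIV"
    using inj by (auto simp: bij_betw_def)
  moreover have "inv_into D B = (\<lambda>g. R (- g))"
    by (intro ext inv_into_f_eq inj R_in B)
  moreover have "bounded_clinear (\<lambda>g. R (- g))"
    using R bounded_linear_compose[OF bounded_clinear_bounded_linear[OF R]
        bounded_linear_minus[OF bounded_linear_ident]]
    by (simp add: bounded_clinear_def flip: scaleC_minus_right)
  ultimately show ?thesis
    by (simp add: invertible_on_def)
qed

theorem theorem2:
  fixes h :: "real \<Rightarrow> real"
    and U :: "real \<Rightarrow> real \<Rightarrow> 'a::complex_banach \<Rightarrow> 'a"
    and T :: "real \<Rightarrow> 'a c0 \<Rightarrow> 'a c0"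
    and D :: "'a c0 set"
    and B :: "'a c0 \<Rightarrow> 'a c0"
  assumes h: "growth_rate h"
    and U: "evolution_family U"
    and U_bounded: "h_bounded h U"
    and T_def: "T = evol_semigroup h U"
    and D_def: "D = gen_domain h T"
    and B_def: "B = generator h T"
  shows "(h_hyperbolic h T \<longleftrightarrow> admits_h_dichotomy h U) \<and>
    (admits_h_dichotomy h U \<longleftrightarrow> op_spectrum D B \<inter> {z. Re z = 0} = {}) \<and>
    (admits_h_dichotomy h U \<longrightarrow> invertible_on D B) \<and>
    (\<forall>P. is_h_dichotomy h U P \<and> h C1_differentiable_on UNIV \<longrightarrow>
       (\<forall>g t. (\<lambda>s. norm ((deriv h s / h s) *\<^sub>R green_kernel U P t s (c0_apply g s)))
                  integrable_on UNIV \<and>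
              ((\<lambda>s. (deriv h s / h s) *\<^sub>R green_kernel U P t s (c0_apply g s))
                  has_integral - c0_apply (inv_into D B g) t) UNIV))"
proof -
  obtain \<alpha> K where "\<alpha> > 0" "K \<ge> 1" "\<And>t s. s \<le> t \<Longrightarrow> onorm (U t s) \<le> K * (h t / h s) powr \<alpha>"
    using U_bounded by (auto simp: h_bounded_def)
  then interpret h_evolution h U \<alpha> K
    using h U by unfold_locales
  have gen: "D = gen_domain exp S" "B = generator exp S"
    by (simp_all add: D_def B_def T_def generator_S)
  have dichotomy: "h_dichotomy h U \<alpha> K P" if "is_h_dichotomy h U P" for P
    using that by unfold_locales
  have 12: "admits_h_dichotomy h U \<Longrightarrow> h_hyperbolic h T"
    using h_dichotomy.h_hyperbolic_exp_S[OF dichotomy]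
    by (auto simp: admits_h_dichotomy_def T_def h_hyperbolic_S)
  have 23: "h_hyperbolic h T \<Longrightarrow> op_spectrum D B \<inter> {z. Re z = 0} = {}"
    unfolding gen T_def h_hyperbolic_S by (rule S.hyperbolic_imp_spectrum)
  have 0: "op_spectrum D B \<inter> {z. Re z = 0} = {} \<Longrightarrow> 0 \<in> resolvent_set D B"
    by (auto simp: op_spectrum_def)
  have 31: "op_spectrum D B \<inter> {z. Re z = 0} = {} \<Longrightarrow> admits_h_dichotomy h U"
    using 0 admits_h_dichotomy_if_resolvent unfolding gen by blast
  have inv: "invertible_on D B" if "admits_h_dichotomy h U"
    using 0[OF 23[OF 12[OF that]]] unfolding resolvent_set_def mem_Collect_eq
    by (rule invertible_on_uminus)
  have green: "(\<lambda>s. norm ((deriv h s / h s) *\<^sub>R green_kernel U P t s (c0_apply g s))) integrable_on UNIV \<and>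
      ((\<lambda>s. (deriv h s / h s) *\<^sub>R green_kernel U P t s (c0_apply g s))
        has_integral - c0_apply (inv_into D B g) t) UNIV"
    if P: "is_h_dichotomy h U P" and C1: "h C1_differentiable_on UNIV" for P g t
  proof -
    interpret P: h_dichotomy h U \<alpha> K P
      by (rule dichotomy[OF P])
    have "g \<in> B ` D"
      using inv P by (auto simp: invertible_on_def bij_betw_def admits_h_dichotomy_def)
    then have "gen_limit exp S (inv_into D B g) g"
      using gen_limit_generator[of "inv_into D B g" exp S]
      by (metis f_inv_into_f gen inv_into_into)
    with P.green_norm_integrable[OF C1 this] P.green_has_integral[OF C1 this] show ?thesis
      by (simp add: P.l_def[OF C1 \<open>gen_limit exp S (inv_into D B g) g\<close>])
  qed
  show ?thesis
    using 12 23 31 inv green by blast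
qed

end
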